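(* For every integer $d\ge2$ there are constants $B_d, C_d>0$, depending only on $d$, such that the following hold. (Upper bound) For every integer $N\ge2$ there exists an $N$-point set $Z\subset\mathbb S^d$ with $$D_{\mathrm{wedge}}(Z)\le C_d\,N^{-\frac12-\frac1{2d}}\sqrt{\log N}.$$ Moreover, for $N\ge 100d$ this holds with a constant $C_d\le 20\,d^{\frac34+\frac1{4d}}$; that is, for every $N\ge100d$ there is an $N$-point set $Z\subset\mathbb S^d$ with $D_{\mathrm{wedge}}(Z)\le 20\,d^{\frac34+\frac1{4d}}N^{-\frac12-\frac1{2d}}\sqrt{\log N}$. (Lower bound) For every integer $N\ge1$ and every set $Z\subset\mathbb S^d$ of cardinality $N$, $$D_{\mathrm{wedge}}(Z)\ge B_d\,N^{-\frac12-\frac1{2d}}.$$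
   Context: $\mathbb S^d\subset\mathbb R^{d+1}$ is the unit sphere and $\sigma$ is its surface measure normalized so that $\sigma(\mathbb S^d)=1$. For $x,y\in\mathbb S^d$ the spherical wedge is $W_{xy}=\{z\in\mathbb S^d:\ \mathrm{sgn}(x\cdot z)\ne\mathrm{sgn}(y\cdot z)\}$, with the convention $\mathrm{sgn}(t)=+1$ for $t\ge0$ and $\mathrm{sgn}(t)=-1$ for $t<0$. For an $N$-point set $Z\subset\mathbb S^d$, the wedge discrepancy is $$D_{\mathrm{wedge}}(Z)=\sup_{x,y\in\mathbb S^d}\Big|\frac{\#(Z\cap W_{xy})}{N}-\sigma(W_{xy})\Big|.$$ *)

theory Defs
  imports "HOL-Probability.Probability"
begin

text \<open>
  Surface measure on the unit sphere of \<open>\<real>\<^sup>n\<close>, with \<open>n = DIM('a)\<close>, as in integration in polar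
  coordinates: the surface measure of \<open>A\<close> is \<open>n\<close> times the Lebesgue measure of the cone
  \<open>{r *\<^sub>R u | r u. 0 < r \<and> r < 1 \<and> u \<in> A}\<close>. Note that \<open>sgn x = x /\<^sub>R norm x\<close> in a normed space.
\<close>

definition surface_measure :: "'a::euclidean_space measure" where
  "surface_measure =
     scale_measure (of_nat DIM('a))
       (distr (restrict_space lborel (ball 0 1 - {0})) (restrict_space borel (sphere 0 1)) sgn)"

definition sphere_prob :: "'a::euclidean_space measure" where
  "sphere_prob = uniform_measure surface_measure (sphere 0 1)"

text \<open>The sign convention differs from that of \<^const>\<open>sgn\<close>: the sign of \<open>0\<close> is \<open>1\<close>.\<close>

definition sign_nonneg :: "real \<Rightarrow> real" where
  "sign_nonneg t = (if t \<ge> 0 then 1 else - 1)"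

definition wedge :: "'a::euclidean_space \<Rightarrow> 'a \<Rightarrow> 'a set" where
  "wedge x y = {z \<in> sphere 0 1. sign_nonneg (x \<bullet> z) \<noteq> sign_nonneg (y \<bullet> z)}"

definition wedge_discrepancy :: "'a::euclidean_space set \<Rightarrow> real" where
  "wedge_discrepancy Z =
     (SUP (x, y) \<in> sphere 0 1 \<times> sphere 0 1.
        \<bar>real (card (Z \<inter> wedge x y)) / real (card Z) - measure sphere_prob (wedge x y)\<bar>)"

lemma space_surface_measure [simp]: "space surface_measure = sphere 0 1"
  by (simp add: surface_measure_def space_scale_measure space_restrict_space)

lemma sets_surface_measure [measurable_cong]:
  "sets surface_measure = sets (restrict_space borel (sphere 0 1))"
  by (simp add: surface_measure_def)

lemma space_sphere_prob [simp]: "space sphere_prob = sphere 0 1"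
  by (simp add: sphere_prob_def)

lemma sets_sphere_prob [measurable_cong]:
  "sets sphere_prob = sets (restrict_space borel (sphere 0 1))"
  by (simp add: sphere_prob_def sets_surface_measure)

lemma sgn_measurable_sphere:
  "(sgn :: 'a::euclidean_space \<Rightarrow> 'a) \<in>
     restrict_space lborel (ball 0 1 - {0}) \<rightarrow>\<^sub>M restrict_space borel (sphere 0 1)"
proof (rule measurable_restrict_space2)
  show "(sgn :: 'a \<Rightarrow> 'a) \<in> space (restrict_space lborel (ball 0 1 - {0})) \<rightarrow> sphere 0 1"
    by (auto simp: space_restrict_space norm_sgn)
  have "(\<lambda>x::'a. x /\<^sub>R norm x) \<in> borel_measurable borel"
    by measurable
  then have "(sgn :: 'a \<Rightarrow> 'a) \<in> borel_measurable borel"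
    by (simp add: sgn_div_norm[abs_def])
  then show "(sgn :: 'a \<Rightarrow> 'a) \<in> borel_measurable (restrict_space lborel (ball 0 1 - {0}))"
    by (intro measurable_restrict_space1) simp
qed

lemma emeasure_surface_measure:
  fixes A :: "'a::euclidean_space set"
  assumes "A \<in> sets borel" "A \<subseteq> sphere 0 1"
  shows "emeasure surface_measure A =
           of_nat DIM('a) * emeasure lborel {x \<in> ball 0 1 - {0}. sgn x \<in> A}"
proof -
  have A: "A \<in> sets (restrict_space borel (sphere 0 1))"
    using assms by (auto simp: sets_restrict_space_iff)
  have eq: "sgn -` A \<inter> space (restrict_space lborel (ball 0 1 - {0})) =
      {x \<in> ball 0 1 - {0}. sgn x \<in> A}"
    by (auto simp: space_restrict_space)
  show ?thesis
    unfolding surface_measure_def emeasure_scale_measure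
    by (subst emeasure_distr[OF sgn_measurable_sphere A], unfold eq)
       (subst emeasure_restrict_space, auto)
qed

lemma emeasure_surface_measure_sphere:
  "emeasure surface_measure (sphere 0 1 :: 'a::euclidean_space set) =
     of_nat DIM('a) * emeasure lborel (ball (0::'a) 1)"
proof -
  have "{x \<in> ball 0 1 - {0}. sgn x \<in> sphere 0 1} = ball (0::'a) 1 - {0}"
    by (auto simp: norm_sgn)
  moreover have "emeasure lborel (ball (0::'a) 1 - {0}) = emeasure lborel (ball (0::'a) 1)"
    by (rule emeasure_Diff_null_set) (auto simp: null_sets_def)
  ultimately show ?thesis
    by (subst emeasure_surface_measure) auto
qed

lemma prob_space_sphere_prob: "prob_space (sphere_prob :: 'a::euclidean_space measure)"
proof -
  have "measure lborel (ball (0::'a) 1) > 0"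
    by (intro content_ball_pos) simp
  then have "emeasure lborel (ball (0::'a) 1) \<noteq> 0"
    by (metis measure_def enn2real_0 less_irrefl)
  then show ?thesis
    unfolding sphere_prob_def
    using emeasure_lborel_ball_finite[of "0::'a" 1]
    by (intro prob_space_uniform_measure)
       (auto simp: emeasure_surface_measure_sphere ennreal_mult_eq_top_iff simp flip: ennreal_of_nat_eq_real_of_nat)
qed

lemma nn_integral_lborel_shift:
  fixes g :: "'a::euclidean_space \<Rightarrow> ennreal"
  assumes [measurable]: "g \<in> borel_measurable borel"
  shows "(\<integral>\<^sup>+x. g (c + x) \<partial>lborel) = (\<integral>\<^sup>+x. g x \<partial>lborel)"
proof -
  have "(\<integral>\<^sup>+x. g x \<partial>lborel) = (\<integral>\<^sup>+x. g x \<partial>distr lborel borel ((+) c))"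
    by (simp add: lborel_distr_plus)
  also have "\<dots> = (\<integral>\<^sup>+x. g (c + x) \<partial>lborel)"
    by (subst nn_integral_distr) auto
  finally show ?thesis by simp
qed

lemma emeasure_lborel_orthogonal_vimage:
  fixes f :: "'a::euclidean_space \<Rightarrow> 'a"
  assumes f: "orthogonal_transformation f" and A [measurable]: "A \<in> sets borel"
  shows "emeasure lborel (f -` A) = emeasure lborel A"
proof -
  have lin: "linear f" and nrm: "\<And>x. norm (f x) = norm x" and surj: "surj f"
    using f by (auto simp: orthogonal_transformation_linear orthogonal_transformation_norm
        orthogonal_transformation_surj)
  have [measurable]: "f \<in> borel_measurable borel"
    using lin by (intro borel_measurable_continuous_onI linear_continuous_on)
      (simp add: linear_conv_bounded_linear)
  have vA [measurable]: "f -` A \<in> sets borel"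
    using measurable_sets[of f borel borel A] by simp
  define B where "B = ball (0::'a) 1"
  have [measurable]: "B \<in> sets borel"
    by (simp add: B_def)
  let ?b = "emeasure lborel B"
  have "measure lborel B > 0"
    unfolding B_def by (intro content_ball_pos) simp
  then have b0: "?b \<noteq> 0"
    by (metis measure_def enn2real_0 less_irrefl)
  have binf: "?b \<noteq> \<infinity>"
    using emeasure_lborel_ball_finite[of "0::'a" 1] by (simp add: B_def)
  have shift_f: "(\<integral>\<^sup>+x. indicator A (y + f x) \<partial>lborel) = (\<integral>\<^sup>+x. indicator A (f x) \<partial>lborel)"
    (is "?L = ?R") for y
  proof -
    obtain z where z: "y = f z" using surj by blast
    have "?L = (\<integral>\<^sup>+x. indicator A (f (z + x)) \<partial>lborel)"
      by (simp add: z linear_add[OF lin])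
    also have "\<dots> = ?R"
      by (rule nn_integral_lborel_shift[where g="\<lambda>x. indicator A (f x)"]) measurable
    finally show ?thesis .
  qed
  have ball_f: "(\<integral>\<^sup>+x. indicator B (y - f x) \<partial>lborel) = ?b" for y
  proof -
    obtain z where z: "y = f z" using surj by blast
    have "indicator B (y - f x) = (indicator B (- z + x) :: ennreal)" for x
    proof -
      have "norm (y - f x) = norm (- z + x)"
        by (simp add: z nrm norm_minus_commute flip: linear_diff[OF lin])
      then show ?thesis by (auto simp: indicator_def B_def)
    qed
    then have "(\<integral>\<^sup>+x. indicator B (y - f x) \<partial>lborel) = (\<integral>\<^sup>+x. indicator B (- z + x) \<partial>lborel)"
      by simp
    also have "\<dots> = (\<integral>\<^sup>+x. indicator B x \<partial>lborel)"
      by (rule nn_integral_lborel_shift) measurable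
    finally show ?thesis by simp
  qed
  have "emeasure lborel (f -` A) * ?b = (\<integral>\<^sup>+x. indicator A (f x) \<partial>lborel) * ?b"
  proof -
    have "(\<integral>\<^sup>+x. indicator A (f x) \<partial>lborel) = (\<integral>\<^sup>+x. indicator (f -` A) x \<partial>lborel)"
      by (simp add: indicator_def)
    then show ?thesis using vA by simp
  qed
  also have "\<dots> = (\<integral>\<^sup>+y. (\<integral>\<^sup>+x. indicator A (f x) \<partial>lborel) * indicator B y \<partial>lborel)"
    by (simp add: nn_integral_cmult)
  also have "\<dots> = (\<integral>\<^sup>+y. (\<integral>\<^sup>+x. indicator A (y + f x) * indicator B y \<partial>lborel) \<partial>lborel)"
    by (subst nn_integral_multc) (simp_all add: shift_f)
  also have "\<dots> = (\<integral>\<^sup>+x. (\<integral>\<^sup>+y. indicator A (y + f x) * indicator B y \<partial>lborel) \<partial>lborel)"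
    by (rule lborel_pair.Fubini') measurable
  also have "\<dots> = (\<integral>\<^sup>+x. (\<integral>\<^sup>+y. indicator A y * indicator B (y - f x) \<partial>lborel) \<partial>lborel)"
  proof (rule nn_integral_cong)
    fix x
    have "(\<integral>\<^sup>+y. indicator A (f x + y) * indicator B (f x + y - f x) \<partial>lborel) =
        (\<integral>\<^sup>+y. indicator A y * indicator B (y - f x) \<partial>lborel)"
      by (rule nn_integral_lborel_shift[where g="\<lambda>y. indicator A y * indicator B (y - f x)"])
        measurable
    then show "(\<integral>\<^sup>+y. indicator A (y + f x) * indicator B y \<partial>lborel) =
        (\<integral>\<^sup>+y. indicator A y * indicator B (y - f x) \<partial>lborel)"
      by (simp add: add.commute)
  qed
  also have "\<dots> = (\<integral>\<^sup>+y. (\<integral>\<^sup>+x. indicator A y * indicator B (y - f x) \<partial>lborel) \<partial>lborel)"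
    by (rule lborel_pair.Fubini') measurable
  also have "\<dots> = (\<integral>\<^sup>+y. indicator A y * ?b \<partial>lborel)"
    by (subst nn_integral_cmult) (simp_all add: ball_f)
  also have "\<dots> = emeasure lborel A * ?b"
    by (subst nn_integral_multc) simp_all
  finally show ?thesis
    using b0 binf by (simp add: ennreal_mult_cancel_left mult.commute[of _ "emeasure lborel B"])
qed

lemma distr_sphere_prob_orthogonal:
  fixes f :: "'a::euclidean_space \<Rightarrow> 'a"
  assumes f: "orthogonal_transformation f"
  shows "distr sphere_prob sphere_prob f = sphere_prob"
proof (rule measure_eqI)
  show "sets (distr sphere_prob sphere_prob f) = sets sphere_prob"
    by simp
next
  fix A :: "'a set"
  assume "A \<in> sets (distr sphere_prob sphere_prob f)"
  then have A: "A \<in> sets borel" "A \<subseteq> sphere 0 1"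
    by (auto simp: sets_sphere_prob sets_restrict_space_iff)
  have lin: "linear f" and nrm: "\<And>x. norm (f x) = norm x"
    using f by (auto simp: orthogonal_transformation_linear orthogonal_transformation_norm)
  have fm: "f \<in> borel_measurable borel"
    using lin by (intro borel_measurable_continuous_onI linear_continuous_on)
      (simp add: linear_conv_bounded_linear)
  have vA: "f -` A \<in> sets borel" "f -` A \<subseteq> sphere 0 1"
    using measurable_sets[OF fm A(1)] A(2) nrm by auto
  define C where "C = (\<lambda>A::'a set. {x \<in> ball 0 1 - {0}. sgn x \<in> A})"
  have C: "C A \<in> sets borel"
  proof -
    have "A \<in> sets (restrict_space borel (sphere 0 1))"
      using A by (auto simp: sets_restrict_space_iff)
    from measurable_sets[OF sgn_measurable_sphere this]
    show ?thesis
      by (auto simp: sets_restrict_space_iff space_restrict_space C_def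
          vimage_def Int_def conj_commute conj_left_commute)
  qed
  have "sgn (f x) = f (sgn x)" for x
    by (simp add: sgn_div_norm nrm linear_scale[OF lin])
  moreover have "f x = 0 \<longleftrightarrow> x = 0" for x
    using nrm[of x] by (metis norm_eq_zero)
  ultimately have "C (f -` A) = f -` C A"
    by (auto simp: C_def nrm)
  then have "emeasure lborel (C (f -` A)) = emeasure lborel (C A)"
    using emeasure_lborel_orthogonal_vimage[OF f C] by simp
  then have eq: "emeasure surface_measure (f -` A) = emeasure surface_measure A"
    using A vA by (simp add: emeasure_surface_measure C_def)
  have sets: "B \<in> sets surface_measure" "B \<in> sets sphere_prob"
    if "B \<in> sets borel" "B \<subseteq> sphere 0 1" for B :: "'a set"
    using that by (auto simp: sets_surface_measure sets_sphere_prob sets_restrict_space_iff)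
  have S: "sphere 0 1 \<in> sets (surface_measure :: 'a measure)"
    by (intro sets) auto
  have "f \<in> sphere_prob \<rightarrow>\<^sub>M sphere_prob"
    unfolding measurable_cong_sets[OF sets_sphere_prob sets_sphere_prob]
    using fm by (intro measurable_restrict_space3) (auto simp: nrm)
  then have "emeasure (distr sphere_prob sphere_prob f) A = emeasure sphere_prob (f -` A)"
    using vA(2) by (simp add: emeasure_distr sets A Int_absorb2)
  also have "\<dots> = emeasure sphere_prob A"
    unfolding sphere_prob_def using A vA eq S sets
    by (simp add: Int_absorb1)
  finally show "emeasure (distr sphere_prob sphere_prob f) A = emeasure sphere_prob A" .
qed

lemma wedge_in_sets [measurable]: "wedge x y \<in> sets sphere_prob"
proof -
  have "wedge x y = {z \<in> space borel. norm z = 1 \<and> (x \<bullet> z \<ge> 0) \<noteq> (y \<bullet> z \<ge> 0)}"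
    by (auto simp: wedge_def sign_nonneg_def split: if_splits)
  also have "\<dots> \<in> sets borel"
    by measurable
  finally show ?thesis
    by (auto simp: sets_sphere_prob sets_restrict_space_iff wedge_def)
qed

lemma bdd_above_wedge_discrepancy:
  fixes Z :: "'a::euclidean_space set"
  shows "bdd_above ((\<lambda>(x, y). \<bar>real (card (Z \<inter> wedge x y)) / real (card Z)
     - measure sphere_prob (wedge x y)\<bar>) ` (sphere 0 1 \<times> sphere 0 1))"
proof -
  interpret prob_space "sphere_prob :: 'a measure" by (rule prob_space_sphere_prob)
  have "real (card (Z \<inter> wedge x y)) / real (card Z) \<le> 1" for x y
    by (cases "finite Z") (auto simp: divide_le_eq_1 card_gt_0_iff intro!: card_mono)
  moreover have "0 \<le> real (card (Z \<inter> wedge x y)) / real (card Z)" for x y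
    by simp
  ultimately have "\<bar>real (card (Z \<inter> wedge x y)) / real (card Z) - prob (wedge x y)\<bar> \<le> 1" for x y
    using prob_le_1[of "wedge x y"] measure_nonneg[of sphere_prob "wedge x y"]
    by (smt (verit))
  then show ?thesis
    by (intro bdd_aboveI[of _ 1]) auto
qed

end

theory Submission
  imports Defs
begin

text \<open>
  Lower bound: by Fubini, the mean of the squared discrepancy over all wedges is the energy of
  \<open>\<nu> = (1/N) \<Sum> \<delta>\<^sub>z - \<sigma>\<close> for the kernel \<open>(1/\<pi> arcsin (z \<bullet> w))\<^sup>2\<close>. The expansion of this kernel in powers
  \<open>(z \<bullet> w)\<^sup>2\<^sup>m\<close> has coefficients at least a multiple of \<open>m powr (-3/2)\<close>, and each power is positive
  definite. Its energy is at least \<open>1/N\<close>, from the diagonal, minus the moment \<open>E z\<^sub>1\<^sup>2\<^sup>m\<close>, which is below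
  \<open>1/(2N)\<close> once \<open>m\<close> exceeds a multiple of \<open>N powr (2/d)\<close>. Summing over \<open>M \<le> m < 2M\<close> with
  \<open>M \<approx> N powr (2/d)\<close> gives \<open>M powr (-1/2) / N \<approx> N powr (-1 - 1/d)\<close>.

  Upper bound: decompose \<open>N \<sigma>\<close> into \<open>N\<close> probability measures supported in caps of radius
  \<open>O(N powr (-1/d))\<close> and draw one point from each. Only the caps meeting one of the two great spheres that
  bound a wedge contribute to its random discrepancy; their number is \<open>O(\<surd>d N powr (1 - 1/d))\<close>.
  Hoeffding's inequality and a union bound over brackets of wedges with poles in a net conclude. As long
  as \<open>N powr (1/d)\<close> is at most a multiple of \<open>\<surd>d\<close>, independent uniform points are good enough.
\<close>

subsection \<open>Caps and bands on the sphere\<close>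

text \<open>The obstacle in the upper bound is that N is arbitrary: the cells of a net have masses
  that are at least 1/N but not multiples of 1/N. Instead of cutting the sphere into equal pieces,
  the excess fractions are passed between neighbouring cells until every cell holds a whole number
  of units. Connectedness of the sphere makes this possible with supports only a bounded factor
  larger than the cells. The resulting measures may overlap; only their sum and their supports
  matter.

  The power 3/4 of d has two sources: the measure of a band contributes sqrt d to the number of
  draws that stay random, and the family of brackets has N powr O(d) members, so Hoeffding's
  exponent must be of order d log N. The squared deviation is thus of order d * sqrt d, up to the
  dependence on N.

  In the lower bound the mixed term of the squared deviation equals the self-energy of \<sigma>. The
  mean square is therefore the energy of the points minus that of \<sigma>, and term by term a
  difference that is nonnegative. Hence all m outside the chosen range may be dropped.\<close>

text \<open>The reflection in the hyperplane orthogonal to \<open>a - b\<close>. That it fixes this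
  hyperplane is what lets two vectors be moved one after the other.\<close>

lemma ex_orthogonal_transformation_swap:
  fixes a b :: "'a::euclidean_space"
  assumes "norm a = norm b"
  obtains f where "orthogonal_transformation f" "f a = b" "\<And>u. u \<bullet> (a - b) = 0 \<Longrightarrow> f u = u"
proof (cases "a = b")
  case True
  then show ?thesis
    using that[of id] by (simp add: orthogonal_transformation_id[unfolded id_def[symmetric]] id_def)
next
  case False
  define w where "w = a - b"
  define f where "f x = x - (2 * (x \<bullet> w) / (w \<bullet> w)) *\<^sub>R w" for x
  have w: "w \<bullet> w \<noteq> 0" using False by (simp add: w_def)
  have "linear f"
  proof (rule linearI)
    show "f (x + y) = f x + f y" for x y
      unfolding f_def inner_add_left distrib_left add_divide_distrib scaleR_add_left by simp
    show "f (r *\<^sub>R x) = r *\<^sub>R f x" for r x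
      unfolding f_def by (simp add: scaleR_diff_right)
  qed
  moreover have "f x \<bullet> f y = x \<bullet> y" for x y
    using w inner_commute[of w y] by (simp add: f_def inner_diff_left inner_diff_right)
  ultimately have "orthogonal_transformation f"
    by (simp add: orthogonal_transformation_def)
  moreover have "f a = b"
  proof -
    have "a \<bullet> a = b \<bullet> b" using assms by (simp add: norm_eq)
    then have "2 * (a \<bullet> w) = w \<bullet> w"
      by (simp add: w_def inner_diff_left inner_diff_right inner_commute)
    then show ?thesis using w by (simp add: f_def) (simp add: w_def)
  qed
  ultimately show ?thesis
    using that[of f] by (simp add: f_def w_def)
qed

text \<open>Two reflections suffice: the second one carries \<open>g v\<close> to \<open>v'\<close>,
  and it leaves \<open>u'\<close> in place because equal inner products make \<open>u'\<close>
  orthogonal to \<open>g v - v'\<close>.\<close>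

lemma ex_orthogonal_transformation_pair:
  fixes u v u' v' :: "'a::euclidean_space"
  assumes "norm u = norm u'" "norm v = norm v'" "u \<bullet> v = u' \<bullet> v'"
  obtains f where "orthogonal_transformation f" "f u = u'" "f v = v'"
proof -
  obtain g where g: "orthogonal_transformation g" "g u = u'"
    using ex_orthogonal_transformation_swap[OF assms(1)] by metis
  have gi: "g x \<bullet> g y = x \<bullet> y" for x y
    using g(1) by (simp add: orthogonal_transformation_def)
  have "norm (g v) = norm v'"
    using assms(2) orthogonal_transformation_norm[OF g(1)] by simp
  then obtain h where h: "orthogonal_transformation h" "h (g v) = v'"
      "\<And>w. w \<bullet> (g v - v') = 0 \<Longrightarrow> h w = w"
    using ex_orthogonal_transformation_swap by metis
  have "u' \<bullet> (g v - v') = 0"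
    using gi[of u v] g(2) assms(3) by (simp add: inner_diff_right)
  then have "h u' = u'" by (rule h(3))
  then show ?thesis
    using that[of "h \<circ> g"] g h(1,2) by (simp add: orthogonal_transformation_compose)
qed

lemma borel_measurable_sphere_prob [measurable (raw)]:
  "f \<in> borel \<rightarrow>\<^sub>M M \<Longrightarrow> f \<in> sphere_prob \<rightarrow>\<^sub>M M"
  using measurable_cong_sets[OF sets_sphere_prob refl, of M] measurable_restrict_space1 by blast

lemma sets_sphere_probI:
  "A \<in> sets borel \<Longrightarrow> A \<subseteq> sphere 0 1 \<Longrightarrow> A \<in> sets sphere_prob"
  by (auto simp: sets_sphere_prob sets_restrict_space_iff)

lemma orthogonal_transformation_measurable:
  fixes f :: "'a::euclidean_space \<Rightarrow> 'a"
  assumes f: "orthogonal_transformation f"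
  shows "f \<in> borel_measurable borel" "f \<in> sphere_prob \<rightarrow>\<^sub>M sphere_prob"
proof -
  show 1: "f \<in> borel_measurable borel"
    using f by (intro borel_measurable_continuous_onI linear_continuous_on)
      (simp add: linear_conv_bounded_linear orthogonal_transformation_def)
  show "f \<in> sphere_prob \<rightarrow>\<^sub>M sphere_prob"
    unfolding measurable_cong_sets[OF sets_sphere_prob sets_sphere_prob]
    using 1 by (intro measurable_restrict_space3) (auto simp: orthogonal_transformation_norm[OF f])
qed

lemma integral_sphere_prob_orthogonal:
  fixes f :: "'a::euclidean_space \<Rightarrow> 'a" and h :: "'a \<Rightarrow> real"
  assumes f: "orthogonal_transformation f" and h: "h \<in> borel_measurable borel"
  shows "(\<integral>x. h (f x) \<partial>sphere_prob) = (\<integral>x. h x \<partial>sphere_prob)"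
proof -
  have "(\<integral>x. h x \<partial>sphere_prob) = (\<integral>x. h x \<partial>distr sphere_prob sphere_prob f)"
    by (simp add: distr_sphere_prob_orthogonal[OF f])
  also have "\<dots> = (\<integral>x. h (f x) \<partial>sphere_prob)"
    using h by (intro integral_distr orthogonal_transformation_measurable[OF f]) measurable
  finally show ?thesis by simp
qed

lemma measure_sphere_prob_orthogonal:
  fixes f :: "'a::euclidean_space \<Rightarrow> 'a"
  assumes f: "orthogonal_transformation f" and A: "A \<in> sets sphere_prob"
  shows "measure sphere_prob (f -` A) = measure sphere_prob A"
proof -
  have "A \<subseteq> sphere 0 1" using sets.sets_into_space[OF A] by simp
  then have "f -` A \<subseteq> sphere 0 1" by (auto simp: orthogonal_transformation_norm[OF f])
  then show ?thesis
    using measure_distr[OF orthogonal_transformation_measurable(2)[OF f] A]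
    by (simp add: distr_sphere_prob_orthogonal[OF f] Int_absorb2)
qed

lemma measure_sphere_prob_cap_cong:
  fixes x y :: "'a::euclidean_space"
  assumes "norm x = norm y"
  shows "measure sphere_prob (ball x r \<inter> sphere 0 1) = measure sphere_prob (ball y r \<inter> sphere 0 1)"
proof -
  obtain f where f: "orthogonal_transformation f" "f x = y"
    using ex_orthogonal_transformation_swap[OF assms] by metis
  have "dist (f u) (f v) = dist u v" for u v
    using f(1) by (simp add: orthogonal_transformation_isometry)
  then have "ball x r \<inter> sphere 0 1 = f -` (ball y r \<inter> sphere 0 1)"
    using f(2) by (auto simp: orthogonal_transformation_norm[OF f(1)] simp flip: f(2))
  then show ?thesis
    using measure_sphere_prob_orthogonal[OF f(1), of "ball y r \<inter> sphere 0 1"]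
    by (simp add: sets_sphere_probI)
qed

section \<open>Packing and covering of the sphere by caps\<close>

text \<open>Disjoint balls of radius \<open>h = \<delta> / 2\<close> about the points all lie in the
  shell between the radii \<open>1 - h\<close> and \<open>1 + h\<close>. The volume of the shell has
  a factor \<open>h\<close>, which cancels one of the \<open>n\<close> factors of the volume of a
  small ball; this brings the exponent down to the dimension of the sphere.\<close>

lemma separated_card_le:
  fixes C :: "'a::euclidean_space set"
  assumes C: "finite C" "C \<subseteq> sphere 0 1" "pairwise (\<lambda>x y. \<delta> \<le> dist x y) C"
    and \<delta>: "0 < \<delta>" "\<delta> \<le> 2"
  shows "real (card C) \<le> 2 * real DIM('a) * (1 + 2 / \<delta>) ^ (DIM('a) - 1)"
proof -
  define n where "n = DIM('a)"
  define v where "v = unit_ball_vol (real n)"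
  define h where "h = \<delta> / 2"
  have h: "0 < h" "h \<le> 1" using \<delta> by (auto simp: h_def)
  have v: "v > 0" by (simp add: v_def)
  have n: "n > 0" by (simp add: n_def)
  have vol: "measure lborel (ball c r :: 'a set) = v * r ^ n" if "r \<ge> 0" for c r
    using that by (simp add: content_ball v_def n_def)
  have fm: "ball c r \<in> fmeasurable lborel" for c :: 'a and r
    using emeasure_lborel_ball_finite[of c r] by (auto simp: fmeasurable_def less_top)
  have disj: "disjoint_family_on (\<lambda>c. ball c h) C"
  proof (unfold disjoint_family_on_def, intro ballI impI)
    fix x y assume "x \<in> C" "y \<in> C" "x \<noteq> y"
    then have "\<delta> \<le> dist x y" using C(3) by (auto simp: pairwise_def)
    then show "ball x h \<inter> ball y h = {}"
      by (auto simp: h_def) (smt (verit, best) dist_commute dist_triangle_half_l field_sum_of_halves mem_ball dist_triangle2)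
  qed
  have "real (card C) * (v * h ^ n) = (\<Sum>c\<in>C. measure lborel (ball c h :: 'a set))"
    using h by (simp add: vol)
  also have "\<dots> = measure lborel (\<Union>c\<in>C. ball c h)"
    using C(1) disj fmeasurableD2[OF fm] by (intro measure_finite_Union[symmetric]) auto
  also have "\<dots> \<le> measure lborel (ball (0::'a) (1 + h) - ball 0 (1 - h))"
  proof (rule measure_mono_fmeasurable)
    show "(\<Union>c\<in>C. ball c h) \<subseteq> ball 0 (1 + h) - ball 0 (1 - h)"
    proof safe
      fix c x assume cx: "c \<in> C" "x \<in> ball c h"
      then have c: "norm c = 1" using C(2) by auto
      have "norm x < 1 + h" "norm x > 1 - h"
        using cx c norm_triangle_ineq2[of c x] norm_triangle_ineq2[of x c]
        by (auto simp: dist_norm norm_minus_commute)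
      then show "x \<in> ball 0 (1 + h)" "x \<in> ball 0 (1 - h) \<Longrightarrow> False" by auto
    qed
    show "(\<Union>c\<in>C. ball c h) \<in> sets lborel" by (simp add: C(1) open_UN)
    show "ball (0::'a) (1 + h) - ball 0 (1 - h) \<in> fmeasurable lborel"
      using fm by (intro fmeasurable.Diff) auto
  qed
  also have "\<dots> = v * (1 + h) ^ n - v * (1 - h) ^ n"
    using h fmeasurableD2[OF fm] by (subst measure_Diff) (auto simp: vol)
  also have "\<dots> = v * ((1 + h) ^ n - (1 - h) ^ n)" by (simp add: algebra_simps)
  also have "(1 + h) ^ n - (1 - h) ^ n \<le> 2 * real n * h * (1 + h) ^ (n - 1)"
  proof -
    have "(1 + h) ^ n - (1 - h) ^ n = 2 * h * (\<Sum>i<n. (1 - h) ^ (n - Suc i) * (1 + h) ^ i)"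
      using power_diff_sumr2[of "1 + h" n "1 - h"] by simp
    also have "(\<Sum>i<n. (1 - h) ^ (n - Suc i) * (1 + h) ^ i) \<le> (\<Sum>i<n. (1 + h) ^ (n - 1))"
    proof (rule sum_mono)
      fix i assume i: "i \<in> {..<n}"
      have "(1 - h) ^ (n - Suc i) * (1 + h) ^ i \<le> (1 + h) ^ (n - Suc i) * (1 + h) ^ i"
        using h by (intro mult_right_mono power_mono) auto
      also have "\<dots> = (1 + h) ^ (n - 1)"
        using i by (simp flip: power_add)
      finally show "(1 - h) ^ (n - Suc i) * (1 + h) ^ i \<le> (1 + h) ^ (n - 1)" .
    qed
    finally show ?thesis using h by (simp add: mult_ac)
  qed
  finally have "real (card C) * h ^ n \<le> 2 * real n * h * (1 + h) ^ (n - 1)"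
    using v by (simp add: mult.left_commute[of _ v])
  also have "h ^ n = h * h ^ (n - 1)" using n by (cases n) auto
  finally have "real (card C) * h ^ (n - 1) \<le> 2 * real n * (1 + h) ^ (n - 1)"
    using h by (simp add: mult_ac)
  then have "real (card C) \<le> 2 * real n * ((1 + h) ^ (n - 1) / h ^ (n - 1))"
    using h by (simp add: field_simps)
  also have "(1 + h) ^ (n - 1) / h ^ (n - 1) = (1 + 2 / \<delta>) ^ (n - 1)"
  proof -
    have "(1 + h) / h = 1 + 2 / \<delta>" using \<delta> by (simp add: h_def field_simps)
    then show ?thesis by (simp flip: power_divide)
  qed
  finally show ?thesis by (simp add: n_def)
qed

lemma ex_maximal_separated:
  assumes \<delta>: "0 < \<delta>" "\<delta> \<le> 2"
  obtains C :: "'a::euclidean_space set" where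
    "finite C" "C \<subseteq> sphere 0 1" "C \<noteq> {}" "pairwise (\<lambda>x y. \<delta> \<le> dist x y) C"
    "sphere 0 1 \<subseteq> (\<Union>c\<in>C. ball c \<delta>)"
    "real (card C) \<le> 2 * real DIM('a) * (1 + 2 / \<delta>) ^ (DIM('a) - 1)"
proof -
  let ?P = "\<lambda>C::'a set. finite C \<and> C \<subseteq> sphere 0 1 \<and> pairwise (\<lambda>x y. \<delta> \<le> dist x y) C"
  define b where "b = 2 * real DIM('a) * (1 + 2 / \<delta>) ^ (DIM('a) - 1)"
  have "\<forall>C. ?P C \<longrightarrow> card C < Suc (nat \<lfloor>b\<rfloor>)"
  proof (intro allI impI)
    fix C assume "?P C"
    then have "real (card C) \<le> b" using separated_card_le[of C \<delta>] \<delta> by (auto simp: b_def)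
    then show "card C < Suc (nat \<lfloor>b\<rfloor>)" by linarith
  qed
  moreover have "?P {}" by simp
  ultimately obtain C where C: "?P C" and mx: "\<And>D. ?P D \<Longrightarrow> card D \<le> card C"
    using ex_has_greatest_nat[of ?P "{}" card] by metis
  have cov: "sphere 0 1 \<subseteq> (\<Union>c\<in>C. ball c \<delta>)"
  \<comment> \<open>An uncovered point could be added to \<open>C\<close>, against
    maximality.\<close>
  proof (rule ccontr)
    assume "\<not> ?thesis"
    then obtain x where x: "norm x = 1" "\<And>c. c \<in> C \<Longrightarrow> \<delta> \<le> dist c x" by (force simp: not_less)
    have "x \<notin> C" using x(2)[of x] \<delta> by auto
    moreover have "?P (insert x C)"
      using C x by (auto simp: pairwise_insert dist_commute)
    ultimately show False using mx[of "insert x C"] C by simp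
  qed
  obtain z :: 'a where "norm z = 1"
    using vector_choose_size[of 1] by auto
  then have "C \<noteq> {}" using cov by auto
  then show ?thesis
    using that[of C] C cov separated_card_le[of C \<delta>] \<delta> by blast
qed

text \<open>The caps about a maximal \<open>\<rho>\<close>-separated set cover the sphere and are
  congruent, so each has at least the average share.\<close>

lemma measure_cap_ge:
  fixes x :: "'a::euclidean_space"
  assumes x: "norm x = 1" and \<rho>: "0 < \<rho>" "\<rho> \<le> 2"
  shows "1 \<le> 2 * real DIM('a) * (1 + 2 / \<rho>) ^ (DIM('a) - 1) * measure sphere_prob (ball x \<rho> \<inter> sphere 0 1)"
proof -
  interpret prob_space "sphere_prob :: 'a measure" by (rule prob_space_sphere_prob)
  obtain C :: "'a set" where C: "finite C" "C \<subseteq> sphere 0 1" "sphere 0 1 \<subseteq> (\<Union>c\<in>C. ball c \<rho>)"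
    "real (card C) \<le> 2 * real DIM('a) * (1 + 2 / \<rho>) ^ (DIM('a) - 1)"
    using ex_maximal_separated[OF \<rho>] by metis
  have "1 = prob (sphere 0 1)" using prob_space by simp
  also have "\<dots> = prob (\<Union>c\<in>C. ball c \<rho> \<inter> sphere 0 1)"
    using C(3) by (intro arg_cong[where f = prob]) auto
  also have "\<dots> \<le> (\<Sum>c\<in>C. prob (ball c \<rho> \<inter> sphere 0 1))"
    using C(1) by (intro finite_measure_subadditive_finite) (auto intro!: sets_sphere_probI)
  also have "\<dots> = (\<Sum>c\<in>C. prob (ball x \<rho> \<inter> sphere 0 1))"
    using C(2) x by (intro sum.cong measure_sphere_prob_cap_cong) auto
  also have "\<dots> \<le> 2 * real DIM('a) * (1 + 2 / \<rho>) ^ (DIM('a) - 1) * prob (ball x \<rho> \<inter> sphere 0 1)"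
    using C(4) by (simp add: mult_right_mono)
  finally show ?thesis .
qed


section \<open>Volumes of slabs and measures of bands\<close>

text \<open>The slab lies in the product of \<open>{-e..e}\<close> and a unit ball of one dimension
  less. That ball lives in the product space over \<open>Basis - {b}\<close>, so no Euclidean type
  of the smaller dimension enters.\<close>

lemma emeasure_lborel_slab_le:
  fixes b :: "'a::euclidean_space"
  assumes b: "b \<in> Basis" and e: "e \<ge> 0"
  shows "emeasure lborel {x. norm x \<le> 1 \<and> \<bar>x \<bullet> b\<bar> \<le> e}
           \<le> ennreal (2 * e * unit_ball_vol (real (DIM('a) - 1)))"
proof -
  interpret product_sigma_finite "\<lambda>_. lborel :: real measure"
    by standard
  define A where "A = Basis - {b}"
  have A: "finite A" "b \<notin> A" "insert b A = Basis" "card A = DIM('a) - 1"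
    using b by (auto simp: A_def card_Diff_singleton)
  define S where "S = {x. norm x \<le> 1 \<and> \<bar>x \<bullet> b\<bar> \<le> e}"
  have S [measurable]: "S \<in> sets borel" unfolding S_def by measurable
  let ?P = "Pi\<^sub>M A (\<lambda>_. lborel :: real measure)"
  define D where "D = {f. sqrt (\<Sum>i\<in>A. (f i)\<^sup>2) \<le> 1} \<inter> space ?P"
  have D: "D \<in> sets ?P" unfolding D_def by measurable
  have "emeasure lborel S = (\<integral>\<^sup>+x. indicator S x \<partial>lborel)" by simp
  also have "\<dots> = (\<integral>\<^sup>+f. indicator S (\<Sum>k\<in>Basis. f k *\<^sub>R k) \<partial>Pi\<^sub>M Basis (\<lambda>_. lborel))"
    by (subst lborel_eq, subst nn_integral_distr) auto
  also have "\<dots> = (\<integral>\<^sup>+f. indicator S (\<Sum>k\<in>Basis. f k *\<^sub>R k) \<partial>Pi\<^sub>M (insert b A) (\<lambda>_. lborel))"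
    by (simp add: A)
  also have "\<dots> = (\<integral>\<^sup>+y. \<integral>\<^sup>+f. indicator S (\<Sum>k\<in>Basis. (f(b := y)) k *\<^sub>R k) \<partial>?P \<partial>lborel)"
    using A by (subst product_nn_integral_insert_rev) auto
  also have "\<dots> \<le> (\<integral>\<^sup>+y. \<integral>\<^sup>+f. indicator {-e..e} y * indicator D f \<partial>?P \<partial>lborel)"
  proof (intro nn_integral_mono)
    fix y :: real and f :: "'a \<Rightarrow> real"
    assume f: "f \<in> space ?P"
    let ?x = "\<Sum>k\<in>Basis. (f(b := y)) k *\<^sub>R k"
    have c: "?x \<bullet> k = (f(b := y)) k" if "k \<in> Basis" for k
      using that by (rule inner_sum_left_Basis)
    have "(norm ?x)\<^sup>2 = (\<Sum>k\<in>Basis. (?x \<bullet> k)\<^sup>2)"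
      unfolding power2_norm_eq_inner by (subst euclidean_inner) (simp add: power2_eq_square)
    also have "\<dots> = (\<Sum>k\<in>insert b A. ((f(b := y)) k)\<^sup>2)"
      unfolding A(3) by (intro sum.cong refl) (simp only: c)
    also have "\<dots> = y\<^sup>2 + (\<Sum>k\<in>A. ((f(b := y)) k)\<^sup>2)"
      using A(1,2) by (subst sum.insert) auto
    also have "(\<Sum>k\<in>A. ((f(b := y)) k)\<^sup>2) = (\<Sum>k\<in>A. (f k)\<^sup>2)"
      using A by (intro sum.cong) auto
    finally have nx: "(norm ?x)\<^sup>2 = y\<^sup>2 + (\<Sum>k\<in>A. (f k)\<^sup>2)" .
    have "?x \<in> S \<Longrightarrow> y \<in> {-e..e} \<and> f \<in> D"
    proof -
      assume x: "?x \<in> S"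
      have "(norm ?x)\<^sup>2 \<le> 1" using x by (simp add: S_def abs_square_le_1)
      then have "sqrt (\<Sum>i\<in>A. (f i)\<^sup>2) \<le> 1"
        unfolding nx real_sqrt_le_1_iff by (smt (verit) zero_le_power2)
      then show ?thesis using x f c[OF b] by (auto simp: S_def D_def)
    qed
    then show "indicator S ?x \<le> (indicator {-e..e} y * indicator D f :: ennreal)"
      by (auto simp: indicator_def)
  qed
  also have "\<dots> = (\<integral>\<^sup>+y. indicator {-e..e} y * emeasure ?P D \<partial>lborel)"
    using D by (subst nn_integral_cmult) auto
  also have "\<dots> = ennreal (2 * e) * emeasure ?P D"
    using e by (subst nn_integral_multc) auto
  also have "emeasure ?P D = ennreal (unit_ball_vol (real (DIM('a) - 1)))"
    unfolding D_def using emeasure_cball_aux[OF A(1), of 1] by (simp add: A)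
  finally show ?thesis
    using e by (simp add: S_def ennreal_mult'')
qed

text \<open>Log-convexity of Gamma at the midpoint of \<open>x\<close> and
  \<open>x + 1\<close>.\<close>

lemma Gamma_plus_half_le:
  fixes x :: real
  assumes "x > 0"
  shows "Gamma (x + 1 / 2) \<le> sqrt x * Gamma x"
proof -
  have "(ln \<circ> Gamma) ((1 - 1/2) *\<^sub>R x + (1/2) *\<^sub>R (x + 1)) \<le> (1 - 1/2) * (ln \<circ> Gamma) x + (1/2) * (ln \<circ> Gamma) (x + 1)"
    using assms by (intro convex_onD[OF log_convex_Gamma_real]) auto
  moreover have "(1 - 1/2) *\<^sub>R x + (1/2) *\<^sub>R (x + 1) = x + 1/2" by (simp add: field_simps)
  ultimately have *: "ln (Gamma (x + 1/2)) \<le> (1/2) * ln (Gamma x) + (1/2) * ln (Gamma (x + 1))"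
    by simp
  have G: "Gamma (x + 1) = x * Gamma x"
    using assms by (intro Gamma_plus1) (auto elim!: nonpos_Ints_cases)
  have pos: "Gamma x > 0" "Gamma (x + 1/2) > 0" "Gamma (x+1) > 0"
    using assms by (auto intro!: Gamma_real_pos)
  have "ln (Gamma (x + 1/2)) \<le> ln (sqrt x * Gamma x)"
    using * unfolding G ln_mult_pos[OF assms pos(1)] ln_mult_pos[OF real_sqrt_gt_zero[OF assms] pos(1)] ln_sqrt[OF less_imp_le[OF assms]] by argo
  then show ?thesis using pos assms by simp
qed

lemma unit_ball_vol_ratio_le:
  assumes "n \<ge> 1"
  shows "unit_ball_vol (real (n - 1)) \<le> sqrt ((real n + 1) / (2 * pi)) * unit_ball_vol (real n)"
proof -
  define x where "x = (real n + 1) / 2"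
  have x: "x > 0" by (simp add: x_def)
  have n1: "real (n - 1) / 2 + 1 = x" using assms by (simp add: x_def field_simps)
  have n2: "real n / 2 + 1 = x + 1/2" by (simp add: x_def field_simps)
  have pos: "Gamma x > 0" "Gamma (x + 1/2) > 0" using x by (auto intro!: Gamma_real_pos)
  have "pi powr (real n / 2) = pi powr (real (n - 1) / 2 + 1/2)" using n1 n2 by (intro arg_cong[where f = "(powr) pi"]) linarith
  also have "\<dots> = pi powr (real (n - 1) / 2) * sqrt pi" by (subst powr_add) (simp add: powr_half_sqrt)
  finally have p: "pi powr (real n / 2) = pi powr (real (n - 1) / 2) * sqrt pi" .
  have "(real n + 1) / (2 * pi) = x / pi" by (simp add: x_def)
  then have s: "sqrt ((real n + 1) / (2 * pi)) = sqrt x / sqrt pi" by (simp add: real_sqrt_divide)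
  have "1 / Gamma x \<le> sqrt x / Gamma (x + 1/2)"
    using Gamma_plus_half_le[OF x] pos by (simp add: field_simps)
  then have "pi powr (real (n - 1) / 2) * (1 / Gamma x) \<le> pi powr (real (n - 1) / 2) * (sqrt x / Gamma (x + 1/2))"
    by (intro mult_left_mono) auto
  then show ?thesis
    unfolding unit_ball_vol_def n1 n2 p s by (simp add: field_simps)
qed

lemma emeasure_sphere_prob_cone:
  fixes A :: "'a::euclidean_space set"
  assumes A: "A \<in> sets borel" "A \<subseteq> sphere 0 1"
  shows "emeasure sphere_prob A * emeasure lborel (ball (0::'a) 1) = emeasure lborel {x \<in> ball 0 1 - {0}. sgn x \<in> A}"
proof -
  let ?b = "emeasure lborel (ball (0::'a) 1)" and ?c = "emeasure lborel {x \<in> ball 0 1 - {0}. sgn x \<in> A}"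
  have s: "A \<in> sets surface_measure" "sphere 0 1 \<in> sets (surface_measure :: 'a measure)"
    using A by (auto simp: sets_surface_measure sets_restrict_space_iff)
  have b: "?b = ennreal (unit_ball_vol (real DIM('a)))" by (simp add: emeasure_ball)
  have b0: "?b \<noteq> 0" "?b \<noteq> \<top>" unfolding b using unit_ball_vol_pos[of "real DIM('a)"] by (simp_all del: unit_ball_vol_pos)
  have "?c \<le> ?b" by (rule emeasure_mono) auto
  then have "?c \<noteq> \<top>" using b0(2) by (auto simp: top_unique)
  then obtain c' where c': "?c = ennreal c'" "c' \<ge> 0" by (cases ?c) auto
  obtain b' where b': "?b = ennreal b'" "b' > 0" using b unit_ball_vol_pos[of "real DIM('a)"] by auto
  have "emeasure sphere_prob A = of_nat DIM('a) * ?c / (of_nat DIM('a) * ?b)"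
    unfolding sphere_prob_def using A
    by (subst emeasure_uniform_measure[OF s(2,1)])
       (simp add: Int_absorb1 emeasure_surface_measure_sphere emeasure_surface_measure)
  also have "\<dots> = ennreal (real DIM('a) * c') / ennreal (real DIM('a) * b')"
    using b' c' unfolding b'(1) c'(1) ennreal_of_nat_eq_real_of_nat by (simp add: ennreal_mult)
  also have "\<dots> = ennreal (c' / b')"
    using b' c' by (subst divide_ennreal) auto
  finally have "emeasure sphere_prob A * ?b = ennreal (c' / b' * b')"
    using b' c' by (metis ennreal_mult'' less_imp_le)
  then show ?thesis using b' c' by simp
qed

text \<open>After a rotation \<open>x\<close> is a basis vector, and scaling a point of the band by
  a radius below 1 keeps it in the slab of half-width \<open>e\<close>. The square root bounds the
  ratio of the unit ball volumes in consecutive dimensions; it is the source of every sqrt d in the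
  upper bound.\<close>

lemma measure_band_le:
  fixes x :: "'a::euclidean_space"
  assumes x: "norm x = 1" and e: "e \<ge> 0"
  shows "measure sphere_prob {z \<in> sphere 0 1. \<bar>x \<bullet> z\<bar> \<le> e} \<le> 2 * e * sqrt ((real DIM('a) + 1) / (2 * pi))"
proof -
  interpret prob_space "sphere_prob :: 'a measure" by (rule prob_space_sphere_prob)
  obtain b :: 'a where b: "b \<in> Basis" using nonempty_Basis by blast
  define A where "A y = {z \<in> sphere 0 1. \<bar>y \<bullet> z\<bar> \<le> e}" for y :: 'a
  have A: "A y \<in> sets borel" "A y \<subseteq> sphere 0 1" "A y \<in> sets sphere_prob" for y
  proof -
    show "A y \<in> sets borel" unfolding A_def sphere_def mem_Collect_eq by measurable
    then show "A y \<subseteq> sphere 0 1" "A y \<in> sets sphere_prob" by (auto simp: A_def intro!: sets_sphere_probI)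
  qed
  define v where "v = unit_ball_vol (real DIM('a))"
  define w where "w = unit_ball_vol (real (DIM('a) - 1))"
  have v: "v > 0" by (simp add: v_def)
  obtain f where f: "orthogonal_transformation f" "f x = b"
    using ex_orthogonal_transformation_swap[of x b] x b by auto
  have "f y \<bullet> f z = y \<bullet> z" for y z using f(1) by (simp add: orthogonal_transformation_def)
  then have "A x = f -` A b"
    using f(2) by (auto simp: A_def orthogonal_transformation_norm[OF f(1)] simp flip: f(2))
  then have "prob (A x) = prob (A b)"
    using measure_sphere_prob_orthogonal[OF f(1) A(3)[of b]] by simp
  moreover have "prob (A b) * v \<le> 2 * e * w"
  proof -
    have "ennreal (prob (A b) * v) = emeasure sphere_prob (A b) * emeasure lborel (ball (0::'a) 1)"
      using v by (simp add: emeasure_eq_measure emeasure_ball v_def ennreal_mult'')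
    also have "\<dots> = emeasure lborel {x \<in> ball 0 1 - {0}. sgn x \<in> A b}"
      by (rule emeasure_sphere_prob_cone) (rule A)+
    also have "\<dots> \<le> emeasure lborel {x. norm x \<le> 1 \<and> \<bar>x \<bullet> b\<bar> \<le> e}"
    proof (rule emeasure_mono)
      show "{x \<in> ball 0 1 - {0}. sgn x \<in> A b} \<subseteq> {x. norm x \<le> 1 \<and> \<bar>x \<bullet> b\<bar> \<le> e}"
      proof safe
        fix z :: 'a assume z: "z \<in> ball 0 1" "sgn z \<in> A b" "z \<noteq> 0"
        show "norm z \<le> 1" using z by simp
        have "z = norm z *\<^sub>R sgn z" using z by (simp add: sgn_div_norm)
        then have "\<bar>z \<bullet> b\<bar> = norm z * \<bar>b \<bullet> sgn z\<bar>"
          by (metis abs_mult abs_norm_cancel inner_commute inner_scaleR_left)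
        also have "\<dots> \<le> 1 * \<bar>b \<bullet> sgn z\<bar>" using z by (intro mult_right_mono) auto
        also have "\<dots> \<le> e" using z by (simp add: A_def)
        finally show "\<bar>z \<bullet> b\<bar> \<le> e" .
      qed
    qed simp
    also have "\<dots> \<le> ennreal (2 * e * w)"
      unfolding w_def by (rule emeasure_lborel_slab_le[OF b e])
    finally show ?thesis
      using e by (subst (asm) ennreal_le_iff) (auto simp: w_def)
  qed
  moreover have "w \<le> sqrt ((real DIM('a) + 1) / (2 * pi)) * v"
    unfolding w_def v_def by (rule unit_ball_vol_ratio_le) simp
  ultimately have "prob (A x) * v \<le> 2 * e * (sqrt ((real DIM('a) + 1) / (2 * pi)) * v)"
    using e by (smt (verit) mult_left_mono)
  then show ?thesis using v by (simp add: A_def mult.assoc[symmetric])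
qed

subsection \<open>The measure of a wedge\<close>

text \<open>Cauchy's functional equation on an interval. Nonnegativity makes \<open>f\<close>
  monotone, the value at \<open>pi / 2\<close> fixes it on the grid of mesh
  \<open>pi / (2 * n)\<close>, and \<theta> is squeezed between neighbouring grid points.\<close>

lemma additive_bounded_linear_on_pi:
  fixes f :: "real \<Rightarrow> real"
  assumes add: "\<And>a b. 0 \<le> a \<Longrightarrow> 0 \<le> b \<Longrightarrow> a + b < pi \<Longrightarrow> f (a + b) = f a + f b"
    and f0: "\<And>a. 0 \<le> f a" and f1: "\<And>a. f a \<le> 1" and half: "f (pi / 2) = 1 / 2"
    and \<theta>: "0 \<le> \<theta>" "\<theta> < pi"
  shows "f \<theta> = \<theta> / pi"
proof -
  have mono: "f a \<le> f b" if "0 \<le> a" "a \<le> b" "b < pi" for a b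
    using add[of a "b - a"] f0[of "b - a"] that by simp
  have bound: "\<bar>f \<theta> - \<theta> / pi\<bar> \<le> 1 / (2 * real n)" if n: "n \<ge> 1" for n :: nat
  proof -
    define h where "h = pi / (2 * real n)"
    have h: "h > 0" "real (2 * n) * h = pi" using n by (simp_all add: h_def)
    have mult: "f (real k * h) = real k * f h" if "k < 2 * n" for k
      using that
    proof (induction k)
      case 0
      show ?case using add[of 0 0] by simp
    next
      case (Suc k)
      have "real (Suc k) * h < real (2 * n) * h"
        using h(1) Suc.prems by (intro mult_strict_right_mono) auto
      then have "f (real k * h + h) = f (real k * h) + f h"
        using h by (intro add) (auto simp: algebra_simps)
      then show ?case using Suc by (simp add: algebra_simps)
    qed
    have "real n * h = pi / 2" using h(2) by simp
    then have fh: "real n * f h = 1 / 2" using mult[of n] n unfolding \<open>real n * h = pi / 2\<close> half by simp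
    define k where "k = nat \<lfloor>\<theta> / h\<rfloor>"
    have k: "real k \<le> \<theta> / h" "\<theta> / h < real k + 1"
      using \<theta> h unfolding k_def by (auto simp: of_nat_nat)
    have k1: "real k * h \<le> \<theta>" "\<theta> < (real k + 1) * h"
      using k h(1) by (simp_all add: field_simps)
    have "real k * h < real (2 * n) * h" using k1 \<theta> h by linarith
    then have kn: "k < 2 * n" using h(1) by simp
    have fh': "f h = 1 / (2 * real n)" using fh n by (simp add: field_simps)
    have lo: "real k / (2 * real n) \<le> f \<theta>"
      using mono[of "real k * h" \<theta>] k1 \<theta> h mult[OF kn] fh' by simp
    have hi: "f \<theta> \<le> (real k + 1) / (2 * real n)"
    proof (cases "Suc k < 2 * n")
      case True
      have "real (Suc k) * h < real (2 * n) * h"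
        using h(1) True by (intro mult_strict_right_mono) auto
      then have "real (Suc k) * h < pi" unfolding h(2) .
      then show ?thesis
        using mono[of \<theta> "real (Suc k) * h"] k1 \<theta> h mult[OF True] fh' by (simp add: add.commute)
    next
      \<comment> \<open>The next grid point would be \<open>pi\<close> itself, where additivity is
        not assumed; the bound \<open>f \<theta> \<le> 1\<close> takes its place.\<close>
      case False
      then have "Suc k = 2 * n" using kn by simp
      then have "real k + 1 = 2 * real n" by (metis of_nat_Suc of_nat_mult of_nat_numeral add.commute)
      then show ?thesis using f1[of \<theta>] n by simp
    qed
    have e: "\<theta> / pi = (\<theta> / h) / (2 * real n)" using n by (simp add: h_def)
    then have "real k / (2 * real n) \<le> \<theta> / pi" "\<theta> / pi \<le> (real k + 1) / (2 * real n)"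
      unfolding e using k by (blast intro: divide_right_mono less_imp_le of_nat_0_le_iff mult_nonneg_nonneg zero_le_numeral)+
    then show ?thesis using lo hi by (simp add: add_divide_distrib abs_le_iff)
  qed
  have "\<bar>f \<theta> - \<theta> / pi\<bar> \<le> e" if "e > 0" for e
  proof -
    obtain n :: nat where n: "1 / e < real n" "n \<ge> 1"
      using reals_Archimedean2[of "max 1 (1 / e)"] by auto
    have "1 / (2 * real n) \<le> 1 / real n" using n by (simp add: field_simps)
    also have "\<dots> \<le> e" using n that by (simp add: field_simps)
    finally show ?thesis using bound[OF n(2)] by linarith
  qed
  then have "\<bar>f \<theta> - \<theta> / pi\<bar> \<le> 0" by (rule field_le_epsilon[where y = 0, simplified])
  then show ?thesis by simp
qed

lemma measure_wedge_cong:
  fixes x y x' y' :: "'a::euclidean_space"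
  assumes "norm x = norm x'" "norm y = norm y'" "x \<bullet> y = x' \<bullet> y'"
  shows "measure sphere_prob (wedge x y) = measure sphere_prob (wedge x' y')"
proof -
  obtain f where f: "orthogonal_transformation f" "f x = x'" "f y = y'"
    using ex_orthogonal_transformation_pair[OF assms] by metis
  have "f y \<bullet> f z = y \<bullet> z" for y z using f(1) by (simp add: orthogonal_transformation_def)
  then have "wedge x y = f -` wedge x' y'"
    by (auto simp: wedge_def orthogonal_transformation_norm[OF f(1)] simp flip: f(2,3))
  then show ?thesis
    using measure_sphere_prob_orthogonal[OF f(1) wedge_in_sets, of x' y'] by simp
qed

lemma measure_great_sphere:
  fixes x :: "'a::euclidean_space"
  assumes "norm x = 1"
  shows "measure sphere_prob {z \<in> sphere 0 1. x \<bullet> z = 0} = 0"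
  using measure_band_le[OF assms, of 0] by (intro order.antisym) simp_all

text \<open>Negating \<open>y\<close> flips its sign at every point off the great sphere orthogonal
  to \<open>y\<close>, so the wedge turns into its complement up to a null set.\<close>

lemma measure_wedge_minus:
  fixes x y :: "'a::euclidean_space"
  assumes y: "norm y = 1"
  shows "measure sphere_prob (wedge x (- y)) = 1 - measure sphere_prob (wedge x y)"
proof -
  interpret prob_space "sphere_prob :: 'a measure" by (rule prob_space_sphere_prob)
  define E where "E = {z \<in> sphere 0 1. y \<bullet> z = 0}"
  have E: "E \<in> sets sphere_prob"
    unfolding E_def by (intro sets_sphere_probI) (auto simp: sphere_def)
  have E0: "E \<in> null_sets sphere_prob"
    using measure_great_sphere[OF y] E by (simp add: null_sets_def E_def emeasure_eq_measure)
  have "prob (wedge x (- y)) = prob (wedge x (- y) - E)"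
    using E0 by (simp add: measure_Diff_null_set)
  also have "wedge x (- y) - E = (sphere 0 1 - wedge x y) - E"
    by (auto simp: wedge_def E_def sign_nonneg_def split: if_splits)
  also have "prob \<dots> = prob (sphere 0 1 - wedge x y)"
    using E0 by (intro measure_Diff_null_set) (auto intro!: sets.Diff[OF sets.top[of sphere_prob, simplified]])
  also have "\<dots> = 1 - prob (wedge x y)"
    using prob_compl[OF wedge_in_sets, of x y] by simp
  finally show ?thesis .
qed

text \<open>Along a great circle the measure of the wedge is an additive function of the angle, and
  it is 1/2 at a right angle by symmetry; hence it is proportional to the angle.\<close>

lemma measure_wedge:
  fixes x y :: "'a::euclidean_space"
  assumes dim: "DIM('a) \<ge> 2" and x: "norm x = 1" and y: "norm y = 1"
  shows "measure sphere_prob (wedge x y) = arccos (x \<bullet> y) / pi"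
proof -
  interpret prob_space "sphere_prob :: 'a measure" by (rule prob_space_sphere_prob)
  obtain b c :: 'a where bc: "b \<in> Basis" "c \<in> Basis" "b \<noteq> c"
    using dim card_le_Suc0_iff_eq[OF finite_Basis, where 'a1 = 'a] by auto
  define p where "p \<alpha> = cos \<alpha> *\<^sub>R b + sin \<alpha> *\<^sub>R c" for \<alpha>
  have pp: "p \<alpha> \<bullet> p \<beta> = cos (\<alpha> - \<beta>)" for \<alpha> \<beta>
    using bc by (simp add: p_def inner_add_left inner_add_right inner_Basis cos_diff)
  then have np: "norm (p \<alpha>) = 1" for \<alpha> by (simp add: norm_eq_1)
  define f where "f \<alpha> = prob (wedge (p 0) (p \<alpha>))" for \<alpha>
  have f_shift: "prob (wedge (p \<alpha>) (p (\<alpha> + \<beta>))) = f \<beta>" for \<alpha> \<beta>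
    unfolding f_def by (rule measure_wedge_cong) (simp_all add: np pp)
  have add: "f (\<alpha> + \<beta>) = f \<alpha> + f \<beta>" if ab: "0 \<le> \<alpha>" "0 \<le> \<beta>" "\<alpha> + \<beta> < pi" for \<alpha> \<beta>
  proof (cases "\<alpha> + \<beta> = 0")
    case True
    then have "\<alpha> = 0" "\<beta> = 0" using ab by auto
    then show ?thesis by (simp add: f_def wedge_def)
  next
    case False
    define s where "s = sin (\<alpha> + \<beta>)"
    have s: "s > 0" unfolding s_def using ab False by (intro sin_gt_zero) auto
    have sab: "sin \<alpha> \<ge> 0" "sin \<beta> \<ge> 0" using ab by (auto intro!: sin_ge_zero)
    have "s * sin \<alpha> = sin \<alpha> * sin (\<alpha> + \<beta>)" by (simp add: s_def)
    moreover have "s * cos \<alpha> = sin \<beta> + sin \<alpha> * cos (\<alpha> + \<beta>)"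
    proof -
      have "sin \<beta> = sin ((\<alpha> + \<beta>) - \<alpha>)" by simp
      then show ?thesis unfolding sin_diff by (simp add: s_def)
    qed
    \<comment> \<open>For angles summing to less than \<open>pi\<close> the middle pole is a
      nonnegative combination of the outer two. So its sign agrees with theirs whenever theirs
      agree, and the large wedge is the disjoint union of the two small ones.\<close>
    ultimately have "s *\<^sub>R p \<alpha> = sin \<beta> *\<^sub>R p 0 + sin \<alpha> *\<^sub>R p (\<alpha> + \<beta>)"
      by (simp add: p_def scaleR_add_right scaleR_add_left)
    then have comb: "s * (p \<alpha> \<bullet> z) = sin \<beta> * (p 0 \<bullet> z) + sin \<alpha> * (p (\<alpha> + \<beta>) \<bullet> z)" for z
      by (metis inner_add_left inner_scaleR_left)
    have nn: "p \<alpha> \<bullet> z \<ge> 0" if "p 0 \<bullet> z \<ge> 0" "p (\<alpha> + \<beta>) \<bullet> z \<ge> 0" for z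
    proof -
      have "s * (p \<alpha> \<bullet> z) \<ge> 0" unfolding comb using sab that by (intro add_nonneg_nonneg mult_nonneg_nonneg)
      then show ?thesis using s by (simp add: zero_le_mult_iff)
    qed
    have ng: "p \<alpha> \<bullet> z < 0" if z: "p 0 \<bullet> z < 0" "p (\<alpha> + \<beta>) \<bullet> z < 0" for z
    proof -
      have "sin \<alpha> \<noteq> 0 \<or> sin \<beta> \<noteq> 0" using s by (auto simp: s_def sin_add)
      then have "s * (p \<alpha> \<bullet> z) < 0" unfolding comb using sab z
        by (smt (verit) mult_nonneg_nonpos mult_pos_neg)
      then show ?thesis using s by (simp add: mult_less_0_iff)
    qed
    have "wedge (p 0) (p (\<alpha> + \<beta>)) = wedge (p 0) (p \<alpha>) \<union> wedge (p \<alpha>) (p (\<alpha> + \<beta>))"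
      "wedge (p 0) (p \<alpha>) \<inter> wedge (p \<alpha>) (p (\<alpha> + \<beta>)) = {}"
      using nn ng unfolding wedge_def sign_nonneg_def by (auto simp: not_le split: if_splits) force+
    then show ?thesis
      unfolding f_def[of "\<alpha> + \<beta>"] using finite_measure_Union[OF wedge_in_sets wedge_in_sets]
      by (simp add: f_shift) (simp add: f_def)
  qed
  have f_half: "f (pi / 2) = 1 / 2"
  proof -
    \<comment> \<open>Orthogonal poles stay orthogonal when one of them is negated, so this wedge
      and its complement have equal measure.\<close>
    have "f (pi / 2) = prob (wedge (p 0) (- p (pi / 2)))"
      unfolding f_def by (rule measure_wedge_cong) (simp_all add: np pp)
    then show ?thesis
      using measure_wedge_minus[OF np, of "p 0" "pi / 2"] by (simp add: f_def)
  qed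
  have f_eq: "f \<theta> = \<theta> / pi" if "0 \<le> \<theta>" "\<theta> < pi" for \<theta>
    by (rule additive_bounded_linear_on_pi[OF add _ _ f_half that]) (simp_all add: f_def)
  have xy: "- 1 \<le> x \<bullet> y" "x \<bullet> y \<le> 1"
    using Cauchy_Schwarz_ineq2[of x y] x y by auto
  show ?thesis
  proof (cases "x \<bullet> y = - 1")
    \<comment> \<open>Antipodal poles correspond to the angle \<open>pi\<close>, which the linearity
      lemma excludes; here the wedge is almost all of the sphere.\<close>
    case True
    have "prob (wedge x y) = prob (wedge x (- x))"
      using x y True by (intro measure_wedge_cong) (auto simp: power2_norm_eq_inner[symmetric])
    also have "\<dots> = 1" using measure_wedge_minus[OF x, of x] by (simp add: wedge_def)
    finally show ?thesis using True by simp
  next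
    case False
    define \<theta> where "\<theta> = arccos (x \<bullet> y)"
    have \<theta>: "0 \<le> \<theta>" "\<theta> \<le> pi" "cos \<theta> = x \<bullet> y" using xy by (auto simp: \<theta>_def arccos_lbound arccos_ubound)
    have "\<theta> \<noteq> pi" using \<theta>(3) False by auto
    then have "f \<theta> = \<theta> / pi" using \<theta> by (intro f_eq) auto
    moreover have "prob (wedge x y) = f \<theta>"
      unfolding f_def by (rule measure_wedge_cong) (simp_all add: np pp x y \<theta>(3))
    ultimately show ?thesis by (simp add: \<theta>_def)
  qed
qed

lemma integral_sign_product:
  fixes x y :: "'a::euclidean_space"
  assumes dim: "DIM('a) \<ge> 2" and x: "norm x = 1" and y: "norm y = 1"
  shows "(\<integral>z. sign_nonneg (x \<bullet> z) * sign_nonneg (y \<bullet> z) \<partial>sphere_prob) = 2 / pi * arcsin (x \<bullet> y)"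
proof -
  interpret prob_space "sphere_prob :: 'a measure" by (rule prob_space_sphere_prob)
  have "(\<integral>z. sign_nonneg (x \<bullet> z) * sign_nonneg (y \<bullet> z) \<partial>sphere_prob) =
      (\<integral>z. 1 - 2 * indicator (wedge x y) z \<partial>sphere_prob)"
    by (intro Bochner_Integration.integral_cong) (auto simp: wedge_def sign_nonneg_def indicator_def)
  also have "\<dots> = 1 - 2 * prob (wedge x y \<inter> sphere 0 1)"
    by (subst Bochner_Integration.integral_diff) (auto simp: prob_space[simplified] emeasure_eq_measure)
  also have "wedge x y \<inter> sphere 0 1 = wedge x y" by (auto simp: wedge_def)
  also have "1 - 2 * prob (wedge x y) = 2 / pi * arcsin (x \<bullet> y)"
    using Cauchy_Schwarz_ineq2[of x y] x y
    by (simp add: measure_wedge[OF dim x y] arccos_arcsin_eq abs_le_iff field_simps)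
  finally show ?thesis .
qed

subsection \<open>Power series of the squared arcsine\<close>

text \<open>The Taylor coefficient of arcsin at the power \<open>2 * k + 1\<close>. The quotient
  \<open>pochhammer (1 / 2) k / fact k\<close> is the central binomial coefficient divided by
  \<open>4 ^ k\<close>.\<close>

definition arcsin_coeff :: "nat \<Rightarrow> real" where
  "arcsin_coeff k = pochhammer (1 / 2) k / fact k / (2 * real k + 1)"

lemma arcsin_coeff_nonneg: "arcsin_coeff k \<ge> 0"
  by (simp add: arcsin_coeff_def pochhammer_nonneg)

lemma pochhammer_half_Suc:
  "pochhammer (1 / 2) (Suc k) / fact (Suc k) =
     pochhammer (1 / 2) k / fact k * ((2 * real k + 1) / (2 * real k + 2))"
  by (simp add: pochhammer_Suc divide_simps) (simp add: algebra_simps)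

lemma pochhammer_half_le_1: "pochhammer (1 / 2) k / fact k \<le> (1 :: real)"
proof (induction k)
  case (Suc k)
  have "pochhammer (1 / 2) k / fact k * ((2 * real k + 1) / (2 * real k + 2)) \<le> 1 * (1::real)"
    using Suc by (intro mult_mono) (auto simp: pochhammer_nonneg)
  then show ?case unfolding pochhammer_half_Suc by simp
qed simp

text \<open>The induction step is equivalent to sqrt (k (k + 1)) being at most k + 1/2, the
  inequality of the two means.\<close>

lemma pochhammer_half_ge:
  assumes "k \<ge> 1"
  shows "1 / (2 * sqrt (real k)) \<le> pochhammer (1 / 2) k / fact k"
  using assms
proof (induction k rule: nat_induct_at_least)
  case base
  show ?case by simp
next
  case (Suc k)
  have k: "real k > 0" using Suc by simp
  have "sqrt (real k) * sqrt (real k + 1) \<le> (2 * real k + 1) / 2"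
    unfolding real_sqrt_mult[symmetric]
    by (rule real_le_lsqrt) (auto simp: power2_eq_square field_simps)
  moreover have "(2 * real k + 2) = 2 * (sqrt (real k + 1) * sqrt (real k + 1))" by simp
  ultimately have "1 / (2 * sqrt (real (Suc k))) \<le> 1 / (2 * sqrt (real k)) * ((2 * real k + 1) / (2 * real k + 2))"
    using k by (simp add: field_simps del: real_sqrt_mult_self)
  also have "\<dots> \<le> pochhammer (1 / 2) k / fact k * ((2 * real k + 1) / (2 * real k + 2))"
    using Suc by (intro mult_right_mono) auto
  finally show ?case unfolding pochhammer_half_Suc .
qed

lemma inverse_sqrt_sums:
  fixes x :: real
  assumes "\<bar>x\<bar> < 1"
  shows "(\<lambda>k. pochhammer (1 / 2) k / fact k * x ^ (2 * k)) sums inverse (sqrt (1 - x\<^sup>2))"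
proof -
  have x2: "x\<^sup>2 < 1" using assms by (simp add: abs_square_less_1)
  have "(\<lambda>k. (- (1 / 2) gchoose k) * (- x\<^sup>2) ^ k) sums (1 + (- x\<^sup>2)) powr (- (1 / 2))"
    by (rule gen_binomial_real) (use x2 in auto)
  moreover have "(- (1 / 2) gchoose k) * (- x\<^sup>2) ^ k = pochhammer (1 / 2) k / fact k * x ^ (2 * k)" for k
  proof -
    have "(- (1 / 2) gchoose k) * (- x\<^sup>2) ^ k = ((- 1) ^ k * (- 1) ^ k) * (pochhammer (1 / 2) k / fact k * x ^ (2 * k))"
      unfolding gbinomial_pochhammer power_minus[of "x\<^sup>2" k] power_mult by simp
    also have "((- 1) ^ k * (- 1) ^ k :: real) = 1"
      unfolding power_mult_distrib[symmetric] by simp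
    finally show ?thesis by simp
  qed
  moreover have "(1 + (- x\<^sup>2)) powr (- (1 / 2)) = inverse (sqrt (1 - x\<^sup>2))"
    using x2 by (simp add: powr_minus powr_half_sqrt)
  ultimately show ?thesis by simp
qed

text \<open>Termwise differentiation turns the series into the binomial series of
  \<open>inverse (sqrt (1 - x\<^sup>2))\<close>, the derivative of arcsin, and both functions vanish
  at 0.\<close>

lemma arcsin_sums:
  fixes x :: real
  assumes x: "\<bar>x\<bar> < 1"
  shows "(\<lambda>k. arcsin_coeff k * x ^ (2 * k + 1)) sums arcsin x"
proof -
  \<comment> \<open>Differentiation of power series needs a coefficient at every exponent, so the
    even ones are filled with zeros.\<close>
  define C where "C j = (if odd j then arcsin_coeff (j div 2) else 0)" for j
  have C_le: "\<bar>C j\<bar> \<le> 1" for j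
  proof -
    have "arcsin_coeff k \<le> 1 / 1" for k
      unfolding arcsin_coeff_def using pochhammer_half_le_1[of k]
      by (intro frac_le) (auto simp: pochhammer_nonneg)
    then show ?thesis using arcsin_coeff_nonneg by (simp add: C_def)
  qed
  have summ: "summable (\<lambda>j. C j * K ^ j)" if "\<bar>K\<bar> < 1" for K
  proof (rule summable_comparison_test')
    show "summable (\<lambda>j. \<bar>K\<bar> ^ j)" using that by (simp add: summable_geometric)
    show "norm (C j * K ^ j) \<le> \<bar>K\<bar> ^ j" for j
      using C_le[of j] by (simp add: abs_mult power_abs mult_left_le_one_le)
  qed
  define F where "F y = (\<Sum>j. C j * y ^ j)" for y
  have diffsC: "(\<Sum>j. diffs C j * y ^ j) = inverse (sqrt (1 - y\<^sup>2))" if y: "\<bar>y\<bar> < 1" for y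
  proof -
    have "(\<lambda>j. diffs C j * y ^ j) sums inverse (sqrt (1 - y\<^sup>2))"
    proof (subst sums_mono_reindex[of "\<lambda>k. 2 * k", symmetric])
      show "strict_mono (\<lambda>k::nat. 2 * k)" by (simp add: strict_mono_def)
      show "diffs C j * y ^ j = 0" if "j \<notin> range (\<lambda>k. 2 * k)" for j
        using that by (auto simp: diffs_def C_def elim!: evenE)
      have "diffs C (2 * k) = pochhammer (1 / 2) k / fact k" for k
        by (simp add: diffs_def C_def arcsin_coeff_def add.commute)
      then show "(\<lambda>k. diffs C (2 * k) * y ^ (2 * k)) sums inverse (sqrt (1 - y\<^sup>2))"
        using inverse_sqrt_sums[OF y] by simp
    qed
    then show ?thesis by (rule sums_unique[symmetric])
  qed
  have DF: "(F has_field_derivative inverse (sqrt (1 - y\<^sup>2))) (at y)" if y: "\<bar>y\<bar> < 1" for y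
  proof -
    obtain K where K: "\<bar>y\<bar> < K" "K < 1" using dense[OF y] by blast
    have "(F has_field_derivative (\<Sum>j. diffs C j * y ^ j)) (at y)"
      unfolding F_def by (rule termdiffs_strong[of _ K]) (use K summ[of K] in auto)
    then show ?thesis using diffsC[OF y] by simp
  qed
  have "(\<lambda>y. F y - arcsin y) x = (\<lambda>y. F y - arcsin y) 0"
  proof (rule DERIV_isconst3[of "-1" 1 x 0 "\<lambda>y. F y - arcsin y"])
    fix y :: real assume "y \<in> {-1<..<1}"
    then have y: "\<bar>y\<bar> < 1" "-1 < y" "y < 1" by auto
    have "((\<lambda>y. F y - arcsin y) has_field_derivative inverse (sqrt (1 - y\<^sup>2)) - inverse (sqrt (1 - y\<^sup>2))) (at y)"
      by (intro DERIV_diff DF DERIV_arcsin y)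
    then show "((\<lambda>y. F y - arcsin y) has_real_derivative 0) (at y)" by simp
  qed (use x in auto)
  moreover have "F 0 = 0" by (simp add: F_def C_def)
  ultimately have "F x = arcsin x" by simp
  then have "(\<lambda>j. C j * x ^ j) sums arcsin x"
    using summ[OF x] by (metis F_def summable_sums)
  moreover have "(\<lambda>k. C (2 * k + 1) * x ^ (2 * k + 1)) sums arcsin x \<longleftrightarrow> (\<lambda>j. C j * x ^ j) sums arcsin x"
  proof (rule sums_mono_reindex[of "\<lambda>k. 2 * k + 1"])
    show "strict_mono (\<lambda>k::nat. 2 * k + 1)" by (simp add: strict_mono_def)
    show "C j * x ^ j = 0" if "j \<notin> range (\<lambda>k. 2 * k + 1)" for j
      using that by (auto simp: C_def elim!: oddE)
  qed
  ultimately show ?thesis by (simp add: C_def)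
qed

text \<open>Belongs to the exponent \<open>2 * Suc m\<close>, since the square of the series starts
  at the second power.\<close>

definition arcsin_sq_coeff :: "nat \<Rightarrow> real" where
  "arcsin_sq_coeff m = 4 / pi\<^sup>2 * (\<Sum>i\<le>m. arcsin_coeff i * arcsin_coeff (m - i))"

lemma arcsin_sq_coeff_nonneg: "arcsin_sq_coeff m \<ge> 0"
  by (simp add: arcsin_sq_coeff_def sum_nonneg arcsin_coeff_nonneg)

text \<open>A single summand of the convolution, the one with \<open>arcsin_coeff 0 = 1\<close>,
  already has the right order of magnitude.\<close>

lemma arcsin_sq_coeff_ge:
  assumes "m \<ge> 1"
  shows "2 / (pi\<^sup>2 * sqrt (real m) * (2 * real m + 1)) \<le> arcsin_sq_coeff m"
proof -
  have "1 / (2 * sqrt (real m)) / (2 * real m + 1) \<le> arcsin_coeff m"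
    unfolding arcsin_coeff_def by (intro divide_right_mono pochhammer_half_ge assms) simp
  also have "\<dots> = arcsin_coeff 0 * arcsin_coeff (m - 0)" by (simp add: arcsin_coeff_def)
  also have "\<dots> \<le> (\<Sum>i\<le>m. arcsin_coeff i * arcsin_coeff (m - i))"
    by (rule member_le_sum) (auto simp: arcsin_coeff_nonneg)
  finally have "4 / pi\<^sup>2 * (1 / (2 * sqrt (real m)) / (2 * real m + 1)) \<le> arcsin_sq_coeff m"
    unfolding arcsin_sq_coeff_def by (intro mult_left_mono) auto
  moreover have "4 / pi\<^sup>2 * (1 / (2 * sqrt (real m)) / (2 * real m + 1)) = 2 / (pi\<^sup>2 * sqrt (real m) * (2 * real m + 1))"
    by (simp add: divide_simps)
  ultimately show ?thesis by metis
qed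

lemma arcsin_sq_sums_interior:
  fixes t :: real
  assumes t: "\<bar>t\<bar> < 1"
  shows "(\<lambda>m. arcsin_sq_coeff m * t ^ (2 * Suc m)) sums (2 / pi * arcsin t)\<^sup>2"
proof -
  let ?a = "\<lambda>k. arcsin_coeff k * t ^ (2 * k + 1)"
  have "summable (\<lambda>k. arcsin_coeff k * \<bar>t\<bar> ^ (2 * k + 1))"
    using arcsin_sums[of "\<bar>t\<bar>"] t by (auto intro: sums_summable)
  then have s: "summable (\<lambda>k. norm (?a k))"
    by (simp add: abs_mult power_abs arcsin_coeff_nonneg)
  have "(\<lambda>m. \<Sum>i\<le>m. ?a i * ?a (m - i)) sums ((\<Sum>k. ?a k) * (\<Sum>k. ?a k))"
    by (rule Cauchy_product_sums[OF s s])
  then have "(\<lambda>m. \<Sum>i\<le>m. ?a i * ?a (m - i)) sums (arcsin t)\<^sup>2"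
    using sums_unique[OF arcsin_sums[OF t]] by (simp add: power2_eq_square)
  moreover have "(\<Sum>i\<le>m. ?a i * ?a (m - i)) = (\<Sum>i\<le>m. arcsin_coeff i * arcsin_coeff (m - i)) * t ^ (2 * Suc m)" for m
    unfolding sum_distrib_right
  proof (rule sum.cong)
    fix i assume "i \<in> {..m}"
    then have "t ^ (2 * i + 1) * t ^ (2 * (m - i) + 1) = t ^ (2 * Suc m)"
      unfolding power_add[symmetric] by (intro arg_cong[where f = "(^) t"]) auto
    then show "?a i * ?a (m - i) = arcsin_coeff i * arcsin_coeff (m - i) * t ^ (2 * Suc m)"
      by (metis (no_types, lifting) mult.assoc mult.left_commute)
  qed simp
  ultimately have "(\<lambda>m. (\<Sum>i\<le>m. arcsin_coeff i * arcsin_coeff (m - i)) * t ^ (2 * Suc m)) sums (arcsin t)\<^sup>2"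
    by simp
  from sums_mult[OF this, of "4 / pi\<^sup>2"] show ?thesis
    by (simp add: arcsin_sq_coeff_def power_mult_distrib power_divide mult.assoc)
qed

text \<open>The endpoints matter because the diagonal terms of the energy have inner product 1.
  There the coefficients are nonnegative, so letting t tend to 1 from the left bounds all partial
  sums by 1; conversely the full sum dominates the series at each t below 1, hence also the
  limit.\<close>

lemma arcsin_sq_sums:
  fixes t :: real
  assumes t: "\<bar>t\<bar> \<le> 1"
  shows "(\<lambda>m. arcsin_sq_coeff m * t ^ (2 * Suc m)) sums (2 / pi * arcsin t)\<^sup>2"
proof (cases "\<bar>t\<bar> < 1")
  case True
  then show ?thesis by (rule arcsin_sq_sums_interior)
next
  case False
  then have t1: "t = 1 \<or> t = -1" using t by auto
  let ?g = "\<lambda>t::real. (2 / pi * arcsin t)\<^sup>2"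
  have g_lim: "(?g \<longlongrightarrow> 1) (at_left 1)"
  proof -
    have "continuous_on {-1..1} ?g" by (intro continuous_intros) auto
    then have "(?g \<longlongrightarrow> ?g 1) (at 1 within {-1..1})" unfolding continuous_on_def by (rule bspec) simp
    then have "(?g \<longlongrightarrow> ?g 1) (at_left 1)"
      by (simp add: at_within_Icc_at_left)
    then show ?thesis by simp
  qed
  have ev: "\<forall>\<^sub>F t in at_left (1::real). 0 < t \<and> t < 1"
    using eventually_at_left_real[of 0 "1::real"] by (auto elim: eventually_mono)
  have part: "(\<Sum>m<P. arcsin_sq_coeff m) \<le> 1" for P
  proof (rule tendsto_le[OF _ g_lim])
    have "((\<lambda>t. \<Sum>m<P. arcsin_sq_coeff m * t ^ (2 * Suc m)) \<longlongrightarrow> (\<Sum>m<P. arcsin_sq_coeff m * 1 ^ (2 * Suc m))) (at_left 1)"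
      by (intro tendsto_intros)
    then show "((\<lambda>t. \<Sum>m<P. arcsin_sq_coeff m * t ^ (2 * Suc m)) \<longlongrightarrow> (\<Sum>m<P. arcsin_sq_coeff m)) (at_left 1)"
      by simp
    show "\<forall>\<^sub>F t in at_left 1. (\<Sum>m<P. arcsin_sq_coeff m * t ^ (2 * Suc m)) \<le> ?g t"
      using ev
    proof eventually_elim
      case (elim t)
      then have "\<bar>t\<bar> < 1" by auto
      from arcsin_sq_sums_interior[OF this] show ?case
        using elim by (subst sums_unique) (auto intro!: sum_le_suminf mult_nonneg_nonneg arcsin_sq_coeff_nonneg sums_summable)
    qed
  qed simp
  have summ: "summable arcsin_sq_coeff"
    by (rule summableI_nonneg_bounded[OF arcsin_sq_coeff_nonneg part])
  have "suminf arcsin_sq_coeff \<le> 1" by (rule suminf_le_const[OF summ part])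
  moreover have "1 \<le> suminf arcsin_sq_coeff"
  proof (rule tendsto_upperbound[OF g_lim])
    show "\<forall>\<^sub>F t in at_left 1. ?g t \<le> suminf arcsin_sq_coeff"
      using ev
    proof eventually_elim
      case (elim t)
      then have "\<bar>t\<bar> < 1" by auto
      have "arcsin_sq_coeff m * t ^ (2 * Suc m) \<le> arcsin_sq_coeff m" for m
        using elim by (intro mult_left_le power_le_one arcsin_sq_coeff_nonneg) auto
      then show ?case
        by (rule sums_le[OF _ arcsin_sq_sums_interior[OF \<open>\<bar>t\<bar> < 1\<close>] summable_sums[OF summ]])
    qed
  qed simp
  ultimately have "suminf arcsin_sq_coeff = 1" by simp
  then have "arcsin_sq_coeff sums 1" using summable_sums[OF summ] by simp
  then show ?thesis using t1 by auto
qed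

subsection \<open>Moments of the sphere\<close>

lemma integrable_sphere_prob_bounded:
  fixes h :: "'a::euclidean_space \<Rightarrow> real"
  assumes h: "h \<in> borel_measurable borel" and B: "\<And>z. norm z = 1 \<Longrightarrow> \<bar>h z\<bar> \<le> B"
  shows "integrable sphere_prob h"
proof -
  interpret prob_space "sphere_prob :: 'a measure" by (rule prob_space_sphere_prob)
  show ?thesis
    using h B by (intro integrable_const_bound[where B = B] AE_I2 borel_measurable_sphere_prob) auto
qed

lemma integrable_sphere_prob_continuous:
  fixes h :: "'a::euclidean_space \<Rightarrow> real"
  assumes h: "continuous_on UNIV h"
  shows "integrable sphere_prob h"
proof -
  have "compact (h ` sphere 0 1)"
    using h by (intro compact_continuous_image compact_sphere) (auto intro: continuous_on_subset)
  then obtain B where "\<And>y. y \<in> h ` sphere 0 1 \<Longrightarrow> norm y \<le> B"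
    using compact_imp_bounded bounded_iff by metis
  then show ?thesis
    using borel_measurable_continuous_onI[OF h]
    by (intro integrable_sphere_prob_bounded[of h B]) auto
qed

lemma integral_inner_power_cong:
  fixes u v :: "'a::euclidean_space"
  assumes "norm u = norm v"
  shows "(\<integral>z. (z \<bullet> u) ^ k \<partial>sphere_prob) = (\<integral>z. (z \<bullet> v) ^ k \<partial>sphere_prob)"
proof -
  obtain f where f: "orthogonal_transformation f" "f u = v"
    using ex_orthogonal_transformation_swap[OF assms] by metis
  have "(\<integral>z. (z \<bullet> v) ^ k \<partial>sphere_prob) = (\<integral>z. (f z \<bullet> f u) ^ k \<partial>sphere_prob)"
    unfolding f(2)
    by (rule integral_sphere_prob_orthogonal[OF f(1), symmetric, where h = "\<lambda>z. (z \<bullet> v) ^ k"]) measurable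
  also have "\<dots> = (\<integral>z. (z \<bullet> u) ^ k \<partial>sphere_prob)"
    using f(1) by (simp add: orthogonal_transformation_def)
  finally show ?thesis by simp
qed

text \<open>By rotation invariance any unit vector could stand for the chosen basis vector.\<close>

definition sphere_moment :: "'a::euclidean_space itself \<Rightarrow> nat \<Rightarrow> real" where
  "sphere_moment _ m = (\<integral>z. (z \<bullet> (SOME b :: 'a. b \<in> Basis)) ^ (2 * m) \<partial>sphere_prob)"

lemma integral_inner_power:
  fixes u :: "'a::euclidean_space"
  shows "(\<integral>z. (z \<bullet> u) ^ (2 * m) \<partial>sphere_prob) = norm u ^ (2 * m) * sphere_moment TYPE('a) m"
proof -
  define b :: 'a where "b = (SOME b. b \<in> Basis)"
  have b: "norm b = 1" unfolding b_def by (rule norm_Basis) (rule someI_ex, use nonempty_Basis in blast)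
  have "(\<integral>z. (z \<bullet> u) ^ (2 * m) \<partial>sphere_prob) = (\<integral>z. (z \<bullet> (norm u *\<^sub>R b)) ^ (2 * m) \<partial>sphere_prob)"
    by (rule integral_inner_power_cong) (simp add: b)
  also have "\<dots> = norm u ^ (2 * m) * (\<integral>z. (z \<bullet> b) ^ (2 * m) \<partial>sphere_prob)"
    by (simp add: power_mult_distrib)
  finally show ?thesis by (simp add: sphere_moment_def b_def)
qed

lemma sum_atMost_even:
  fixes h :: "nat \<Rightarrow> real"
  shows "(\<Sum>i\<le>2 * n. if even i then h (i div 2) else 0) = (\<Sum>j\<le>n. h j)"
  by (induction n) auto

text \<open>Compare the coefficients of \<open>s\<^sup>2\<close> in \<open>E (z\<^sub>b + s z\<^sub>c)\<^sup>2\<^sup>m\<^sup>+\<^sup>2 = (1 + s\<^sup>2)\<^sup>m\<^sup>+\<^sup>1 E z\<^sub>b\<^sup>2\<^sup>m\<^sup>+\<^sup>2\<close>.\<close>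

lemma integral_inner_power_mixed:
  fixes b c :: "'a::euclidean_space"
  assumes bc: "b \<in> Basis" "c \<in> Basis" "b \<noteq> c"
  shows "(2 * real m + 1) * (\<integral>z. (z \<bullet> c)\<^sup>2 * (z \<bullet> b) ^ (2 * m) \<partial>sphere_prob) = sphere_moment TYPE('a) (Suc m)"
proof -
  define n where "n = Suc m"
  define E where "E = sphere_moment TYPE('a) n"
  define M where "M k = (\<integral>z. (z \<bullet> c) ^ k * (z \<bullet> b) ^ (2 * n - k) \<partial>sphere_prob)" for k
  have eq: "(\<Sum>k\<le>2 * n. (real (2 * n choose k) * M k) * s ^ k) =
      (\<Sum>k\<le>2 * n. (if even k then real (n choose (k div 2)) * E else 0) * s ^ k)" for s
  proof -
    have "(norm (b + s *\<^sub>R c))\<^sup>2 = 1 + s\<^sup>2"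
      using bc unfolding power2_norm_eq_inner
      by (simp add: inner_add_left inner_add_right inner_Basis power2_eq_square)
    then have nrm: "norm (b + s *\<^sub>R c) ^ (2 * n) = (s\<^sup>2 + 1) ^ n"
      by (simp add: power_mult add.commute)
    have "(\<Sum>k\<le>2 * n. (real (2 * n choose k) * M k) * s ^ k) =
        (\<Sum>k\<le>2 * n. \<integral>z. real (2 * n choose k) * s ^ k * ((z \<bullet> c) ^ k * (z \<bullet> b) ^ (2 * n - k)) \<partial>sphere_prob)"
      by (intro sum.cong refl, subst integral_mult_right_zero) (simp add: M_def mult_ac)
    also have "\<dots> = (\<integral>z. (\<Sum>k\<le>2 * n. real (2 * n choose k) * s ^ k * ((z \<bullet> c) ^ k * (z \<bullet> b) ^ (2 * n - k))) \<partial>sphere_prob)"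
      by (intro Bochner_Integration.integral_sum[symmetric] integrable_sphere_prob_continuous continuous_intros)
    also have "\<dots> = (\<integral>z. (z \<bullet> (b + s *\<^sub>R c)) ^ (2 * n) \<partial>sphere_prob)"
    proof -
      have "(z \<bullet> (b + s *\<^sub>R c)) ^ (2 * n) =
          (\<Sum>k\<le>2 * n. real (2 * n choose k) * s ^ k * ((z \<bullet> c) ^ k * (z \<bullet> b) ^ (2 * n - k)))" for z
        using binomial_ring[of "s * (z \<bullet> c)" "z \<bullet> b" "2 * n"]
        by (simp add: inner_add_right power_mult_distrib mult_ac add.commute)
      then show ?thesis by simp
    qed
    also have "\<dots> = (s\<^sup>2 + 1) ^ n * E"
      by (simp add: integral_inner_power nrm E_def)
    also have "\<dots> = (\<Sum>j\<le>n. real (n choose j) * E * (s\<^sup>2) ^ j)"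
      using binomial_ring[of "s\<^sup>2" 1 n] by (simp add: sum_distrib_left sum_distrib_right mult_ac)
    also have "\<dots> = (\<Sum>k\<le>2 * n. if even k then real (n choose (k div 2)) * E * (s\<^sup>2) ^ (k div 2) else 0)"
      by (rule sum_atMost_even[symmetric])
    also have "\<dots> = (\<Sum>k\<le>2 * n. (if even k then real (n choose (k div 2)) * E else 0) * s ^ k)"
      by (intro sum.cong refl) (auto elim!: evenE simp: power_mult)
    finally show ?thesis .
  qed
  have "\<forall>k\<le>2 * n. real (2 * n choose k) * M k = (if even k then real (n choose (k div 2)) * E else 0)"
    using eq by (intro iffD1[OF polyfun_eq_coeffs] allI)
  \<comment> \<open>Both sides are polynomials in \<open>s\<close> that agree everywhere, so their
    coefficients agree. With \<open>n = Suc m\<close> the binomial coefficient is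
    \<open>n * (2 * m + 1)\<close>, and \<open>n\<close> cancels.\<close>
  from spec[OF this, of 2] have "real (2 * n choose 2) * M 2 = real n * E" by (simp add: n_def)
  moreover have "2 * n choose 2 = n * (2 * m + 1)"
    by (simp add: choose_two n_def)
  then have "real (2 * n choose 2) = real n * (2 * real m + 1)"
    by (simp add: distrib_left)
  ultimately have "real n * ((2 * real m + 1) * M 2) = real n * E"
    by (simp only: mult.assoc)
  then have "(2 * real m + 1) * M 2 = E" by (simp add: n_def)
  then show ?thesis by (simp add: M_def E_def n_def)
qed

lemma sphere_moment_0: "sphere_moment TYPE('a::euclidean_space) 0 = 1"
proof -
  interpret prob_space "sphere_prob :: 'a measure" by (rule prob_space_sphere_prob)
  show ?thesis using prob_space by (simp add: sphere_moment_def)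
qed

lemma sphere_moment_nonneg: "sphere_moment TYPE('a::euclidean_space) m \<ge> 0"
  by (simp add: sphere_moment_def)

text \<open>Insert the sum of the squared coordinates, which is 1, under the integral. The
  coordinate along \<open>b\<close> yields the next moment, and each of the others yields the next
  moment divided by \<open>2 * m + 1\<close>.\<close>

lemma sphere_moment_Suc:
  "(2 * real m + 1) * sphere_moment TYPE('a::euclidean_space) m =
     (2 * real m + real DIM('a)) * sphere_moment TYPE('a) (Suc m)"
proof -
  interpret prob_space "sphere_prob :: 'a measure" by (rule prob_space_sphere_prob)
  obtain b :: 'a where b: "b \<in> Basis" using nonempty_Basis by blast
  let ?E = "sphere_moment TYPE('a)"
  have "?E m = (\<integral>z. (z \<bullet> b) ^ (2 * m) \<partial>sphere_prob)"
    using b by (simp add: integral_inner_power)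
  also have "\<dots> = (\<integral>z. (\<Sum>c\<in>Basis. (z \<bullet> c)\<^sup>2 * (z \<bullet> b) ^ (2 * m)) \<partial>sphere_prob)"
  proof (rule Bochner_Integration.integral_cong[OF refl])
    fix z :: 'a assume "z \<in> space sphere_prob"
    then have "norm z = 1" by simp
    then have "(\<Sum>c\<in>Basis. (z \<bullet> c)\<^sup>2) = 1"
      using euclidean_inner[of z z] by (simp add: norm_eq_1 power2_eq_square)
    then show "(z \<bullet> b) ^ (2 * m) = (\<Sum>c\<in>Basis. (z \<bullet> c)\<^sup>2 * (z \<bullet> b) ^ (2 * m))"
      by (simp flip: sum_distrib_right)
  qed
  also have "\<dots> = (\<Sum>c\<in>Basis. \<integral>z. (z \<bullet> c)\<^sup>2 * (z \<bullet> b) ^ (2 * m) \<partial>sphere_prob)"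
    by (intro Bochner_Integration.integral_sum integrable_sphere_prob_continuous continuous_intros)
  also have "\<dots> = (\<integral>z. (z \<bullet> b)\<^sup>2 * (z \<bullet> b) ^ (2 * m) \<partial>sphere_prob) +
      (\<Sum>c\<in>Basis - {b}. \<integral>z. (z \<bullet> c)\<^sup>2 * (z \<bullet> b) ^ (2 * m) \<partial>sphere_prob)"
    by (rule sum.remove[OF finite_Basis b])
  also have "(\<integral>z. (z \<bullet> b)\<^sup>2 * (z \<bullet> b) ^ (2 * m) \<partial>sphere_prob) = ?E (Suc m)"
    using integral_inner_power[of b "Suc m"] b by (simp add: power2_eq_square mult.assoc)
  finally have "(2 * real m + 1) * ?E m = (2 * real m + 1) * ?E (Suc m) +
      (\<Sum>c\<in>Basis - {b}. (2 * real m + 1) * (\<integral>z. (z \<bullet> c)\<^sup>2 * (z \<bullet> b) ^ (2 * m) \<partial>sphere_prob))"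
    by (simp add: distrib_left sum_distrib_left)
  also have "(\<Sum>c\<in>Basis - {b}. (2 * real m + 1) * (\<integral>z. (z \<bullet> c)\<^sup>2 * (z \<bullet> b) ^ (2 * m) \<partial>sphere_prob)) =
      (\<Sum>c\<in>Basis - {b}. ?E (Suc m))"
    using b by (intro sum.cong integral_inner_power_mixed) auto
  also have "\<dots> = (real DIM('a) - 1) * ?E (Suc m)"
    using b DIM_positive[where 'a = 'a] by (simp add: card_Diff_singleton of_nat_diff)
  finally show ?thesis by (simp add: algebra_simps)
qed

text \<open>With \<open>x = 2 * m + d + 1\<close> the recursion multiplies by
  \<open>1 - d / x\<close>, at most \<open>exp (- (d / x))\<close>, while the claimed bound shrinks
  by \<open>(x / (x + 2)) powr (d / 2)\<close>, at least the same exponential.\<close>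

lemma sphere_moment_le:
  assumes n: "real DIM('a::euclidean_space) = d + 1" and d: "d \<ge> 0"
  shows "sphere_moment TYPE('a) m \<le> ((d + 1) / (2 * real m + d + 1)) powr (d / 2)"
proof (induction m)
  case 0
  show ?case using d by (simp add: sphere_moment_0)
next
  case (Suc m)
  let ?E = "sphere_moment TYPE('a)"
  define x where "x = 2 * real m + d + 1"
  have x: "x > 0" "x \<ge> d" using d by (simp_all add: x_def)
  have "((x + 2) / x) powr (d / 2) \<le> exp (2 / x) powr (d / 2)"
    using x d exp_ge_add_one_self[of "2 / x"]
    by (intro powr_mono2) (auto simp: add_divide_distrib)
  also have "\<dots> = exp (d / x)" by (simp add: exp_powr_real)
  finally have "(1 - d / x) * ((x + 2) / x) powr (d / 2) \<le> exp (- (d / x)) * exp (d / x)"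
    using exp_ge_add_one_self[of "- (d / x)"] x by (intro mult_mono) auto
  then have *: "(1 - d / x) * ((x + 2) / x) powr (d / 2) \<le> 1" by (simp add: exp_minus)
  have "?E (Suc m) = (1 - d / x) * ?E m"
  proof -
    have "(x - d) * ?E m = x * ?E (Suc m)"
      using sphere_moment_Suc[where 'a = 'a, of m] by (simp add: n x_def algebra_simps)
    then show ?thesis using x by (simp add: field_simps)
  qed
  also have "\<dots> \<le> (1 - d / x) * ((d + 1) / x) powr (d / 2)"
    using Suc x by (intro mult_left_mono) (auto simp: x_def add_ac)
  also have "((d + 1) / x) powr (d / 2) = ((d + 1) / (x + 2)) powr (d / 2) * ((x + 2) / x) powr (d / 2)"
    using x d by (subst powr_mult[symmetric]) auto
  also have "(1 - d / x) * \<dots> \<le> ((d + 1) / (x + 2)) powr (d / 2)"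
    using mult_left_mono[OF *, of "((d + 1) / (x + 2)) powr (d / 2)"] by (simp add: mult_ac)
  finally show ?case by (simp add: x_def add_ac)
qed

section \<open>Positive definiteness of the power kernels\<close>

text \<open>Shows that the power is an inner product of k-fold tensor powers. Indexing the monomials
  by words, not by multisets, avoids multinomial coefficients.\<close>

lemma inner_power_eq_sum_monomials:
  fixes z w :: "'a::euclidean_space"
  shows "(z \<bullet> w) ^ k = (\<Sum>f\<in>{..<k} \<rightarrow>\<^sub>E Basis. (\<Prod>i<k. z \<bullet> f i) * (\<Prod>i<k. w \<bullet> f i))"
proof -
  have "(z \<bullet> w) ^ k = (\<Prod>i<k. \<Sum>b\<in>Basis. (z \<bullet> b) * (w \<bullet> b))"
    by (simp flip: euclidean_inner)
  also have "\<dots> = (\<Sum>f\<in>{..<k} \<rightarrow>\<^sub>E Basis. \<Prod>i<k. (z \<bullet> f i) * (w \<bullet> f i))"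
    by (rule prod_sum_PiE) auto
  finally show ?thesis by (simp add: prod.distrib)
qed

text \<open>In the feature space of monomials let \<open>a\<close> be the mean over the points and
  \<open>t\<close> the mean over the sphere. Rotation invariance makes the inner products of
  \<open>t\<close> with \<open>a\<close> and with itself both equal to the moment, so the squared
  distance of \<open>a\<close> and \<open>t\<close> is the energy minus the moment.\<close>

lemma sphere_moment_le_energy:
  fixes Z :: "'a::euclidean_space set"
  assumes Z: "finite Z" "Z \<noteq> {}" "Z \<subseteq> sphere 0 1"
  shows "sphere_moment TYPE('a) m \<le> (\<Sum>z\<in>Z. \<Sum>w\<in>Z. (z \<bullet> w) ^ (2 * m)) / (real (card Z))\<^sup>2"
proof -
  interpret prob_space "sphere_prob :: 'a measure" by (rule prob_space_sphere_prob)
  let ?F = "{..<2 * m} \<rightarrow>\<^sub>E (Basis :: 'a set)"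
  define mon where "mon f z = (\<Prod>i<2 * m. z \<bullet> f i)" for f and z :: 'a
  define N where "N = real (card Z)"
  have N: "N > 0" using Z by (simp add: N_def card_gt_0_iff)
  define a where "a f = (\<Sum>z\<in>Z. mon f z) / N" for f
  define t where "t f = (\<integral>z. mon f z \<partial>sphere_prob)" for f
  let ?I = "sphere_moment TYPE('a) m"
  have F: "finite ?F" by (intro finite_PiE) auto
  have int: "integrable sphere_prob (mon f)" for f
    unfolding mon_def by (intro integrable_sphere_prob_continuous continuous_intros)
  have ip: "(\<Sum>f\<in>?F. mon f z * mon f w) = (z \<bullet> w) ^ (2 * m)" for z w
    by (simp add: inner_power_eq_sum_monomials mon_def)
  have pt: "(\<Sum>f\<in>?F. mon f z * t f) = ?I" if "norm z = 1" for z
  proof -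
    have "(\<Sum>f\<in>?F. mon f z * t f) = (\<integral>w. (\<Sum>f\<in>?F. mon f z * mon f w) \<partial>sphere_prob)"
      unfolding t_def using int by (subst Bochner_Integration.integral_sum) auto
    also have "\<dots> = (\<integral>w. (w \<bullet> z) ^ (2 * m) \<partial>sphere_prob)"
      by (simp add: ip inner_commute)
    also have "\<dots> = ?I" using that by (simp add: integral_inner_power)
    finally show ?thesis .
  qed
  have at: "(\<Sum>f\<in>?F. a f * t f) = ?I"
  proof -
    have "(\<Sum>f\<in>?F. a f * t f) = (\<Sum>f\<in>?F. \<Sum>z\<in>Z. mon f z * t f) / N"
      by (simp add: a_def sum_divide_distrib sum_distrib_right)
    also have "\<dots> = (\<Sum>z\<in>Z. \<Sum>f\<in>?F. mon f z * t f) / N" by (subst sum.swap) simp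
    also have "\<dots> = (\<Sum>z\<in>Z. ?I) / N" using Z(3) by (intro arg_cong[where f = "\<lambda>x. x / N"] sum.cong pt) auto
    also have "\<dots> = ?I" using N by (simp add: N_def)
    finally show ?thesis .
  qed
  have tt: "(\<Sum>f\<in>?F. t f * t f) = ?I"
  proof -
    have "(\<Sum>f\<in>?F. t f * t f) = (\<integral>z. (\<Sum>f\<in>?F. mon f z * t f) \<partial>sphere_prob)"
      using int by (subst Bochner_Integration.integral_sum) (auto simp: t_def)
    also have "\<dots> = (\<integral>z. ?I \<partial>(sphere_prob :: 'a measure))"
      by (intro Bochner_Integration.integral_cong refl pt) simp
    also have "\<dots> = ?I" using prob_space by simp
    finally show ?thesis .
  qed
  have aa: "(\<Sum>f\<in>?F. a f * a f) = (\<Sum>z\<in>Z. \<Sum>w\<in>Z. (z \<bullet> w) ^ (2 * m)) / N\<^sup>2"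
  proof -
    have "(\<Sum>f\<in>?F. a f * a f) = (\<Sum>f\<in>?F. \<Sum>z\<in>Z. \<Sum>w\<in>Z. mon f z * mon f w) / N\<^sup>2"
      by (simp add: a_def sum_divide_distrib sum_product power2_eq_square)
    also have "(\<Sum>f\<in>?F. \<Sum>z\<in>Z. \<Sum>w\<in>Z. mon f z * mon f w) = (\<Sum>z\<in>Z. \<Sum>f\<in>?F. \<Sum>w\<in>Z. mon f z * mon f w)"
      by (rule sum.swap)
    also have "\<dots> = (\<Sum>z\<in>Z. \<Sum>w\<in>Z. \<Sum>f\<in>?F. mon f z * mon f w)"
      by (intro sum.cong refl sum.swap)
    finally show ?thesis by (simp add: ip)
  qed
  have "0 \<le> (\<Sum>f\<in>?F. (a f - t f)\<^sup>2)" by (intro sum_nonneg) simp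
  also have "\<dots> = (\<Sum>f\<in>?F. a f * a f) - 2 * (\<Sum>f\<in>?F. a f * t f) + (\<Sum>f\<in>?F. t f * t f)"
    by (simp add: power2_eq_square algebra_simps sum.distrib sum_subtractf sum_distrib_left)
  finally show ?thesis unfolding at tt aa by (simp add: N_def)
qed

subsection \<open>The lower bound\<close>

lemma sign_nonneg_measurable [measurable]: "sign_nonneg \<in> borel_measurable borel"
  unfolding sign_nonneg_def by measurable

lemma abs_sign_nonneg [simp]: "\<bar>sign_nonneg t\<bar> = 1"
  by (simp add: sign_nonneg_def)

lemma sphere_prob_Fubini:
  fixes h :: "'a::euclidean_space \<Rightarrow> 'a \<Rightarrow> real"
  assumes h: "(\<lambda>p. h (fst p) (snd p)) \<in> borel_measurable (borel \<Otimes>\<^sub>M borel)" and B: "\<And>x y. \<bar>h x y\<bar> \<le> B"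
  shows "(\<integral>x. \<integral>y. h x y \<partial>sphere_prob \<partial>sphere_prob) = (\<integral>y. \<integral>x. h x y \<partial>sphere_prob \<partial>sphere_prob)"
proof -
  interpret S: prob_space "sphere_prob :: 'a measure" by (rule prob_space_sphere_prob)
  interpret P: pair_prob_space "sphere_prob :: 'a measure" "sphere_prob :: 'a measure" ..
  have "fst \<in> sphere_prob \<Otimes>\<^sub>M sphere_prob \<rightarrow>\<^sub>M (borel :: 'a measure)"
    by (rule measurable_compose[OF measurable_fst borel_measurable_sphere_prob]) simp
  moreover have "snd \<in> sphere_prob \<Otimes>\<^sub>M sphere_prob \<rightarrow>\<^sub>M (borel :: 'a measure)"
    by (rule measurable_compose[OF measurable_snd borel_measurable_sphere_prob]) simp
  ultimately have "(\<lambda>p. (fst p, snd p)) \<in> sphere_prob \<Otimes>\<^sub>M sphere_prob \<rightarrow>\<^sub>M (borel \<Otimes>\<^sub>M borel :: ('a \<times> 'a) measure)"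
    by (rule measurable_Pair)
  from measurable_compose[OF this h]
  have "(\<lambda>p. h (fst p) (snd p)) \<in> borel_measurable (sphere_prob \<Otimes>\<^sub>M sphere_prob)"
    by simp
  then have "integrable (sphere_prob \<Otimes>\<^sub>M sphere_prob) (\<lambda>(x, y). h x y)"
    using B by (intro P.integrable_const_bound[where B = B]) (auto simp: case_prod_beta')
  from P.Fubini_integral[OF this] show ?thesis by simp
qed

text \<open>Clamping makes the kernel continuous on all of \<open>\<real>\<close>.\<close>

definition sign_kernel :: "real \<Rightarrow> real" where
  "sign_kernel t = 2 / pi * arcsin (max (- 1) (min 1 t))"

lemma continuous_on_sign_kernel: "continuous_on A sign_kernel"
  unfolding sign_kernel_def by (intro continuous_intros) auto

lemma sign_kernel_measurable [measurable]: "sign_kernel \<in> borel_measurable borel"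
  by (intro borel_measurable_continuous_onI continuous_on_sign_kernel)

lemma abs_sign_kernel_le: "\<bar>sign_kernel t\<bar> \<le> 1"
proof -
  define a where "a = arcsin (max (- 1) (min 1 t))"
  have "- (pi / 2) \<le> a" "a \<le> pi / 2"
    unfolding a_def by (rule arcsin_lbound arcsin_ubound; simp)+
  then have "\<bar>2 / pi * a\<bar> \<le> 1" by (simp add: abs_le_iff field_simps)
  then show ?thesis by (simp add: sign_kernel_def a_def)
qed

lemma integral_sign_kernel:
  fixes x y :: "'a::euclidean_space"
  assumes dim: "DIM('a) \<ge> 2" and x: "norm x = 1" and y: "norm y = 1"
  shows "(\<integral>z. sign_nonneg (x \<bullet> z) * sign_nonneg (y \<bullet> z) \<partial>sphere_prob) = sign_kernel (x \<bullet> y)"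
  using integral_sign_product[OF assms] Cauchy_Schwarz_ineq2[of x y] x y
  by (simp add: sign_kernel_def abs_le_iff)

lemma sign_kernel_sq_sums:
  fixes x y :: "'a::euclidean_space"
  assumes x: "norm x = 1" and y: "norm y = 1"
  shows "(\<lambda>m. arcsin_sq_coeff m * (x \<bullet> y) ^ (2 * Suc m)) sums (sign_kernel (x \<bullet> y))\<^sup>2"
  using arcsin_sq_sums[of "x \<bullet> y"] Cauchy_Schwarz_ineq2[of x y] x y
  by (simp add: sign_kernel_def abs_le_iff)

section \<open>The energy of the point set and the mean square discrepancy\<close>

text \<open>The sum on the left does not mention \<open>z\<close>; thus the integral is the same
  constant for all unit vectors. Nonnegative coefficients and summability at t = 1 justify the
  termwise integration.\<close>

lemma integral_sign_kernel_sq_sums: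
  fixes z :: "'a::euclidean_space"
  assumes z: "norm z = 1"
  shows "(\<lambda>m. arcsin_sq_coeff m * sphere_moment TYPE('a) (Suc m)) sums (\<integral>v. (sign_kernel (z \<bullet> v))\<^sup>2 \<partial>sphere_prob)"
proof -
  let ?f = "\<lambda>m v. arcsin_sq_coeff m * (v \<bullet> z) ^ (2 * Suc m)"
  have summ1: "summable arcsin_sq_coeff"
    using arcsin_sq_sums[of 1] by (auto intro: sums_summable)
  have int: "integrable sphere_prob (?f m)" for m
    by (intro integrable_sphere_prob_continuous continuous_intros)
  have le1: "sphere_moment TYPE('a) m \<le> 1" for m
    using sphere_moment_le[of "real DIM('a) - 1", where 'a = 'a, of m]
      DIM_positive[where 'a = 'a]
    by (auto intro!: powr_le1 elim!: order_trans simp: divide_le_eq_1)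
  have If: "(\<integral>v. ?f m v \<partial>sphere_prob) = arcsin_sq_coeff m * sphere_moment TYPE('a) (Suc m)" for m
    using integral_inner_power[of z "Suc m"] z by simp
  have nn: "norm (?f m v) = ?f m v" for m v
    unfolding real_norm_def
    by (intro abs_of_nonneg mult_nonneg_nonneg arcsin_sq_coeff_nonneg zero_le_even_power) simp
  have s: "(\<lambda>m. ?f m v) sums (sign_kernel (z \<bullet> v))\<^sup>2" if "norm v = 1" for v
    using sign_kernel_sq_sums[OF z that] by (simp add: inner_commute)
  have "(\<lambda>m. \<integral>v. ?f m v \<partial>sphere_prob) sums (\<integral>v. (\<Sum>m. ?f m v) \<partial>sphere_prob)"
  proof (rule sums_integral[OF int])
    show "AE v in sphere_prob. summable (\<lambda>m. norm (?f m v))"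
      unfolding nn using s by (intro AE_I2 sums_summable) auto
    show "summable (\<lambda>m. \<integral>v. norm (?f m v) \<partial>sphere_prob)"
      unfolding nn If
      by (rule summable_comparison_test'[OF summ1])
        (auto simp: abs_mult arcsin_sq_coeff_nonneg sphere_moment_nonneg intro!: mult_left_le le1)
  qed
  moreover have "(\<integral>v. (\<Sum>m. ?f m v) \<partial>sphere_prob) = (\<integral>v. (sign_kernel (z \<bullet> v))\<^sup>2 \<partial>sphere_prob)"
    using s by (intro Bochner_Integration.integral_cong refl sums_unique[symmetric]) auto
  ultimately show ?thesis by (simp only: If)
qed

text \<open>Write the kernel at \<open>x\<close> and \<open>y\<close> as the integral of a product
  of signs over a new point \<open>v\<close>. Then the integrals over \<open>y\<close> and over
  \<open>x\<close> each produce one factor \<open>sign_kernel (z \<bullet> v)\<close>.\<close>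

lemma integral_sign_cross:
  fixes z :: "'a::euclidean_space"
  assumes dim: "DIM('a) \<ge> 2" and z: "norm z = 1"
  shows "(\<integral>x. \<integral>y. sign_nonneg (x \<bullet> z) * sign_nonneg (y \<bullet> z) * sign_kernel (x \<bullet> y) \<partial>sphere_prob \<partial>sphere_prob)
    = (\<integral>v. (sign_kernel (z \<bullet> v))\<^sup>2 \<partial>sphere_prob)"
proof -
  let ?s = "\<lambda>x z::'a. sign_nonneg (x \<bullet> z)"
  have inner: "(\<integral>y. ?s x z * ?s y z * sign_kernel (x \<bullet> y) \<partial>sphere_prob) = (\<integral>v. ?s x z * ?s x v * sign_kernel (z \<bullet> v) \<partial>sphere_prob)"
    if x: "norm x = 1" for x
  proof -
    have "(\<integral>y. ?s x z * ?s y z * sign_kernel (x \<bullet> y) \<partial>sphere_prob) =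
        (\<integral>y. \<integral>v. ?s x z * ?s y z * (?s x v * ?s y v) \<partial>sphere_prob \<partial>sphere_prob)"
      using x by (intro Bochner_Integration.integral_cong refl) (simp add: integral_sign_kernel[OF dim x])
    also have "\<dots> = (\<integral>v. \<integral>y. ?s x z * ?s y z * (?s x v * ?s y v) \<partial>sphere_prob \<partial>sphere_prob)"
      by (rule sphere_prob_Fubini[where B = 1]) (simp_all add: abs_mult)
    also have "\<dots> = (\<integral>v. \<integral>y. ?s x z * ?s x v * (?s z y * ?s v y) \<partial>sphere_prob \<partial>sphere_prob)"
      by (simp add: inner_commute mult_ac)
    also have "\<dots> = (\<integral>v. ?s x z * ?s x v * sign_kernel (z \<bullet> v) \<partial>sphere_prob)"
      by (intro Bochner_Integration.integral_cong refl) (simp add: integral_sign_kernel[OF dim z])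
    finally show ?thesis .
  qed
  have "(\<integral>x. \<integral>y. ?s x z * ?s y z * sign_kernel (x \<bullet> y) \<partial>sphere_prob \<partial>sphere_prob) =
      (\<integral>x. \<integral>v. ?s x z * ?s x v * sign_kernel (z \<bullet> v) \<partial>sphere_prob \<partial>sphere_prob)"
    by (intro Bochner_Integration.integral_cong refl inner) simp
  also have "\<dots> = (\<integral>v. \<integral>x. ?s x z * ?s x v * sign_kernel (z \<bullet> v) \<partial>sphere_prob \<partial>sphere_prob)"
    by (rule sphere_prob_Fubini[where B = 1]) (simp_all add: abs_mult abs_sign_kernel_le)
  also have "\<dots> = (\<integral>v. \<integral>x. ?s z x * ?s v x * sign_kernel (z \<bullet> v) \<partial>sphere_prob \<partial>sphere_prob)"
    by (simp add: inner_commute)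
  also have "\<dots> = (\<integral>v. (sign_kernel (z \<bullet> v))\<^sup>2 \<partial>sphere_prob)"
    by (intro Bochner_Integration.integral_cong refl) (simp add: integral_sign_kernel[OF dim z] power2_eq_square)
  finally show ?thesis .
qed

lemma abs_wedge_deviation_le:
  fixes Z :: "'a::euclidean_space set"
  assumes "norm x = 1" "norm y = 1"
  shows "\<bar>real (card (Z \<inter> wedge x y)) / real (card Z) - measure sphere_prob (wedge x y)\<bar> \<le> wedge_discrepancy Z"
proof -
  have "(x, y) \<in> sphere 0 1 \<times> sphere 0 1" using assms by simp
  from cSUP_upper[OF this bdd_above_wedge_discrepancy, of Z] show ?thesis
    by (simp add: wedge_discrepancy_def)
qed

lemma wedge_discrepancy_le:
  fixes Z :: "'a::euclidean_space set"
  assumes "\<And>x y. norm x = 1 \<Longrightarrow> norm y = 1 \<Longrightarrow>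
    \<bar>real (card (Z \<inter> wedge x y)) / real (card Z) - measure sphere_prob (wedge x y)\<bar> \<le> D"
  shows "wedge_discrepancy Z \<le> D"
proof -
  obtain z :: 'a where "norm z = 1" using vector_choose_size[of 1] by auto
  then have "sphere (0::'a) 1 \<noteq> {}" by auto
  then show ?thesis
    unfolding wedge_discrepancy_def using assms by (intro cSUP_least) auto
qed

text \<open>Integrate the squared deviation
  \<open>(av x y - sign_kernel (x \<bullet> y))\<^sup>2\<close> over both poles. The pure point term
  is the energy of the points, while the mixed term and the pure measure term both give
  \<open>G\<close>, leaving energy - 2 G + G. A product of signs is 1 minus twice the indicator of
  the wedge, so each deviation doubles; hence the factor 4.\<close>

lemma energy_le_wedge_discrepancy:
  fixes Z :: "'a::euclidean_space set" and z0 :: 'a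
  assumes dim: "DIM('a) \<ge> 2" and Z: "finite Z" "Z \<noteq> {}" "Z \<subseteq> sphere 0 1" and z0: "norm z0 = 1"
  shows "(\<Sum>z\<in>Z. \<Sum>w\<in>Z. (sign_kernel (z \<bullet> w))\<^sup>2) / (real (card Z))\<^sup>2 - (\<integral>v. (sign_kernel (z0 \<bullet> v))\<^sup>2 \<partial>sphere_prob)
    \<le> 4 * (wedge_discrepancy Z)\<^sup>2"
proof -
  interpret prob_space "sphere_prob :: 'a measure" by (rule prob_space_sphere_prob)
  let ?s = "\<lambda>x z::'a. sign_nonneg (x \<bullet> z)"
  let ?g = "\<lambda>x y::'a. sign_kernel (x \<bullet> y)"
  define N where "N = real (card Z)"
  define G where "G = (\<integral>v. (?g z0 v)\<^sup>2 \<partial>sphere_prob)"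
  define D where "D = wedge_discrepancy Z"
  define av where "av x y = (\<Sum>z\<in>Z. ?s x z * ?s y z) / N" for x y
  have N: "N > 0" using Z by (simp add: N_def card_gt_0_iff)
  have Gz: "(\<integral>v. (?g z v)\<^sup>2 \<partial>sphere_prob) = G" if "norm z = 1" for z
    using sums_unique2[OF integral_sign_kernel_sq_sums[OF that] integral_sign_kernel_sq_sums[OF z0]]
    by (simp add: G_def)
  have av_bd: "\<bar>av x y\<bar> \<le> 1" for x y
  proof -
    have "\<bar>\<Sum>z\<in>Z. ?s x z * ?s y z\<bar> \<le> (\<Sum>z\<in>Z. \<bar>?s x z * ?s y z\<bar>)" by (rule sum_abs)
    also have "\<dots> = N" by (simp add: abs_mult N_def)
    finally show ?thesis using N by (simp add: av_def field_simps)
  qed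
  have diff: "\<bar>av x y - ?g x y\<bar> \<le> 2 * D" if x: "norm x = 1" and y: "norm y = 1" for x y
  proof -
    have "(\<Sum>z\<in>Z. ?s x z * ?s y z) = (\<Sum>z\<in>Z. 1 - 2 * indicator (wedge x y) z)"
      using Z by (intro sum.cong refl) (auto simp: wedge_def sign_nonneg_def indicator_def)
    also have "\<dots> = N - 2 * real (card (Z \<inter> wedge x y))"
      using Z(1) by (simp add: sum_subtractf N_def sum_distrib_left[symmetric] indicator_def sum.If_cases Int_def)
    finally have "av x y = 1 - 2 * (real (card (Z \<inter> wedge x y)) / N)"
      using N by (simp add: av_def field_simps)
    moreover have "?g x y = 1 - 2 * measure sphere_prob (wedge x y)"
      using Cauchy_Schwarz_ineq2[of x y] x y
      by (simp add: measure_wedge[OF dim x y] arccos_arcsin_eq abs_le_iff sign_kernel_def field_simps)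
    ultimately show ?thesis
      using abs_wedge_deviation_le[OF x y, of Z] by (simp add: D_def N_def)
  qed
  have sq: "(av x y - ?g x y)\<^sup>2 \<le> 4 * D\<^sup>2" if "norm x = 1" "norm y = 1" for x y
  proof -
    have "(av x y - ?g x y)\<^sup>2 \<le> (2 * D)\<^sup>2"
      using power_mono[OF diff[OF that], of 2] by simp
    then show ?thesis by (simp add: power_mult_distrib)
  qed
  have [measurable]: "(\<lambda>y. av x y) \<in> borel_measurable borel" for x unfolding av_def by measurable
  have intg: "integrable sphere_prob h" if "h \<in> borel_measurable borel" "\<And>z. \<bar>h z\<bar> \<le> 1" for h :: "'a \<Rightarrow> real"
    using that by (intro integrable_sphere_prob_bounded) auto
  \<comment> \<open>\<open>a2\<close> and \<open>c\<close> are the results of integrating over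
    \<open>y\<close> alone, with \<open>x\<close> still fixed.\<close>
  define a2 where "a2 x = (\<Sum>z\<in>Z. \<Sum>w\<in>Z. ?s x z * ?s x w * ?g z w) / N\<^sup>2" for x
  define c where "c x = (\<Sum>z\<in>Z. \<integral>y. ?s x z * ?s y z * ?g x y \<partial>sphere_prob) / N" for x
  have a2: "(\<integral>y. (av x y)\<^sup>2 \<partial>sphere_prob) = a2 x" for x
  proof -
    have "(\<integral>y. (av x y)\<^sup>2 \<partial>sphere_prob) = (\<integral>y. (\<Sum>z\<in>Z. \<Sum>w\<in>Z. ?s x z * ?s x w * (?s z y * ?s w y)) / N\<^sup>2 \<partial>sphere_prob)"
      by (simp add: av_def power_divide power2_eq_square sum_product inner_commute[of _ "_::'a"] mult_ac)
    also have "\<dots> = (\<Sum>z\<in>Z. \<Sum>w\<in>Z. \<integral>y. ?s x z * ?s x w * (?s z y * ?s w y) \<partial>sphere_prob) / N\<^sup>2"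
    proof -
      have "integrable sphere_prob (\<lambda>y. ?s x z * ?s x w * (?s z y * ?s w y))" for z w
        by (intro intg) (auto simp: abs_mult)
      then show ?thesis
        by (simp add: Bochner_Integration.integral_sum Bochner_Integration.integrable_sum del: integral_mult_right_zero)
    qed
    also have "\<dots> = a2 x"
      unfolding a2_def using Z
      by (intro arg_cong[where f = "\<lambda>t. t / N\<^sup>2"] sum.cong refl) (auto simp: integral_sign_kernel[OF dim] subset_iff)
    finally show ?thesis .
  qed
  have c: "(\<integral>y. av x y * ?g x y \<partial>sphere_prob) = c x" for x
  proof -
    have "(\<integral>y. av x y * ?g x y \<partial>sphere_prob) = (\<integral>y. (\<Sum>z\<in>Z. ?s x z * ?s y z * ?g x y) / N \<partial>sphere_prob)"
      by (simp add: av_def sum_distrib_right)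
    also have "\<dots> = c x"
    proof -
      have "integrable sphere_prob (\<lambda>y. ?s x z * ?s y z * ?g x y)" for z
        by (intro intg) (auto simp: abs_mult abs_sign_kernel_le)
      then show ?thesis
        by (simp add: c_def Bochner_Integration.integral_sum Bochner_Integration.integrable_sum)
    qed
    finally show ?thesis .
  qed
  have "(\<integral>y. (av x y - ?g x y)\<^sup>2 \<partial>sphere_prob) = a2 x - 2 * c x + G" if x: "norm x = 1" for x
  proof -
    have "(\<integral>y. (av x y - ?g x y)\<^sup>2 \<partial>sphere_prob) = (\<integral>y. (av x y)\<^sup>2 - 2 * (av x y * ?g x y) + (?g x y)\<^sup>2 \<partial>sphere_prob)"
      by (simp add: power2_eq_square algebra_simps)
    also have "\<dots> = (\<integral>y. (av x y)\<^sup>2 \<partial>sphere_prob) - 2 * (\<integral>y. av x y * ?g x y \<partial>sphere_prob) + (\<integral>y. (?g x y)\<^sup>2 \<partial>sphere_prob)"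
    proof -
      have 1: "integrable sphere_prob (\<lambda>y. (av x y)\<^sup>2)"
        using av_bd by (intro intg) (auto simp: abs_square_le_1)
      have 2: "integrable sphere_prob (\<lambda>y. av x y * ?g x y)"
        using av_bd by (intro intg) (auto simp: abs_mult intro!: mult_le_one abs_sign_kernel_le)
      have 3: "integrable sphere_prob (\<lambda>y. (?g x y)\<^sup>2)"
        by (intro intg) (auto simp: abs_square_le_1 abs_sign_kernel_le)
      show ?thesis using 1 2 3 by simp
    qed
    finally show ?thesis by (simp add: a2 c Gz[OF x])
  qed
  moreover have "(\<integral>y. (av x y - ?g x y)\<^sup>2 \<partial>sphere_prob) \<le> 4 * D\<^sup>2" if x: "norm x = 1" for x
  proof (rule integral_le_const)
    have "\<bar>(av x y - ?g x y)\<^sup>2\<bar> \<le> 4 * D\<^sup>2" if "norm y = 1" for y using sq[OF x that] by simp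
    then show "integrable sphere_prob (\<lambda>y. (av x y - ?g x y)\<^sup>2)"
      by (intro integrable_sphere_prob_bounded[where B = "4 * D\<^sup>2"]) auto
  qed (use sq[OF x] in auto)
  ultimately have key: "a2 x - 2 * c x + G \<le> 4 * D\<^sup>2" if "norm x = 1" for x
    using that by fastforce
  have ia: "integrable sphere_prob a2"
    unfolding a2_def by (intro integrable_divide_zero impI Bochner_Integration.integrable_sum intg)
      (auto simp: abs_mult abs_sign_kernel_le)
  have ic0: "integrable sphere_prob (\<lambda>x. \<integral>y. ?s x z * ?s y z * ?g x y \<partial>sphere_prob)" for z
  proof (rule integrable_const_bound[where B = 1])
    show "AE x in sphere_prob. norm (\<integral>y. ?s x z * ?s y z * ?g x y \<partial>sphere_prob) \<le> 1"
    proof (rule AE_I2)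
      fix x :: 'a
      have "\<bar>\<integral>y. ?s x z * ?s y z * ?g x y \<partial>sphere_prob\<bar> \<le> (\<integral>y. \<bar>?s x z * ?s y z * ?g x y\<bar> \<partial>sphere_prob)"
        by (rule integral_abs_bound)
      also have "\<dots> \<le> 1"
        by (rule integral_le_const) (auto intro!: intg simp: abs_mult abs_sign_kernel_le)
      finally show "norm (\<integral>y. ?s x z * ?s y z * ?g x y \<partial>sphere_prob) \<le> 1" by simp
    qed
    \<comment> \<open>Measurability in the parameter \<open>x\<close> of an integral over
      \<open>y\<close>, obtained from joint measurability.\<close>
    have "snd \<in> borel \<Otimes>\<^sub>M sphere_prob \<rightarrow>\<^sub>M (borel :: 'a measure)"
      by (rule measurable_compose[OF measurable_snd borel_measurable_sphere_prob]) simp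
    then have "(\<lambda>p. (fst p, snd p)) \<in> borel \<Otimes>\<^sub>M sphere_prob \<rightarrow>\<^sub>M (borel \<Otimes>\<^sub>M borel :: ('a \<times> 'a) measure)"
      by (intro measurable_Pair measurable_fst)
    moreover have "(\<lambda>p. ?s (fst p) z * ?s (snd p) z * ?g (fst p) (snd p)) \<in> borel_measurable (borel \<Otimes>\<^sub>M borel)"
      by measurable
    ultimately have "(\<lambda>(x, y). ?s x z * ?s y z * ?g x y) \<in> borel_measurable (borel \<Otimes>\<^sub>M sphere_prob)"
      using measurable_compose[of "\<lambda>p. (fst p, snd p)"] by (fastforce simp: case_prod_beta')
    then have "(\<lambda>x. \<integral>y. ?s x z * ?s y z * ?g x y \<partial>sphere_prob) \<in> borel_measurable borel"
      by (rule borel_measurable_lebesgue_integral[where f = "\<lambda>x y. ?s x z * ?s y z * ?g x y"])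
    then show "(\<lambda>x. \<integral>y. ?s x z * ?s y z * ?g x y \<partial>sphere_prob) \<in> borel_measurable sphere_prob"
      by (rule borel_measurable_sphere_prob)
  qed
  then have ic: "integrable sphere_prob c"
    unfolding c_def by (intro integrable_divide_zero impI Bochner_Integration.integrable_sum)
  have Ia: "(\<integral>x. a2 x \<partial>sphere_prob) = (\<Sum>z\<in>Z. \<Sum>w\<in>Z. (?g z w)\<^sup>2) / N\<^sup>2"
  proof -
    have "(\<integral>x. a2 x \<partial>sphere_prob) = (\<Sum>z\<in>Z. \<Sum>w\<in>Z. \<integral>x. ?s z x * ?s w x * ?g z w \<partial>sphere_prob) / N\<^sup>2"
    proof -
      have "a2 x = (\<Sum>z\<in>Z. \<Sum>w\<in>Z. ?s z x * ?s w x * ?g z w) / N\<^sup>2" for x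
        unfolding a2_def inner_commute[of x] ..
      moreover have "integrable sphere_prob (\<lambda>x. ?s z x * ?s w x * ?g z w)" for z w
        by (intro intg) (auto simp: abs_mult abs_sign_kernel_le)
      ultimately show ?thesis
        by (simp add: Bochner_Integration.integral_sum Bochner_Integration.integrable_sum del: integral_mult_left_zero)
    qed
    also have "\<dots> = (\<Sum>z\<in>Z. \<Sum>w\<in>Z. (?g z w)\<^sup>2) / N\<^sup>2"
      using Z
      by (intro arg_cong[where f = "\<lambda>t. t / N\<^sup>2"] sum.cong refl) (auto simp: integral_sign_kernel[OF dim] subset_iff power2_eq_square)
    finally show ?thesis .
  qed
  have Ic: "(\<integral>x. c x \<partial>sphere_prob) = G"
  proof -
    have "(\<integral>x. c x \<partial>sphere_prob) = (\<Sum>z\<in>Z. \<integral>x. \<integral>y. ?s x z * ?s y z * ?g x y \<partial>sphere_prob \<partial>sphere_prob) / N"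
      unfolding c_def using ic0 by (subst integral_divide_zero) simp
    also have "\<dots> = (\<Sum>z\<in>Z. G) / N"
      using Z by (intro arg_cong[where f = "\<lambda>t. t / N"] sum.cong refl) (auto simp: integral_sign_cross[OF dim] subset_iff Gz)
    also have "\<dots> = G" using N by (simp add: N_def)
    finally show ?thesis .
  qed
  have "(\<integral>x. a2 x - 2 * c x + G \<partial>sphere_prob) \<le> 4 * D\<^sup>2"
    using key ia ic by (intro integral_le_const) auto
  moreover have "(\<integral>x. a2 x - 2 * c x + G \<partial>sphere_prob) = (\<integral>x. a2 x \<partial>sphere_prob) - 2 * (\<integral>x. c x \<partial>sphere_prob) + G"
    using ia ic prob_space by simp
  ultimately show ?thesis unfolding Ia Ic by (simp add: N_def D_def G_def)
qed


theorem wedge_discrepancy_lower_bound: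
  fixes Z :: "'a::euclidean_space set"
  assumes dim: "DIM('a) = d + 1" and d: "d \<ge> 1" and Z: "finite Z" "card Z = N" "Z \<subseteq> sphere 0 1" and N1: "N \<ge> 1"
  shows "1 / (8 * pi * sqrt (sqrt (real d + 1))) * real N powr (- 1 / 2 - 1 / (2 * real d)) \<le> wedge_discrepancy Z"
proof -
  define D where "D = wedge_discrepancy Z"
  define n where "n = real N"
  have n: "n \<ge> 1" using N1 by (simp add: n_def)
  have dd: "real d \<ge> 1" using d by simp
  have dim2: "DIM('a) \<ge> 2" using dim d by simp
  have Z0: "Z \<noteq> {}" using Z N1 by auto
  then obtain z0 where "z0 \<in> Z" by blast
  with Z(3) have z0: "norm z0 = 1" by auto
  let ?I = "sphere_moment TYPE('a)"
  define A where "A m = (\<Sum>z\<in>Z. \<Sum>w\<in>Z. (z \<bullet> w) ^ (2 * m)) / n\<^sup>2" for m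
  have A_ge: "1 / n \<le> A m" for m
  proof -
    have "n = (\<Sum>z\<in>Z. (z \<bullet> z) ^ (2 * m))"
      using Z by (auto simp: n_def norm_eq_1 subset_iff)
    also have "\<dots> \<le> (\<Sum>z\<in>Z. \<Sum>w\<in>Z. (z \<bullet> w) ^ (2 * m))"
      using Z by (intro sum_mono member_le_sum zero_le_even_power) auto
    finally have "n / n\<^sup>2 \<le> A m" unfolding A_def by (intro divide_right_mono) auto
    then show ?thesis using n by (simp add: power2_eq_square)
  qed
  have AI: "?I m \<le> A m" for m
    using sphere_moment_le_energy[OF Z(1) Z0 Z(3), of m] by (simp add: A_def n_def Z(2))
  have "(\<lambda>m. arcsin_sq_coeff m * A (Suc m)) sums
      ((\<Sum>z\<in>Z. \<Sum>w\<in>Z. (sign_kernel (z \<bullet> w))\<^sup>2) / n\<^sup>2)"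
  proof -
    have "(\<lambda>m. (\<Sum>z\<in>Z. \<Sum>w\<in>Z. arcsin_sq_coeff m * (z \<bullet> w) ^ (2 * Suc m)) / n\<^sup>2) sums
      ((\<Sum>z\<in>Z. \<Sum>w\<in>Z. (sign_kernel (z \<bullet> w))\<^sup>2) / n\<^sup>2)"
      using Z(3) by (intro sums_divide sums_sum sign_kernel_sq_sums) auto
    then show ?thesis by (simp add: A_def sum_distrib_left)
  qed
  from sums_diff[OF this integral_sign_kernel_sq_sums[OF z0]]
  have sm: "(\<lambda>m. arcsin_sq_coeff m * (A (Suc m) - ?I (Suc m))) sums
      ((\<Sum>z\<in>Z. \<Sum>w\<in>Z. (sign_kernel (z \<bullet> w))\<^sup>2) / n\<^sup>2 - (\<integral>v. (sign_kernel (z0 \<bullet> v))\<^sup>2 \<partial>sphere_prob))"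
    (is "_ sums ?R") by (simp add: right_diff_distrib)
  have RD: "?R \<le> 4 * D\<^sup>2"
    using energy_le_wedge_discrepancy[OF dim2 Z(1) Z0 Z(3) z0] by (simp add: n_def D_def Z(2))
  \<comment> \<open>Solves \<open>((d + 1) / K) powr (d / 2) = 1 / (2 * n)\<close>: from here on the
    moment is at most half of the diagonal contribution \<open>1 / n\<close>.\<close>
  define K where "K = (real d + 1) * (2 * n) powr (2 / real d)"
  have "(2 * n) powr (2 / real d) \<ge> 1" using n dd by (intro ge_one_powr_ge_zero) auto
  then have "1 * 1 \<le> K" unfolding K_def using dd by (intro mult_mono) auto
  then have K: "K \<ge> 1" by simp
  define M where "M = nat \<lceil>K\<rceil>"
  have M: "K \<le> real M" "real M \<le> 2 * K" "M \<ge> 1" using K unfolding M_def by linarith+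
  have M0: "real M > 0" using M(3) by simp
  have I_le: "?I (Suc m) \<le> 1 / (2 * n)" if "m \<ge> M" for m
  proof -
    have dim': "real DIM('a) = real d + 1" using dim by simp
    have "real M \<le> real m" using that by simp
    then have "?I (Suc m) \<le> ((real d + 1) / K) powr (real d / 2)"
      using dd K M(1)
      by (intro order_trans[OF sphere_moment_le[OF dim']] powr_mono2 divide_left_mono) auto
    also have "(real d + 1) / K = (2 * n) powr (- 2 / real d)"
    proof -
      have "(real d + 1) / K = 1 / (2 * n) powr (2 / real d)" using dd by (simp add: K_def)
      also have "\<dots> = (2 * n) powr (- (2 / real d))" by (rule powr_minus_divide[symmetric])
      finally show ?thesis by simp
    qed
    also have "((2 * n) powr (- 2 / real d)) powr (real d / 2) = (2 * n) powr - 1"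
      using dd by (simp add: powr_powr)
    also have "\<dots> = 1 / (2 * n)" using n powr_minus_divide[of "2 * n" 1] by simp
    finally show ?thesis .
  qed
  have term_ge: "1 / (4 * pi\<^sup>2 * n * sqrt (2 * real M)) / real M \<le> arcsin_sq_coeff m * (A (Suc m) - ?I (Suc m))"
    if m: "m \<in> {M..<2 * M}" for m
  proof -
    have m1: "m \<ge> 1" "m \<ge> M" using m M by auto
    have "2 / (pi\<^sup>2 * sqrt (2 * real M) * (4 * real M)) \<le> 2 / (pi\<^sup>2 * sqrt (real m) * (2 * real m + 1))"
      using m m1 M0 by (intro divide_left_mono mult_mono mult_pos_pos) auto
    also have "\<dots> \<le> arcsin_sq_coeff m" by (rule arcsin_sq_coeff_ge[OF m1(1)])
    finally have c: "2 / (pi\<^sup>2 * sqrt (2 * real M) * (4 * real M)) \<le> arcsin_sq_coeff m" .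
    \<comment> \<open>Half of the diagonal contribution survives. The lower bound for the
      coefficient uses \<open>m < 2 * M\<close>, which gives
      \<open>2 * m + 1 \<le> 4 * M\<close>.\<close>
    have "1 / (2 * n) \<le> A (Suc m) - ?I (Suc m)"
      using A_ge[of "Suc m"] I_le[OF m1(2)] n by (simp add: field_simps)
    then have "2 / (pi\<^sup>2 * sqrt (2 * real M) * (4 * real M)) * (1 / (2 * n)) \<le> arcsin_sq_coeff m * (A (Suc m) - ?I (Suc m))"
      using c n by (intro mult_mono arcsin_sq_coeff_nonneg) auto
    then show ?thesis by (simp add: mult_ac)
  qed
  have "1 / (4 * pi\<^sup>2 * n * sqrt (2 * real M)) = (\<Sum>m\<in>{M..<2 * M}. 1 / (4 * pi\<^sup>2 * n * sqrt (2 * real M)) / real M)"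
    using M0 by simp
  also have "\<dots> \<le> (\<Sum>m\<in>{M..<2 * M}. arcsin_sq_coeff m * (A (Suc m) - ?I (Suc m)))"
    by (intro sum_mono term_ge)
  \<comment> \<open>The discarded terms are nonnegative by positive definiteness.\<close>
  also have "\<dots> \<le> (\<Sum>m. arcsin_sq_coeff m * (A (Suc m) - ?I (Suc m)))"
    using AI by (intro sum_le_suminf sums_summable[OF sm]) (auto intro!: mult_nonneg_nonneg arcsin_sq_coeff_nonneg)
  also have "\<dots> = ?R" using sums_unique[OF sm] by simp
  also note RD
  finally have low: "1 / (4 * pi\<^sup>2 * n * sqrt (2 * real M)) \<le> 4 * D\<^sup>2" .
  have "sqrt (2 * real M) \<le> sqrt (4 * K)" using M(2) by simp
  also have "\<dots> = 2 * sqrt (real d + 1) * (2 * n) powr (1 / real d)"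
    using n by (simp add: K_def real_sqrt_mult powr_half_sqrt[symmetric] powr_powr)
  also have "(2 * n) powr (1 / real d) = 2 powr (1 / real d) * n powr (1 / real d)"
    by (rule powr_mult)
  also have "2 powr (1 / real d) \<le> 2 powr 1" using dd by (intro powr_mono) auto
  finally have sM: "sqrt (2 * real M) \<le> 4 * sqrt (real d + 1) * n powr (1 / real d)"
    by (simp add: mult_left_mono mult_right_mono)
  define q where "q = n powr (- 1 / 2 - 1 / (2 * real d))"
  have "q\<^sup>2 = n powr (- 1 - 1 / real d)"
    unfolding q_def power2_eq_square powr_add[symmetric]
    by (rule arg_cong[where f = "(powr) n"]) (use dd in \<open>simp add: divide_simps\<close>)
  also have "\<dots> = 1 / (n * n powr (1 / real d))"
    using n by (simp add: powr_diff powr_minus divide_inverse)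
  finally have q2: "q\<^sup>2 = 1 / (n * n powr (1 / real d))" .
  have "(1 / (8 * pi * sqrt (sqrt (real d + 1))) * q)\<^sup>2 = 1 / (64 * pi\<^sup>2 * sqrt (real d + 1)) * q\<^sup>2"
    by (simp add: power_mult_distrib power_divide)
  also have "\<dots> = 1 / (4 * pi\<^sup>2 * n * (4 * sqrt (real d + 1) * n powr (1 / real d))) / 4"
    by (simp add: q2)
  also have "\<dots> \<le> 1 / (4 * pi\<^sup>2 * n * sqrt (2 * real M)) / 4"
    using sM n M0 by (intro divide_right_mono divide_left_mono mult_left_mono mult_pos_pos) auto
  also have "\<dots> \<le> D\<^sup>2" using low by simp
  finally have "(1 / (8 * pi * sqrt (sqrt (real d + 1))) * q)\<^sup>2 \<le> D\<^sup>2" .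
  moreover have "D \<ge> 0"
    using order_trans[OF abs_ge_zero abs_wedge_deviation_le[OF z0 z0, of Z]] by (simp add: D_def)
  ultimately have "1 / (8 * pi * sqrt (sqrt (real d + 1))) * q \<le> D"
    by (rule power2_le_imp_le)
  then show ?thesis by (simp add: q_def n_def D_def)
qed

subsection \<open>Integral transport along a connected graph\<close>

text \<open>
  In \<^term>\<open>transportable adj S\<close>, each \<open>j\<close> holds a mass \<open>a j \<ge> 1\<close>, and \<open>T k j\<close> is the part of it that is
  moved to \<open>k\<close>. Masses move only along edges and become integers, and less than one unit leaves each
  vertex; this last condition is what makes the induction over attached leaves work, since the mass
  received from a leaf has to stay where it arrives.
\<close>

definition transportable :: "('a \<Rightarrow> 'a \<Rightarrow> bool) \<Rightarrow> 'a set \<Rightarrow> bool" where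
  "transportable adj S \<longleftrightarrow> finite S \<and>
    (\<forall>a :: 'a \<Rightarrow> real. (\<forall>j\<in>S. 1 \<le> a j) \<longrightarrow> (\<Sum>j\<in>S. a j) \<in> \<nat> \<longrightarrow>
      (\<exists>(T :: 'a \<Rightarrow> 'a \<Rightarrow> real) (n :: 'a \<Rightarrow> nat).
        (\<forall>k\<in>S. \<forall>j\<in>S. 0 \<le> T k j \<and> (T k j \<noteq> 0 \<longrightarrow> k = j \<or> adj k j)) \<and>
        (\<forall>j\<in>S. (\<Sum>k\<in>S. T k j) = a j) \<and>
        (\<forall>k\<in>S. (\<Sum>j\<in>S. T k j) = real (n k)) \<and>
        (\<forall>k\<in>S. a k - 1 \<le> T k k)))"

lemma transportableD:
  assumes "transportable adj S" "\<forall>j\<in>S. 1 \<le> a j" "(\<Sum>j\<in>S. a j) \<in> \<nat>"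
  shows "\<exists>(T :: 'a \<Rightarrow> 'a \<Rightarrow> real) (n :: 'a \<Rightarrow> nat).
        (\<forall>k\<in>S. \<forall>j\<in>S. 0 \<le> T k j \<and> (T k j \<noteq> 0 \<longrightarrow> k = j \<or> adj k j)) \<and>
        (\<forall>j\<in>S. (\<Sum>k\<in>S. T k j) = a j) \<and>
        (\<forall>k\<in>S. (\<Sum>j\<in>S. T k j) = real (n k)) \<and>
        (\<forall>k\<in>S. a k - 1 \<le> T k k)"
  using assms(1) unfolding transportable_def
  by (elim conjE allE[of _ a]) (use assms(2,3) in auto)

lemma transportable_singleton: "transportable adj {v}"
proof -
  have "\<exists>(T :: 'a \<Rightarrow> 'a \<Rightarrow> real) (n :: 'a \<Rightarrow> nat). 0 \<le> T v v \<and> T v v = a v \<and> T v v = real (n v) \<and> a v - 1 \<le> T v v"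
    if a: "1 \<le> a v" "a v \<in> \<nat>" for a :: "'a \<Rightarrow> real"
  proof -
    obtain m where "a v = real m" using a(2) by (elim Nats_cases)
    then show ?thesis using a by (intro exI[of _ "\<lambda>_. a"] exI[of _ "\<lambda>_. m"]) auto
  qed
  then show ?thesis by (simp add: transportable_def)
qed

text \<open>Keep the integer part of the mass of the leaf \<open>j\<close> and add its fractional
  part \<open>f\<close> to the mass of \<open>k\<close>; the transport on \<open>S\<close> then
  treats \<open>f\<close> as mass of \<open>k\<close>. At least \<open>a k + f - 1 \<ge> f\<close>
  of the mass of \<open>k\<close> stays at \<open>k\<close>, so an amount \<open>f\<close> of what
  stays can be relabelled as coming from \<open>j\<close>. What remains on the diagonal at
  \<open>k\<close> is still at least \<open>a k - 1\<close>.\<close>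

lemma transportable_insert:
  assumes S: "transportable adj S" and k: "k \<in> S" and j: "j \<notin> S" and kj: "adj k j"
  shows "transportable adj (insert j S)"
proof -
  have fin: "finite S" using S by (simp add: transportable_def)
  have "\<exists>(T :: 'a \<Rightarrow> 'a \<Rightarrow> real) (n :: 'a \<Rightarrow> nat).
        (\<forall>k\<in>insert j S. \<forall>i\<in>insert j S. 0 \<le> T k i \<and> (T k i \<noteq> 0 \<longrightarrow> k = i \<or> adj k i)) \<and>
        (\<forall>i\<in>insert j S. (\<Sum>k\<in>insert j S. T k i) = a i) \<and>
        (\<forall>k\<in>insert j S. (\<Sum>i\<in>insert j S. T k i) = real (n k)) \<and>
        (\<forall>k\<in>insert j S. a k - 1 \<le> T k k)"
    if a: "\<forall>i\<in>insert j S. 1 \<le> a i" and sa: "(\<Sum>i\<in>insert j S. a i) \<in> \<nat>" for a :: "'a \<Rightarrow> real"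
  proof -
    define m where "m = nat \<lfloor>a j\<rfloor>"
    define f where "f = a j - real m"
    have aj: "a j \<ge> 1" using a by simp
    have f: "0 \<le> f" "f < 1" "m + f = a j" using aj unfolding f_def m_def by linarith+
    define a' where "a' = a(k := a k + f)"
    have a': "1 \<le> a' i" if "i \<in> S" for i using a that f by (auto simp: a'_def intro: add_increasing2)
    have sum_upd: "(\<Sum>i\<in>S. g i + (if i = k then c else 0)) = (\<Sum>i\<in>S. g i) + c" for g :: "'a \<Rightarrow> real" and c
      using fin k by (simp add: sum.distrib)
    have "(\<Sum>i\<in>S. a' i) = (\<Sum>i\<in>S. a i + (if i = k then f else 0))"
      by (intro sum.cong) (auto simp: a'_def)
    also have "\<dots> = (\<Sum>i\<in>insert j S. a i) - real m"
      using f j fin by (simp add: sum_upd)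
    finally have s': "(\<Sum>i\<in>S. a' i) = (\<Sum>i\<in>insert j S. a i) - real m" .
    obtain M where M: "(\<Sum>i\<in>insert j S. a i) = real M" using sa by (elim Nats_cases)
    have "0 \<le> (\<Sum>i\<in>S. a' i)" using a' by (intro sum_nonneg) (auto intro: order_trans[of 0 1])
    then have "m \<le> M" unfolding s' M by simp
    then have "(\<Sum>i\<in>S. a' i) = real (M - m)" unfolding s' M by simp
    then have nat: "(\<Sum>i\<in>S. a' i) \<in> \<nat>" by simp
    have a'_ball: "\<forall>i\<in>S. 1 \<le> a' i" using a' by blast
    obtain T :: "'a \<Rightarrow> 'a \<Rightarrow> real" and n :: "'a \<Rightarrow> nat" where
      T': "\<forall>k\<in>S. \<forall>j\<in>S. 0 \<le> T k j \<and> (T k j \<noteq> 0 \<longrightarrow> k = j \<or> adj k j)"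
      "\<forall>j\<in>S. (\<Sum>k\<in>S. T k j) = a' j" "\<forall>k\<in>S. (\<Sum>j\<in>S. T k j) = real (n k)"
      "\<forall>k\<in>S. a' k - 1 \<le> T k k"
      using transportableD[OF S a'_ball nat] by (elim exE conjE) (rule that)
    have T: "\<And>k j. k \<in> S \<Longrightarrow> j \<in> S \<Longrightarrow> 0 \<le> T k j"
      "\<And>k j. k \<in> S \<Longrightarrow> j \<in> S \<Longrightarrow> T k j \<noteq> 0 \<Longrightarrow> k = j \<or> adj k j"
      "\<And>j. j \<in> S \<Longrightarrow> (\<Sum>k\<in>S. T k j) = a' j"
      "\<And>k. k \<in> S \<Longrightarrow> (\<Sum>j\<in>S. T k j) = real (n k)"
      "\<And>k. k \<in> S \<Longrightarrow> a' k - 1 \<le> T k k"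
      using T' by blast+
    \<comment> \<open>Row \<open>j\<close> is new and holds only the integer part. Column
      \<open>j\<close> sends \<open>f\<close> to \<open>k\<close>, and the same \<open>f\<close> is
      deducted from the diagonal entry at \<open>k\<close>, so the other row sums are
      unchanged.\<close>
    define U where "U x y = (if x = j then (if y = j then real m else 0)
      else if y = j then (if x = k then f else 0)
      else T x y + (if x = k \<and> y = k then - f else 0))" for x y
    define p where "p = n(j := m)"
    have kj': "k \<noteq> j" using k j by auto
    have Tkk: "T k k \<ge> f" "T k k - f \<ge> a k - 1" using T(5)[OF k] a k f by (auto simp: a'_def)
    have U1: "0 \<le> U x y \<and> (U x y \<noteq> 0 \<longrightarrow> x = y \<or> adj x y)" if "x \<in> insert j S" "y \<in> insert j S" for x y
      using that T(1,2) Tkk f kj by (auto simp: U_def)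
    have col: "(\<Sum>x\<in>insert j S. U x y) = a y" if y: "y \<in> insert j S" for y
    proof (cases "y = j")
      case True
      have "(\<Sum>x\<in>S. U x j) = (\<Sum>x\<in>S. 0 + (if x = k then f else 0))"
        using j by (intro sum.cong) (auto simp: U_def)
      then show ?thesis using f fin j True by (simp only: sum_upd sum.insert) (simp add: U_def)
    next
      case False
      then have yS: "y \<in> S" using y by auto
      have "(\<Sum>x\<in>S. U x y) = (\<Sum>x\<in>S. T x y + (if x = k then (if y = k then - f else 0) else 0))"
        using j False by (intro sum.cong) (auto simp: U_def)
      also have "\<dots> = a' y + (if y = k then - f else 0)" by (simp only: sum_upd T(3)[OF yS])
      also have "\<dots> = a y" by (simp add: a'_def)
      finally show ?thesis using fin j False by (simp add: U_def)
    qed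
    have row: "(\<Sum>y\<in>insert j S. U x y) = real (p x)" if x: "x \<in> insert j S" for x
    proof (cases "x = j")
      case True
      have "(\<Sum>y\<in>S. U j y) = (\<Sum>y\<in>S. 0)" using j by (intro sum.cong) (auto simp: U_def)
      then show ?thesis using fin j True by (simp add: U_def p_def)
    next
      case False
      then have xS: "x \<in> S" using x by auto
      have "(\<Sum>y\<in>S. U x y) = (\<Sum>y\<in>S. T x y + (if y = k then (if x = k then - f else 0) else 0))"
        using j False by (intro sum.cong) (auto simp: U_def)
      also have "\<dots> = real (n x) + (if x = k then - f else 0)" by (simp only: sum_upd T(4)[OF xS])
      finally show ?thesis using fin j False by (simp add: U_def p_def)
    qed
    have diag: "a x - 1 \<le> U x x" if "x \<in> insert j S" for x
      using that f Tkk T(5)[of x] kj' by (auto simp: U_def a'_def split: if_splits)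
    show ?thesis
      using U1 col row diag by (intro exI[of _ U] exI[of _ p]) blast
  qed
  then show ?thesis using fin unfolding transportable_def by blast
qed

text \<open>Take a maximal transportable subset of the net. If it were proper, the balls about it
  and those about the rest would be two open sets covering the connected sphere. They would meet on
  it, and a common point yields an edge to a new leaf.\<close>

lemma transportable_net:
  fixes C :: "'a::euclidean_space set"
  assumes dim: "DIM('a) \<ge> 2" and C: "finite C" "C \<noteq> {}" "C \<subseteq> sphere 0 1" and cov: "sphere 0 1 \<subseteq> (\<Union>c\<in>C. ball c r)"
  shows "transportable (\<lambda>x y. dist x y < 2 * r) C"
proof -
  let ?adj = "\<lambda>x y :: 'a. dist x y < 2 * r"
  let ?Q = "\<lambda>S. S \<noteq> {} \<and> S \<subseteq> C \<and> transportable ?adj S"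
  obtain v where v: "v \<in> C" using C(2) by blast
  have "?Q {v}" using v transportable_singleton by auto
  moreover have "\<forall>S. ?Q S \<longrightarrow> card S < Suc (card C)"
    using C(1) by (auto simp: less_Suc_eq_le intro: card_mono)
  ultimately obtain S where S: "?Q S" and mx: "\<And>R. ?Q R \<Longrightarrow> card R \<le> card S"
    using ex_has_greatest_nat[of ?Q "{v}" card] by metis
  have "S = C"
  proof (rule ccontr)
    assume "S \<noteq> C"
    define A where "A = (\<Union>c\<in>S. ball c r)"
    define B where "B = (\<Union>c\<in>C - S. ball c r)"
    have "v \<in> (\<Union>c\<in>C. ball c r)" using v C(3) cov by blast
    then have r: "r > 0" by (auto intro: le_less_trans[OF zero_le_dist])
    obtain w where w: "w \<in> C - S" using S \<open>S \<noteq> C\<close> by blast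
    obtain u where u: "u \<in> S" using S by blast
    have "u \<in> A" "w \<in> B"
      unfolding A_def B_def using u w r by (blast intro: centre_in_ball[THEN iffD2])+
    moreover have "u \<in> sphere 0 1" "w \<in> sphere 0 1" using u w S C(3) by blast+
    ultimately have "A \<inter> sphere 0 1 \<noteq> {}" "B \<inter> sphere 0 1 \<noteq> {}" by blast+
    moreover have "sphere 0 1 \<subseteq> A \<union> B" using cov by (auto simp: A_def B_def)
    moreover have "open A" "open B" by (auto simp: A_def B_def)
    ultimately have "A \<inter> B \<inter> sphere 0 1 \<noteq> {}"
      using connected_sphere[OF dim, of 0 1] unfolding connected_def by blast
    then obtain x c c' where x: "c \<in> S" "c' \<in> C" "c' \<notin> S" "dist c x < r" "dist c' x < r"
      by (auto simp: A_def B_def)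
    have "dist c c' < 2 * r" using dist_triangle3[of c c' x] x by (simp add: dist_commute)
    then have "?Q (insert c' S)"
      using S x transportable_insert[of ?adj S c c'] by auto
    then have "card (insert c' S) \<le> card S" by (rule mx)
    moreover have "finite S" using S C(1) finite_subset by auto
    ultimately show False using x by simp
  qed
  then show ?thesis using S by simp
qed

subsection \<open>Jittered sampling measures\<close>

text \<open>Every centre first receives its ball of radius \<open>r / 2\<close>; separation keeps
  these cores (whose union is \<open>H\<close>) disjoint. Any other point goes to the centre of
  least number whose ball of radius \<open>r\<close> contains it. The core is what guarantees a cell
  its minimal mass.\<close>

lemma ex_voronoi_cells:
  fixes C :: "'a::euclidean_space set"
  assumes C: "finite C" and sep: "pairwise (\<lambda>x y. r \<le> dist x y) C" and cov: "sphere 0 1 \<subseteq> (\<Union>c\<in>C. ball c r)"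
  obtains V :: "'a \<Rightarrow> 'a set" where
    "\<And>c. V c \<in> sets sphere_prob"
    "\<And>c. c \<in> C \<Longrightarrow> V c \<subseteq> ball c r"
    "\<And>c. c \<in> C \<Longrightarrow> ball c (r / 2) \<inter> sphere 0 1 \<subseteq> V c"
    "disjoint_family_on V C"
    "(\<Union>c\<in>C. V c) = sphere 0 1"
proof -
  obtain f :: "'a \<Rightarrow> nat" where f: "inj_on f C"
    using finite_imp_inj_to_nat_seg[OF C] by blast
  define H where "H = (\<Union>c\<in>C. ball c (r / 2))"
  define E where "E c = (\<Union>c'\<in>{c' \<in> C. f c' < f c}. ball c' r)" for c
  define V where "V c = sphere 0 1 \<inter> (ball c (r / 2) \<union> (ball c r - H - E c))" for c
  have "open H" "open (E c)" for c by (auto simp: H_def E_def)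
  then have 1: "V c \<in> sets sphere_prob" for c
    by (intro sets_sphere_probI) (auto simp: V_def intro!: sets.Int sets.Un sets.Diff)
  have 2: "V c \<subseteq> ball c r" if "c \<in> C" for c
    by (auto simp: V_def intro: le_less_trans[OF zero_le_dist]) (smt (verit) zero_le_dist field_sum_of_halves)
  have 3: "ball c (r / 2) \<inter> sphere 0 1 \<subseteq> V c" for c
    by (auto simp: V_def)
  have 4: "disjoint_family_on V C"
    unfolding disjoint_family_on_def
  proof (intro ballI impI)
    fix c c' assume c: "c \<in> C" "c' \<in> C" "c \<noteq> c'"
    then have rd: "r \<le> dist c c'" using sep by (auto simp: pairwise_def)
    have hh: "ball c (r / 2) \<inter> ball c' (r / 2) = {}"
    proof -
      have False if "dist c x < r / 2" "dist c' x < r / 2" for x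
        using rd that dist_triangle2[of c c' x] by linarith
      then show ?thesis by auto
    qed
    have hH: "ball c (r / 2) \<subseteq> H" "ball c' (r / 2) \<subseteq> H" using c by (auto simp: H_def)
    have "f c < f c' \<or> f c' < f c" using c inj_onD[OF f] by (metis linorder_neqE_nat)
    then have "ball c r \<subseteq> E c' \<or> ball c' r \<subseteq> E c" using c by (auto simp: E_def)
    then show "V c \<inter> V c' = {}" using hh hH unfolding V_def by blast
  qed
  have "sphere 0 1 \<subseteq> (\<Union>c\<in>C. V c)"
  proof
    fix z :: 'a assume z: "z \<in> sphere 0 1"
    show "z \<in> (\<Union>c\<in>C. V c)"
    proof (cases "z \<in> H")
      case True
      then show ?thesis using z by (auto simp: H_def V_def)
    next
      case False
      define n where "n = (LEAST n. \<exists>c\<in>C. f c = n \<and> z \<in> ball c r)"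
      have ex: "\<exists>n. \<exists>c\<in>C. f c = n \<and> z \<in> ball c r" using cov z by blast
      obtain c where c: "c \<in> C" "f c = n" "z \<in> ball c r"
        using LeastI_ex[OF ex] unfolding n_def by blast
      have "z \<notin> E c"
      proof
        assume "z \<in> E c"
        then obtain c' where "c' \<in> C" "f c' < n" "z \<in> ball c' r" using c by (auto simp: E_def)
        then show False using not_less_Least[of "f c'" "\<lambda>n. \<exists>c\<in>C. f c = n \<and> z \<in> ball c r"] by (auto simp: n_def)
      qed
      then show ?thesis using c z False by (auto simp: V_def)
    qed
  qed
  then have 5: "(\<Union>c\<in>C. V c) = sphere 0 1" by (auto simp: V_def)
  show ?thesis by (rule that[OF 1 2 3 4 5])
qed

lemma ex_multiplicity_enumeration:
  fixes n :: "'a \<Rightarrow> nat"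
  assumes C: "finite C"
  obtains \<kappa> :: "nat \<Rightarrow> 'a" where
    "\<And>i. i < (\<Sum>c\<in>C. n c) \<Longrightarrow> \<kappa> i \<in> C \<and> n (\<kappa> i) > 0"
    "\<And>g :: 'a \<Rightarrow> real. (\<Sum>i<(\<Sum>c\<in>C. n c). g (\<kappa> i)) = (\<Sum>c\<in>C. real (n c) * g c)"
proof -
  let ?S = "SIGMA c:C. {..<n c}"
  have "card {..<(\<Sum>c\<in>C. n c)} = card ?S" using C by (simp add: card_SigmaI)
  then obtain b where b: "bij_betw b {..<(\<Sum>c\<in>C. n c)} ?S"
    using finite_same_card_bij[of "{..<(\<Sum>c\<in>C. n c)}" ?S] C by auto
  have "(fst \<circ> b) i \<in> C \<and> n ((fst \<circ> b) i) > 0" if "i < (\<Sum>c\<in>C. n c)" for i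
    using bspec[OF bij_betwE[OF b], of i] that by (auto simp: mem_Times_iff)
  moreover have "(\<Sum>i<(\<Sum>c\<in>C. n c). g ((fst \<circ> b) i)) = (\<Sum>c\<in>C. real (n c) * g c)" for g :: "'a \<Rightarrow> real"
  proof -
    have "(\<Sum>i<(\<Sum>c\<in>C. n c). g ((fst \<circ> b) i)) = (\<Sum>p\<in>?S. g (fst p))"
      using sum.reindex_bij_betw[OF b, of "\<lambda>p. g (fst p)"] by simp
    also have "\<dots> = (\<Sum>c\<in>C. \<Sum>i<n c. g c)"
      using C by (subst sum.Sigma) (auto simp: case_prod_beta')
    finally show ?thesis by simp
  qed
  ultimately show ?thesis by (rule that)
qed

text \<open>The assumption on \<open>N\<close> says that a cap of radius \<open>r / 2\<close>, hence
  every cell, has measure at least 1/N. The transport makes the masses integral. The measure of a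
  centre \<open>k\<close> mixes the uniform distributions of the cells \<open>V j\<close> with
  weights \<open>T k j / n k\<close> and is used \<open>n k\<close> times. It lives within
  \<open>2 * r + r\<close> of \<open>k\<close>, and the column sums of \<open>T\<close> restore the
  total \<open>N * \<sigma>\<close>.\<close>

lemma ex_jittered_measures:
  assumes dim: "DIM('a::euclidean_space) \<ge> 2" and r: "0 < r" "r \<le> 2"
    and N: "2 * real DIM('a) * (1 + 4 / r) ^ (DIM('a) - 1) \<le> real N"
  obtains \<mu> :: "nat \<Rightarrow> 'a::euclidean_space measure" and c :: "nat \<Rightarrow> 'a" where
    "\<And>i. prob_space (\<mu> i)" "\<And>i. sets (\<mu> i) = sets sphere_prob"
    "\<And>i. i < N \<Longrightarrow> norm (c i) = 1"
    "\<And>i. i < N \<Longrightarrow> measure (\<mu> i) (ball (c i) (3 * r) \<inter> sphere 0 1) = 1"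
    "\<And>A. A \<in> sets sphere_prob \<Longrightarrow> (\<Sum>i<N. measure (\<mu> i) A) = real N * measure sphere_prob A"
proof -
  interpret S: prob_space "sphere_prob :: 'a measure" by (rule prob_space_sphere_prob)
  obtain C :: "'a set" where C: "finite C" "C \<subseteq> sphere 0 1" "C \<noteq> {}" "pairwise (\<lambda>x y. r \<le> dist x y) C"
      "sphere 0 1 \<subseteq> (\<Union>c\<in>C. ball c r)"
    by (rule ex_maximal_separated[OF r])
  obtain V :: "'a \<Rightarrow> 'a set" where V: "\<And>c. V c \<in> sets sphere_prob" "\<And>c. c \<in> C \<Longrightarrow> V c \<subseteq> ball c r"
    "\<And>c. c \<in> C \<Longrightarrow> ball c (r / 2) \<inter> sphere 0 1 \<subseteq> V c" "disjoint_family_on V C" "(\<Union>c\<in>C. V c) = sphere 0 1"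
    by (rule ex_voronoi_cells[OF C(1,4,5)]) (rule that)
  note [measurable] = V(1)
  have Npos: "real N > 0" using r by (intro less_le_trans[OF _ N]) (auto intro!: mult_pos_pos zero_less_power add_pos_pos)
  define a where "a k = real N * S.prob (V k)" for k
  have a1: "1 \<le> a k" if k: "k \<in> C" for k
  proof -
    have "1 \<le> 2 * real DIM('a) * (1 + 2 / (r / 2)) ^ (DIM('a) - 1) * S.prob (ball k (r / 2) \<inter> sphere 0 1)"
      using k C(2) r by (intro measure_cap_ge) auto
    also have "\<dots> \<le> real N * S.prob (V k)"
      using N V(3)[OF k] by (intro mult_mono S.finite_measure_mono V(1)) auto
    finally show ?thesis by (simp add: a_def)
  qed
  have V_sum: "(\<Sum>j\<in>C. S.prob (V j \<inter> A)) = S.prob A" if A: "A \<in> sets sphere_prob" for A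
  proof -
    have "(\<Sum>j\<in>C. S.prob (V j \<inter> A)) = S.prob (\<Union>j\<in>C. V j \<inter> A)"
      using C(1) V(1,4) A by (intro S.finite_measure_finite_Union[symmetric]) (auto simp: disjoint_family_on_def)
    also have "(\<Union>j\<in>C. V j \<inter> A) = A"
      using sets.sets_into_space[OF A] V(5) by auto
    finally show ?thesis .
  qed
  have "(\<Sum>j\<in>C. a j) = real N * (\<Sum>j\<in>C. S.prob (V j \<inter> sphere 0 1))"
  proof -
    have "V j \<inter> sphere 0 1 = V j" for j using sets.sets_into_space[OF V(1)[of j]] by auto
    then show ?thesis by (simp add: a_def sum_distrib_left)
  qed
  also have "\<dots> = real N"
    using V_sum[of "sphere 0 1"] S.prob_space sets.top[of "sphere_prob :: 'a measure"] by simp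
  finally have sa: "(\<Sum>j\<in>C. a j) = real N" .
  have a1': "\<forall>k\<in>C. 1 \<le> a k" using a1 by blast
  from sa have sa': "(\<Sum>j\<in>C. a j) \<in> \<nat>" by simp
  obtain T :: "'a \<Rightarrow> 'a \<Rightarrow> real" and n :: "'a \<Rightarrow> nat" where
    T: "\<forall>k\<in>C. \<forall>j\<in>C. 0 \<le> T k j \<and> (T k j \<noteq> 0 \<longrightarrow> k = j \<or> dist k j < 2 * r)"
    "\<forall>j\<in>C. (\<Sum>k\<in>C. T k j) = a j" "\<forall>k\<in>C. (\<Sum>j\<in>C. T k j) = real (n k)" "\<forall>k\<in>C. a k - 1 \<le> T k k"
    using transportableD[OF transportable_net[OF dim C(1,3,2,5)] a1' sa'] by (elim exE conjE) (rule that)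
  have "real (\<Sum>k\<in>C. n k) = (\<Sum>k\<in>C. \<Sum>j\<in>C. T k j)" using T(3) by simp
  also have "\<dots> = (\<Sum>j\<in>C. \<Sum>k\<in>C. T k j)" by (rule sum.swap)
  also have "\<dots> = real N" using T(2) sa by simp
  finally have nN: "(\<Sum>k\<in>C. n k) = N" by (simp only: of_nat_eq_iff)
  obtain \<kappa> :: "nat \<Rightarrow> 'a" where \<kappa>: "\<And>i. i < N \<Longrightarrow> \<kappa> i \<in> C \<and> n (\<kappa> i) > 0"
    "\<And>g :: 'a \<Rightarrow> real. (\<Sum>i<N. g (\<kappa> i)) = (\<Sum>c\<in>C. real (n c) * g c)"
    using ex_multiplicity_enumeration[OF C(1), of n] unfolding nN by metis
  \<comment> \<open>The constant value on \<open>V j\<close> of the density of the measure belonging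
    to \<open>k\<close>. For \<open>n k = 0\<close> division by zero makes it 0, and such
    \<open>k\<close> are never enumerated.\<close>
  define w where "w k j = T k j / (S.prob (V j) * real (n k))" for k j
  have w: "w k j \<ge> 0" if "k \<in> C" "j \<in> C" for k j using T(1) that by (auto simp: w_def)
  define \<nu> where "\<nu> k = density sphere_prob (\<lambda>z. \<Sum>j\<in>C. ennreal (w k j) * indicator (V j) z)" for k
  have \<nu>_em: "emeasure (\<nu> k) A = ennreal (\<Sum>j\<in>C. w k j * S.prob (V j \<inter> A))"
    if A: "A \<in> sets sphere_prob" and k: "k \<in> C" for k A
  proof -
    have "emeasure (\<nu> k) A = (\<integral>\<^sup>+z. (\<Sum>j\<in>C. ennreal (w k j) * indicator (V j) z) * indicator A z \<partial>sphere_prob)"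
      unfolding \<nu>_def using A by (subst emeasure_density) auto
    also have "\<dots> = (\<integral>\<^sup>+z. (\<Sum>j\<in>C. ennreal (w k j) * indicator (V j \<inter> A) z) \<partial>sphere_prob)"
      by (simp add: sum_distrib_right indicator_inter_arith mult.assoc)
    also have "\<dots> = (\<Sum>j\<in>C. ennreal (w k j) * emeasure sphere_prob (V j \<inter> A))"
      using A by (subst nn_integral_sum) (auto simp: nn_integral_cmult_indicator)
    also have "\<dots> = (\<Sum>j\<in>C. ennreal (w k j * S.prob (V j \<inter> A)))"
      using w[OF k] by (intro sum.cong refl) (simp add: S.emeasure_eq_measure ennreal_mult)
    also have "\<dots> = ennreal (\<Sum>j\<in>C. w k j * S.prob (V j \<inter> A))"
      using w[OF k] by (intro sum_ennreal) auto
    finally show ?thesis .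
  qed
  have \<nu>_sets: "sets (\<nu> k) = sets sphere_prob" for k by (simp add: \<nu>_def)
  have \<nu>_me: "measure (\<nu> k) A = (\<Sum>j\<in>C. w k j * S.prob (V j \<inter> A))"
    if "A \<in> sets sphere_prob" "k \<in> C" for k A
    using \<nu>_em[OF that] w that(2) by (simp add: measure_def sum_nonneg)
  have wV: "w k j * S.prob (V j) = T k j / real (n k)" if "j \<in> C" for k j
    using a1[OF that] by (auto simp: w_def a_def)
  have mass: "(\<Sum>j\<in>C. w k j * S.prob (V j)) = 1" if "k \<in> C" "n k > 0" for k
    using T(3) that by (simp add: wV sum_divide_distrib[symmetric])
  have VS: "V j \<inter> sphere 0 1 = V j" for j using sets.sets_into_space[OF V(1)[of j]] by auto
  have \<nu>_prob: "prob_space (\<nu> k)" if "k \<in> C" "n k > 0" for k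
  proof
    have "space (\<nu> k) = sphere 0 1" by (simp add: \<nu>_def)
    then show "emeasure (\<nu> k) (space (\<nu> k)) = 1"
      using \<nu>_em[of "sphere 0 1" k] that mass[OF that] sets.top[of "sphere_prob :: 'a measure"] by (simp add: VS)
  qed
  have \<nu>_ball: "measure (\<nu> k) (ball k (3 * r) \<inter> sphere 0 1) = 1" if k: "k \<in> C" "n k > 0" for k
  proof -
    have "measure (\<nu> k) (ball k (3 * r) \<inter> sphere 0 1) = (\<Sum>j\<in>C. w k j * S.prob (V j \<inter> (ball k (3 * r) \<inter> sphere 0 1)))"
      using k by (intro \<nu>_me sets_sphere_probI) auto
    also have "\<dots> = (\<Sum>j\<in>C. w k j * S.prob (V j))"
    proof (intro sum.cong refl)
      fix j assume j: "j \<in> C"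
      show "w k j * S.prob (V j \<inter> (ball k (3 * r) \<inter> sphere 0 1)) = w k j * S.prob (V j)"
      proof (cases "T k j = 0")
        case False
        then have "dist k j < 2 * r" using T(1) k j r by fastforce
        then have "dist k x < 3 * r" if "dist j x < r" for x
          using that dist_triangle[of k x j] by linarith
        then have "ball j r \<subseteq> ball k (3 * r)" by auto
        then have "V j \<inter> (ball k (3 * r) \<inter> sphere 0 1) = V j" using V(2)[OF j] VS[of j] by blast
        then show ?thesis by simp
      qed (simp add: w_def)
    qed
    finally show ?thesis using mass[OF k] by simp
  qed
  \<comment> \<open>A default beyond \<open>N\<close>, so that every index carries a probability
    measure.\<close>
  define \<mu> where "\<mu> i = (if i < N then \<nu> (\<kappa> i) else sphere_prob)" for i
  show ?thesis
  proof (rule that[of \<mu> \<kappa>])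
    show "prob_space (\<mu> i)" for i using \<kappa>(1) \<nu>_prob S.prob_space_axioms by (simp add: \<mu>_def)
    show "sets (\<mu> i) = sets sphere_prob" for i by (simp add: \<mu>_def \<nu>_sets)
    show "norm (\<kappa> i) = 1" if "i < N" for i using \<kappa>(1)[OF that] C(2) by auto
    show "measure (\<mu> i) (ball (\<kappa> i) (3 * r) \<inter> sphere 0 1) = 1" if "i < N" for i
      using \<kappa>(1)[OF that] that by (simp add: \<mu>_def \<nu>_ball)
    fix A :: "'a set" assume A: "A \<in> sets sphere_prob"
    have "(\<Sum>i<N. measure (\<mu> i) A) = (\<Sum>i<N. measure (\<nu> (\<kappa> i)) A)" by (simp add: \<mu>_def)
    also have "\<dots> = (\<Sum>k\<in>C. real (n k) * measure (\<nu> k) A)" by (rule \<kappa>(2))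
    also have "\<dots> = (\<Sum>k\<in>C. \<Sum>j\<in>C. T k j / S.prob (V j) * S.prob (V j \<inter> A))"
    proof (intro sum.cong refl)
      fix k assume k: "k \<in> C"
      have "real (n k) * w k j = T k j / S.prob (V j)" if j: "j \<in> C" for j
      proof (cases "n k = 0")
        \<comment> \<open>A row with sum 0 and nonnegative entries vanishes, so dropping this centre
          loses no mass.\<close>
        case True
        then have "(\<Sum>j\<in>C. T k j) = 0" using T(3) k by simp
        then have "T k j = 0" using sum_nonneg_eq_0_iff[of C "T k"] T(1) C(1) j k by auto
        then show ?thesis by (simp add: w_def)
      qed (simp add: w_def)
      then show "real (n k) * measure (\<nu> k) A = (\<Sum>j\<in>C. T k j / S.prob (V j) * S.prob (V j \<inter> A))"
        using A k by (simp add: \<nu>_me sum_distrib_left mult.assoc[symmetric])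
    qed
    also have "\<dots> = (\<Sum>j\<in>C. (\<Sum>k\<in>C. T k j) / S.prob (V j) * S.prob (V j \<inter> A))"
      by (subst sum.swap) (simp add: sum_distrib_right sum_divide_distrib)
    also have "\<dots> = (\<Sum>j\<in>C. real N * S.prob (V j \<inter> A))"
    proof (intro sum.cong refl)
      fix j assume j: "j \<in> C"
      have "S.prob (V j) \<noteq> 0" using a1[OF j] by (auto simp: a_def)
      then show "(\<Sum>k\<in>C. T k j) / S.prob (V j) * S.prob (V j \<inter> A) = real N * S.prob (V j \<inter> A)"
        using T(2) j by (simp add: a_def)
    qed
    also have "\<dots> = real N * S.prob A" using V_sum[OF A] by (simp add: sum_distrib_left[symmetric])
    finally show "(\<Sum>i<N. measure (\<mu> i) A) = real N * measure sphere_prob A" .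
  qed
qed

subsection \<open>Random points\<close>

lemma measure_sphere_prob_singleton:
  fixes z :: "'a::euclidean_space"
  assumes dim: "DIM('a) \<ge> 2"
  shows "measure sphere_prob {z} = 0"
proof (cases "norm z = 1")
  case False
  then have "{z} \<notin> sets sphere_prob" using sets.sets_into_space[of "{z}" "sphere_prob :: 'a measure"] by auto
  then show ?thesis by (simp add: measure_notin_sets)
next
  case True
  interpret prob_space "sphere_prob :: 'a measure" by (rule prob_space_sphere_prob)
  obtain y where y: "y \<noteq> 0" "orthogonal z y" using orthogonal_to_vector_exists[OF dim] by blast
  define w where "w = sgn y"
  have w: "norm w = 1" "w \<bullet> z = 0"
    using y by (simp_all add: w_def norm_sgn orthogonal_def sgn_div_norm inner_commute)
  have "measure sphere_prob {z} \<le> measure sphere_prob {u \<in> sphere 0 1. w \<bullet> u = 0}"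
    using True w by (intro finite_measure_mono sets_sphere_probI) (auto simp: sphere_def)
  then show ?thesis using measure_great_sphere[OF w(1)] measure_nonneg[of sphere_prob "{z}"] by linarith
qed

lemma indep_vars_PiM_components:
  assumes P: "\<And>i. i \<in> I \<Longrightarrow> prob_space (\<mu> i)" and I: "I \<noteq> {}"
  shows "prob_space.indep_vars (PiM I \<mu>) \<mu> (\<lambda>i \<omega>. \<omega> i) I"
proof -
  interpret prob_space "PiM I \<mu>" by (rule prob_space_PiM[OF P])
  have "distr (PiM I \<mu>) (PiM I \<mu>) (\<lambda>x. \<lambda>i\<in>I. x i) = distr (PiM I \<mu>) (PiM I \<mu>) (\<lambda>x. x)"
    by (intro distr_cong) (auto simp: space_PiM)
  also have "\<dots> = PiM I (\<lambda>i. distr (PiM I \<mu>) (\<mu> i) (\<lambda>\<omega>. \<omega> i))"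
    by (simp add: distr_id) (intro PiM_cong refl distr_PiM_component[symmetric] P)
  finally show ?thesis
    by (subst indep_vars_iff_distr_eq_PiM'[OF I]) auto
qed

text \<open>Needed because the sample has to be a set of exactly \<open>N\<close> points. The joint
  law of two components is a product, and by Fubini the diagonal is null as soon as one factor has
  no atoms.\<close>

lemma AE_PiM_components_neq:
  fixes \<mu> :: "nat \<Rightarrow> 'a::euclidean_space measure"
  assumes P: "\<And>i. prob_space (\<mu> i)" and S: "\<And>i. sets (\<mu> i) = sets sphere_prob"
    and ij: "i < N" "j < N" "i \<noteq> j" and null: "\<And>z. measure (\<mu> j) {z} = 0"
  shows "AE \<omega> in PiM {..<N} \<mu>. \<omega> i \<noteq> \<omega> j"
proof -
  let ?\<Omega> = "PiM {..<N} \<mu>"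
  interpret PP: product_prob_space \<mu> "{..<N}" by (rule product_prob_spaceI) (rule P)
  interpret i: prob_space "\<mu> i" by (rule P)
  interpret j: prob_space "\<mu> j" by (rule P)
  interpret ij: pair_prob_space "\<mu> i" "\<mu> j" ..
  have sp: "space (\<mu> k) = sphere 0 1" for k using sets_eq_imp_space_eq[OF S[of k]] by simp
  have pm: "(\<lambda>\<omega>. (\<omega> i, \<omega> j)) \<in> ?\<Omega> \<rightarrow>\<^sub>M \<mu> i \<Otimes>\<^sub>M \<mu> j"
    using ij by (intro measurable_Pair measurable_component_singleton) auto
  have eq: "\<mu> i \<Otimes>\<^sub>M \<mu> j = distr ?\<Omega> (\<mu> i \<Otimes>\<^sub>M \<mu> j) (\<lambda>\<omega>. (\<omega> i, \<omega> j))"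
  proof (rule pair_measure_eqI)
    fix A B assume A: "A \<in> sets (\<mu> i)" and B: "B \<in> sets (\<mu> j)"
    define X where "X k = (if k = i then A else B)" for k
    have "(\<lambda>\<omega>. (\<omega> i, \<omega> j)) -` (A \<times> B) \<inter> space ?\<Omega> = {\<omega> \<in> space ?\<Omega>. \<forall>k\<in>{i, j}. \<omega> k \<in> X k}"
      using ij by (auto simp: X_def)
    then have "emeasure (distr ?\<Omega> (\<mu> i \<Otimes>\<^sub>M \<mu> j) (\<lambda>\<omega>. (\<omega> i, \<omega> j))) (A \<times> B) = emeasure ?\<Omega> {\<omega> \<in> space ?\<Omega>. \<forall>k\<in>{i, j}. \<omega> k \<in> X k}"
      using A B pm by (subst emeasure_distr) auto
    also have "\<dots> = (\<Prod>k\<in>{i, j}. emeasure (\<mu> k) (X k))"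
      using ij A B by (intro PP.emeasure_PiM_Collect) (auto simp: X_def)
    also have "\<dots> = emeasure (\<mu> i) A * emeasure (\<mu> j) B"
      using ij by (simp add: X_def)
    finally show "emeasure (\<mu> i) A * emeasure (\<mu> j) B = emeasure (distr ?\<Omega> (\<mu> i \<Otimes>\<^sub>M \<mu> j) (\<lambda>\<omega>. (\<omega> i, \<omega> j))) (A \<times> B)" ..
  qed (simp_all add: prob_space_imp_sigma_finite[OF P])
  have bor: "(\<lambda>x. x) \<in> \<mu> k \<rightarrow>\<^sub>M borel" for k
    unfolding measurable_cong_sets[OF S refl] by (rule borel_measurable_sphere_prob) simp
  have fst: "fst \<in> \<mu> i \<Otimes>\<^sub>M \<mu> j \<rightarrow>\<^sub>M borel" by (rule measurable_compose[OF measurable_fst bor])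
  have snd: "snd \<in> \<mu> i \<Otimes>\<^sub>M \<mu> j \<rightarrow>\<^sub>M borel" by (rule measurable_compose[OF measurable_snd bor])
  have "(\<lambda>p. norm (fst p - snd p)) \<in> borel_measurable (\<mu> i \<Otimes>\<^sub>M \<mu> j)"
    using fst snd by measurable
  then have "{p \<in> space (\<mu> i \<Otimes>\<^sub>M \<mu> j). norm (fst p - snd p) \<noteq> 0} \<in> sets (\<mu> i \<Otimes>\<^sub>M \<mu> j)"
    by measurable
  then have m: "{p \<in> space (\<mu> i \<Otimes>\<^sub>M \<mu> j). fst p \<noteq> snd p} \<in> sets (\<mu> i \<Otimes>\<^sub>M \<mu> j)" by simp
  have "AE p in \<mu> i \<Otimes>\<^sub>M \<mu> j. fst p \<noteq> snd p"
  proof (rule ij.AE_pair_measure[OF m])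
    show "AE x in \<mu> i. AE y in \<mu> j. fst (x, y) \<noteq> snd (x, y)"
    proof (rule AE_I2)
      fix x assume x: "x \<in> space (\<mu> i)"
      then have "{x} \<in> sets (\<mu> j)" unfolding S by (intro sets_sphere_probI) (auto simp: sp)
      then have "{x} \<in> null_sets (\<mu> j)" using null[of x] by (simp add: null_sets_def finite_measure.emeasure_eq_measure[OF prob_space.finite_measure[OF P]])
      then show "AE y in \<mu> j. fst (x, y) \<noteq> snd (x, y)"
        by (elim eventually_mono[OF AE_not_in]) auto
    qed
  qed
  then have "AE p in distr ?\<Omega> (\<mu> i \<Otimes>\<^sub>M \<mu> j) (\<lambda>\<omega>. (\<omega> i, \<omega> j)). fst p \<noteq> snd p"
    unfolding eq[symmetric] .
  then show ?thesis using m by (subst (asm) AE_distr_iff[OF pm]) auto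
qed

text \<open>A draw whose measure gives \<open>A\<close> probability 0 or 1 contributes no deviation
  almost surely. Hoeffding's inequality therefore runs only over the at most \<open>M\<close>
  remaining draws, and the union bound leaves a positive probability that no set of \<open>F\<close>
  deviates by \<open>t\<close> or more.\<close>

lemma ex_points_of_measures:
  fixes \<mu> :: "nat \<Rightarrow> 'a::euclidean_space measure" and F :: "'a set set"
  assumes dim: "DIM('a) \<ge> 2" and N: "N \<ge> 1"
    and P: "\<And>i. prob_space (\<mu> i)" and S: "\<And>i. sets (\<mu> i) = sets sphere_prob"
    and tot: "\<And>A. A \<in> sets sphere_prob \<Longrightarrow> (\<Sum>i<N. measure (\<mu> i) A) = real N * measure sphere_prob A"
    and F: "finite F" "F \<subseteq> sets sphere_prob"
    and cut: "\<And>A. A \<in> F \<Longrightarrow> real (card {i \<in> {..<N}. measure (\<mu> i) A \<notin> {0, 1}}) \<le> M"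
    and t: "t > 0" and small: "real (card F) * (2 * exp (- 2 * t\<^sup>2 / M)) < 1"
  obtains Z where "Z \<subseteq> sphere 0 1" "finite Z" "card Z = N"
    "\<And>A. A \<in> F \<Longrightarrow> \<bar>real (card (Z \<inter> A)) - real N * measure sphere_prob A\<bar> \<le> t"
proof -
  let ?\<Omega> = "PiM {..<N} \<mu>"
  interpret \<Omega>: prob_space ?\<Omega> by (rule prob_space_PiM[OF P])
  interpret PP: product_prob_space \<mu> "{..<N}" by (rule product_prob_spaceI) (rule P)
  have sp: "space (\<mu> k) = sphere 0 1" for k using sets_eq_imp_space_eq[OF S[of k]] by simp
  define I where "I A = {i \<in> {..<N}. measure (\<mu> i) A \<notin> {0, 1}}" for A
  define X where "X A i \<omega> = (indicator A (\<omega> i) :: real)" for A :: "'a set" and i :: nat and \<omega> :: "nat \<Rightarrow> 'a"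
  define B where "B A = {\<omega> \<in> space ?\<Omega>. \<bar>(\<Sum>i\<in>I A. X A i \<omega>) - (\<Sum>i\<in>I A. measure (\<mu> i) A)\<bar> \<ge> t}" for A
  have I: "finite (I A)" "I A \<subseteq> {..<N}" for A by (auto simp: I_def)
  have Xm: "X A i \<in> borel_measurable ?\<Omega>" if "A \<in> F" "i < N" for A i
  proof -
    have "A \<in> sets (\<mu> i)" using that F S by auto
    then show ?thesis unfolding X_def using that
      by (intro measurable_compose[OF measurable_component_singleton borel_measurable_indicator]) auto
  qed
  have Bm: "B A \<in> sets ?\<Omega>" if "A \<in> F" for A
  proof -
    have [measurable]: "X A i \<in> borel_measurable ?\<Omega>" if "i \<in> I A" for i
      using Xm[OF \<open>A \<in> F\<close>] that I(2) by auto
    show ?thesis unfolding B_def by measurable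
  qed
  have B_le: "\<Omega>.prob (B A) \<le> 2 * exp (- 2 * t\<^sup>2 / M)" if A: "A \<in> F" for A
  proof (cases "I A = {}")
    \<comment> \<open>With no random draw the deviation is 0, which is below \<open>t\<close>;
      Hoeffding's exponent would divide by zero.\<close>
    case True
    then have "B A = {}" using t by (simp add: B_def)
    then show ?thesis by simp
  next
    case False
    have As: "A \<in> sets (\<mu> i)" for i using A F S by auto
    have ind: "\<Omega>.indep_vars (\<lambda>_. borel) (X A) (I A)"
      unfolding X_def
    proof (rule \<Omega>.indep_vars_compose2[where Y = "\<lambda>i. indicator A"])
      have "{..<N} \<noteq> {}" using N by (simp add: lessThan_empty_iff bot_nat_def)
      from indep_vars_PiM_components[OF P this] show "\<Omega>.indep_vars \<mu> (\<lambda>i \<omega>. \<omega> i) (I A)"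
        using I(2) by (rule \<Omega>.indep_vars_subset)
      show "indicator A \<in> borel_measurable (\<mu> i)" for i using As by simp
    qed
    have E: "\<Omega>.expectation (X A i) = measure (\<mu> i) A" if "i \<in> I A" for i
    proof -
      have i: "i \<in> {..<N}" using that I(2) by auto
      have "\<Omega>.expectation (X A i) = (\<integral>z. indicator A z \<partial>distr ?\<Omega> (\<mu> i) (\<lambda>\<omega>. \<omega> i))"
        unfolding X_def using i As by (intro integral_distr[symmetric] measurable_component_singleton) auto
      also have "distr ?\<Omega> (\<mu> i) (\<lambda>\<omega>. \<omega> i) = \<mu> i" using i by (rule PP.PiM_component)
      also have "(\<integral>z. indicator A z \<partial>\<mu> i) = measure (\<mu> i) A"
        using sets.sets_into_space[OF As[of i]] by (simp add: Int_absorb2)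
      finally show ?thesis .
    qed
    interpret H: Hoeffding_ineq ?\<Omega> "I A" "X A" "\<lambda>_. 0" "\<lambda>_. 1" "\<Sum>i\<in>I A. \<Omega>.expectation (X A i)"
      by unfold_locales (use I ind in \<open>auto simp: X_def indicator_def\<close>)
    have c: "real (card (I A)) > 0" using False I by (simp add: card_gt_0_iff)
    have "B A = {\<omega> \<in> space ?\<Omega>. \<bar>(\<Sum>i\<in>I A. X A i \<omega>) - (\<Sum>i\<in>I A. \<Omega>.expectation (X A i))\<bar> \<ge> t}"
      unfolding B_def by (simp add: E)
    then have "\<Omega>.prob (B A) \<le> 2 * exp (- 2 * t\<^sup>2 / (\<Sum>i\<in>I A. (1 - 0)\<^sup>2))"
      using H.Hoeffding_ineq_abs_ge[of t] t c by simp
    also have "\<dots> = 2 * exp (- (2 * t\<^sup>2 / real (card (I A))))" by simp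
    also have "\<dots> \<le> 2 * exp (- (2 * t\<^sup>2 / M))"
      using c cut[OF A] by (simp add: I_def) (intro divide_left_mono mult_pos_pos, auto)
    finally show ?thesis by simp
  qed
  define bad where "bad = (\<Union>A\<in>F. B A)"
  have bad_m: "bad \<in> sets ?\<Omega>" unfolding bad_def using F Bm by (intro sets.finite_UN) auto
  have "\<Omega>.prob bad \<le> (\<Sum>A\<in>F. \<Omega>.prob (B A))"
    unfolding bad_def using F Bm by (intro \<Omega>.finite_measure_subadditive_finite) auto
  also have "\<dots> \<le> (\<Sum>A\<in>F. 2 * exp (- 2 * t\<^sup>2 / M))" by (intro sum_mono B_le)
  also have "\<dots> < 1" using small by simp
  finally have bad1: "\<Omega>.prob bad < 1" .
  have null: "measure (\<mu> j) {z} = 0" if j: "j < N" for j z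
  proof (cases "{z} \<in> sets sphere_prob")
    case True
    \<comment> \<open>No single measure can have an atom, because their sum
      \<open>N * \<sigma>\<close> has none.\<close>
    have "measure (\<mu> j) {z} \<le> (\<Sum>i<N. measure (\<mu> i) {z})" using j by (intro member_le_sum) auto
    also have "\<dots> = 0" using tot[OF True] measure_sphere_prob_singleton[OF dim, of z] by simp
    finally show ?thesis using measure_nonneg[of "\<mu> j" "{z}"] by linarith
  qed (simp add: measure_notin_sets S)
  have "AE \<omega> in ?\<Omega>. \<forall>p\<in>{..<N} \<times> {..<N}. fst p \<noteq> snd p \<longrightarrow> \<omega> (fst p) \<noteq> \<omega> (snd p)"
  proof (rule AE_finite_allI)
    fix p assume p: "p \<in> {..<N} \<times> {..<N}"
    show "AE \<omega> in ?\<Omega>. fst p \<noteq> snd p \<longrightarrow> \<omega> (fst p) \<noteq> \<omega> (snd p)"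
    proof (cases "fst p = snd p")
      case False
      have "AE \<omega> in ?\<Omega>. \<omega> (fst p) \<noteq> \<omega> (snd p)"
        using p False null by (intro AE_PiM_components_neq P S) auto
      then show ?thesis by auto
    qed simp
  qed simp
  moreover have "AE \<omega> in ?\<Omega>. \<forall>q\<in>F \<times> {..<N}. snd q \<notin> I (fst q) \<longrightarrow> X (fst q) (snd q) \<omega> = measure (\<mu> (snd q)) (fst q)"
  proof (rule AE_finite_allI)
    fix q assume q: "q \<in> F \<times> {..<N}"
    obtain A i where Ai: "q = (A, i)" "A \<in> F" "i < N" using q by auto
    have As: "A \<in> sets (\<mu> i)" using Ai F S by auto
    show "AE \<omega> in ?\<Omega>. snd q \<notin> I (fst q) \<longrightarrow> X (fst q) (snd q) \<omega> = measure (\<mu> (snd q)) (fst q)"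
    proof (cases "i \<in> I A")
      case False
      then consider "measure (\<mu> i) A = 0" | "measure (\<mu> i) A = 1" using Ai by (auto simp: I_def)
      then have "AE z in \<mu> i. indicator A z = measure (\<mu> i) A"
      proof cases
        case 1
        then have "A \<in> null_sets (\<mu> i)" using As by (simp add: null_sets_def finite_measure.emeasure_eq_measure[OF prob_space.finite_measure[OF P]])
        then have "AE z in \<mu> i. z \<notin> A" by (rule AE_not_in)
        then show ?thesis by eventually_elim (simp add: 1)
      next
        case 2
        then have "AE z in \<mu> i. z \<in> A" using As by (subst prob_space.AE_in_set_eq_1[OF P]) auto
        then show ?thesis by eventually_elim (simp add: 2)
      qed
      then have "AE \<omega> in ?\<Omega>. indicator A (\<omega> i) = measure (\<mu> i) A"
        using Ai P by (intro AE_PiM_component) auto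
      then show ?thesis by eventually_elim (simp add: Ai X_def)
    qed (simp add: Ai)
  qed (use F in simp)
  \<comment> \<open>The complement of \<open>bad\<close> has positive probability, so the two almost
    sure properties hold simultaneously at one of its points.\<close>
  moreover have "\<not> (AE \<omega> in ?\<Omega>. \<omega> \<in> bad)"
    using bad1 bad_m by (subst \<Omega>.AE_in_set_eq_1) auto
  ultimately have "\<exists>\<omega>\<in>space ?\<Omega>. \<omega> \<notin> bad \<and>
      (\<forall>p\<in>{..<N} \<times> {..<N}. fst p \<noteq> snd p \<longrightarrow> \<omega> (fst p) \<noteq> \<omega> (snd p)) \<and>
      (\<forall>q\<in>F \<times> {..<N}. snd q \<notin> I (fst q) \<longrightarrow> X (fst q) (snd q) \<omega> = measure (\<mu> (snd q)) (fst q))" (is "\<exists>\<omega>\<in>_. ?Q \<omega>")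
  proof -
    assume 1: "AE \<omega> in ?\<Omega>. \<forall>p\<in>{..<N} \<times> {..<N}. fst p \<noteq> snd p \<longrightarrow> \<omega> (fst p) \<noteq> \<omega> (snd p)"
    assume 2: "AE \<omega> in ?\<Omega>. \<forall>q\<in>F \<times> {..<N}. snd q \<notin> I (fst q) \<longrightarrow> X (fst q) (snd q) \<omega> = measure (\<mu> (snd q)) (fst q)"
    assume 3: "\<not> (AE \<omega> in ?\<Omega>. \<omega> \<in> bad)"
    show ?thesis
    proof (rule ccontr)
      assume neg: "\<not> ?thesis"
      have "AE \<omega> in ?\<Omega>. \<omega> \<in> bad"
        using 1 2 AE_space by eventually_elim (use neg in blast)
      then show False using 3 by blast
    qed
  qed
  then obtain \<omega> where \<omega>: "\<omega> \<in> space ?\<Omega>" "\<omega> \<notin> bad"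
    "\<And>i j. i < N \<Longrightarrow> j < N \<Longrightarrow> i \<noteq> j \<Longrightarrow> \<omega> i \<noteq> \<omega> j"
    "\<And>A i. A \<in> F \<Longrightarrow> i < N \<Longrightarrow> i \<notin> I A \<Longrightarrow> X A i \<omega> = measure (\<mu> i) A"
    by fastforce
  have inj: "inj_on \<omega> {..<N}" using \<omega>(3) by (auto simp: inj_on_def)
  define Z where "Z = \<omega> ` {..<N}"
  show ?thesis
  proof (rule that[of Z])
    show "Z \<subseteq> sphere 0 1" using \<omega>(1) by (auto simp: Z_def space_PiM PiE_iff sp)
    show "finite Z" by (simp add: Z_def)
    show "card Z = N" by (simp add: Z_def card_image[OF inj])
    fix A assume A: "A \<in> F"
    have "\<omega> \<notin> B A" using \<omega>(2) A by (auto simp: bad_def)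
    then have dev: "\<bar>(\<Sum>i\<in>I A. X A i \<omega>) - (\<Sum>i\<in>I A. measure (\<mu> i) A)\<bar> < t"
      using \<omega>(1) by (auto simp: B_def)
    have "real (card (Z \<inter> A)) = (\<Sum>z\<in>Z. indicator A z)"
      by (simp add: Z_def indicator_def sum.If_cases Int_def)
    also have "\<dots> = (\<Sum>i<N. X A i \<omega>)" unfolding Z_def X_def by (simp add: sum.reindex[OF inj])
    finally have cardZ: "real (card (Z \<inter> A)) = (\<Sum>i<N. X A i \<omega>)" .
    have "(\<Sum>i<N. X A i \<omega>) - (\<Sum>i<N. measure (\<mu> i) A) = (\<Sum>i<N. X A i \<omega> - measure (\<mu> i) A)"
      by (simp add: sum_subtractf)
    also have "\<dots> = (\<Sum>i\<in>I A. X A i \<omega> - measure (\<mu> i) A)"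
      using I[of A] \<omega>(4)[OF A] by (intro sum.mono_neutral_right) auto
    also have "\<dots> = (\<Sum>i\<in>I A. X A i \<omega>) - (\<Sum>i\<in>I A. measure (\<mu> i) A)" by (simp add: sum_subtractf)
    finally show "\<bar>real (card (Z \<inter> A)) - real N * measure sphere_prob A\<bar> \<le> t"
      using dev tot[of A] A F(2) by (auto simp: cardZ)
  qed
qed

subsection \<open>Bracketing of wedges\<close>

text \<open>
  \<open>wedge_inner \<delta> x y\<close> and \<open>wedge_outer \<delta> x y\<close> bracket every wedge whose two poles are within \<open>\<delta>\<close> of
  \<open>x\<close> and \<open>y\<close>.
\<close>

definition wedge_inner :: "real \<Rightarrow> 'a::euclidean_space \<Rightarrow> 'a \<Rightarrow> 'a set" where
  "wedge_inner \<delta> x y = {z \<in> sphere 0 1. (\<delta> \<le> x \<bullet> z \<and> y \<bullet> z < - \<delta>) \<or> (x \<bullet> z < - \<delta> \<and> \<delta> \<le> y \<bullet> z)}"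

definition wedge_outer :: "real \<Rightarrow> 'a::euclidean_space \<Rightarrow> 'a \<Rightarrow> 'a set" where
  "wedge_outer \<delta> x y = {z \<in> sphere 0 1. \<not> (\<delta> \<le> x \<bullet> z \<and> \<delta> \<le> y \<bullet> z) \<and> \<not> (x \<bullet> z < - \<delta> \<and> y \<bullet> z < - \<delta>)}"

lemma wedge_bracket_in_sets [measurable]:
  "wedge_inner \<delta> x y \<in> sets sphere_prob" "wedge_outer \<delta> x y \<in> sets sphere_prob"
proof -
  have "{z. norm z = 1 \<and> ((\<delta> \<le> x \<bullet> z \<and> y \<bullet> z < - \<delta>) \<or> (x \<bullet> z < - \<delta> \<and> \<delta> \<le> y \<bullet> z))} \<in> sets borel"
    "{z. norm z = 1 \<and> \<not> (\<delta> \<le> x \<bullet> z \<and> \<delta> \<le> y \<bullet> z) \<and> \<not> (x \<bullet> z < - \<delta> \<and> y \<bullet> z < - \<delta>)} \<in> sets borel"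
    by measurable
  then show "wedge_inner \<delta> x y \<in> sets sphere_prob" "wedge_outer \<delta> x y \<in> sets sphere_prob"
    by (auto simp: wedge_inner_def wedge_outer_def intro!: sets_sphere_probI)
qed

lemma band_in_sets [measurable]: "{z \<in> sphere 0 1. \<bar>x \<bullet> z\<bar> \<le> e} \<in> sets sphere_prob"
proof -
  have "{z. norm z = 1 \<and> \<bar>x \<bullet> z\<bar> \<le> e} \<in> sets borel" by measurable
  then show ?thesis by (auto intro!: sets_sphere_probI)
qed

lemma abs_inner_diff_le:
  fixes x x' z :: "'a::real_inner"
  assumes "norm z = 1" "dist x x' \<le> e"
  shows "\<bar>x \<bullet> z - x' \<bullet> z\<bar> \<le> e"
  using Cauchy_Schwarz_ineq2[of "x - x'" z] assms by (simp add: inner_diff_left dist_norm)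

lemma wedge_bracket:
  fixes x y x' y' :: "'a::euclidean_space"
  assumes "dist x x' < \<delta>" "dist y y' < \<delta>"
  shows "wedge_inner \<delta> x y \<subseteq> wedge x' y'" "wedge x' y' \<subseteq> wedge_outer \<delta> x y"
proof -
  have *: "\<bar>x \<bullet> z - x' \<bullet> z\<bar> < \<delta>" "\<bar>y \<bullet> z - y' \<bullet> z\<bar> < \<delta>" if "norm z = 1" for z
    using abs_inner_diff_le[OF that, of x x' "dist x x'"] abs_inner_diff_le[OF that, of y y' "dist y y'"] assms by auto
  show "wedge_inner \<delta> x y \<subseteq> wedge x' y'"
  proof
    fix z assume z: "z \<in> wedge_inner \<delta> x y"
    then have "norm z = 1" by (simp add: wedge_inner_def)
    with *[OF this] z show "z \<in> wedge x' y'" by (auto simp: wedge_inner_def wedge_def sign_nonneg_def)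
  qed
  show "wedge x' y' \<subseteq> wedge_outer \<delta> x y"
  proof
    fix z assume z: "z \<in> wedge x' y'"
    then have "norm z = 1" by (simp add: wedge_def)
    with *[OF this] z show "z \<in> wedge_outer \<delta> x y"
      by (auto simp: wedge_outer_def wedge_def sign_nonneg_def split: if_splits)
  qed
qed

text \<open>Off the two bands of half-width \<open>\<delta>\<close> all signs are decided by that
  margin, so the two brackets coincide there.\<close>

lemma measure_wedge_outer_le:
  fixes x y :: "'a::euclidean_space"
  assumes x: "norm x = 1" and y: "norm y = 1" and \<delta>: "\<delta> \<ge> 0"
  shows "measure sphere_prob (wedge_outer \<delta> x y) \<le> measure sphere_prob (wedge_inner \<delta> x y) + 4 * \<delta> * sqrt ((real DIM('a) + 1) / (2 * pi))"
proof -
  interpret prob_space "sphere_prob :: 'a measure" by (rule prob_space_sphere_prob)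
  let ?b = "\<lambda>x. {z \<in> sphere 0 1. \<bar>x \<bullet> z\<bar> \<le> \<delta>} :: 'a set"
  have "wedge_outer \<delta> x y \<subseteq> wedge_inner \<delta> x y \<union> (?b x \<union> ?b y)"
    by (auto simp: wedge_outer_def wedge_inner_def)
  then have "prob (wedge_outer \<delta> x y) \<le> prob (wedge_inner \<delta> x y \<union> (?b x \<union> ?b y))"
    by (intro finite_measure_mono) measurable
  also have "\<dots> \<le> prob (wedge_inner \<delta> x y) + prob (?b x \<union> ?b y)"
    by (intro measure_Un_le) measurable
  also have "prob (?b x \<union> ?b y) \<le> prob (?b x) + prob (?b y)"
    by (intro measure_Un_le) measurable
  finally show ?thesis
    using measure_band_le[OF x \<delta>] measure_band_le[OF y \<delta>] by linarith
qed

text \<open>A cap whose centre is farther than \<open>\<rho> + \<delta>\<close> from both great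
  spheres, measured by inner products, lies on one fixed side of the thresholds
  \<open>\<delta>\<close> and \<open>- \<delta>\<close> for either pole. It is then contained in
  \<open>A\<close> or disjoint from it.\<close>

lemma wedge_bracket_cut:
  fixes x y c :: "'a::euclidean_space"
  assumes P: "prob_space \<mu>" and S: "sets \<mu> = sets sphere_prob"
    and c: "measure \<mu> (ball c \<rho> \<inter> sphere 0 1) = 1"
    and A: "A = wedge_inner \<delta> x y \<or> A = wedge_outer \<delta> x y" and x: "norm x = 1" and y: "norm y = 1" and \<delta>: "\<delta> > 0"
    and cut: "measure \<mu> A \<notin> {0, 1}"
  shows "\<bar>x \<bullet> c\<bar> \<le> \<rho> + \<delta> \<or> \<bar>y \<bullet> c\<bar> \<le> \<rho> + \<delta>"
proof (rule ccontr)
  assume "\<not> ?thesis"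
  then have far: "\<bar>x \<bullet> c\<bar> > \<rho> + \<delta>" "\<bar>y \<bullet> c\<bar> > \<rho> + \<delta>" by auto
  interpret prob_space \<mu> by (rule P)
  let ?b = "ball c \<rho> \<inter> sphere 0 1"
  have sp: "space \<mu> = sphere 0 1" using sets_eq_imp_space_eq[OF S] by simp
  have b: "?b \<in> sets \<mu>" unfolding S by (intro sets_sphere_probI) auto
  have As: "A \<in> sets \<mu>" unfolding S using A wedge_bracket_in_sets by auto
  have near: "\<bar>x \<bullet> z - x \<bullet> c\<bar> < \<rho>" "\<bar>y \<bullet> z - y \<bullet> c\<bar> < \<rho>" if "z \<in> ?b" for z
    using abs_inner_diff_le[OF x, of z c "dist z c"] abs_inner_diff_le[OF y, of z c "dist z c"] that
    by (auto simp: inner_commute dist_commute)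
  have "?b \<subseteq> A \<or> ?b \<inter> A = {}"
  proof (rule ccontr)
    assume "\<not> ?thesis"
    then obtain z w where zw: "z \<in> ?b" "z \<notin> A" "w \<in> ?b" "w \<in> A" by blast
    have "x \<bullet> z > \<delta> \<and> x \<bullet> w > \<delta> \<or> x \<bullet> z < - \<delta> \<and> x \<bullet> w < - \<delta>"
      using near(1)[OF zw(1)] near(1)[OF zw(3)] far(1) \<delta> by linarith
    moreover have "y \<bullet> z > \<delta> \<and> y \<bullet> w > \<delta> \<or> y \<bullet> z < - \<delta> \<and> y \<bullet> w < - \<delta>"
      using near(2)[OF zw(1)] near(2)[OF zw(3)] far(2) \<delta> by linarith
    ultimately show False using A zw \<delta> by (auto simp: wedge_inner_def wedge_outer_def)
  qed
  then show False
  proof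
    assume "?b \<subseteq> A"
    then have "1 \<le> prob A" using finite_measure_mono[OF _ As, of ?b] c by simp
    then have "prob A = 1" using prob_le_1[of A] by linarith
    then show False using cut by simp
  next
    assume "?b \<inter> A = {}"
    then have "prob (?b \<union> A) = 1 + prob A" using finite_measure_Union[OF b As] c by simp
    then have "prob A = 0" using prob_le_1[of "?b \<union> A"] measure_nonneg[of \<mu> A] by linarith
    then show False using cut by simp
  qed
qed

text \<open>A cap that is cut has its centre in a band of half-width
  \<open>\<rho> + \<delta>\<close>, so the whole cap lies in the band of half-width
  \<open>2 * \<rho> + \<delta>\<close>. Each such measure gives this wider band mass 1, and the
  masses add up to \<open>N\<close> times its measure; this replaces a packing argument.\<close>

lemma wedge_bracket_cut_count:
  fixes \<mu> :: "nat \<Rightarrow> 'a::euclidean_space measure"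
  assumes P: "\<And>i. prob_space (\<mu> i)" and S: "\<And>i. sets (\<mu> i) = sets sphere_prob"
    and c: "\<And>i. i < N \<Longrightarrow> norm (c i) = 1" "\<And>i. i < N \<Longrightarrow> measure (\<mu> i) (ball (c i) \<rho> \<inter> sphere 0 1) = 1"
    and tot: "\<And>A. A \<in> sets sphere_prob \<Longrightarrow> (\<Sum>i<N. measure (\<mu> i) A) = real N * measure sphere_prob A"
    and A: "A = wedge_inner \<delta> x y \<or> A = wedge_outer \<delta> x y" and x: "norm x = 1" and y: "norm y = 1"
    and \<delta>: "\<delta> > 0" and \<rho>: "\<rho> \<ge> 0"
  shows "real (card {i \<in> {..<N}. measure (\<mu> i) A \<notin> {0, 1}})
    \<le> real N * (4 * (2 * \<rho> + \<delta>) * sqrt ((real DIM('a) + 1) / (2 * pi)))"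
proof -
  let ?near = "\<lambda>x. {i \<in> {..<N}. \<bar>x \<bullet> c i\<bar> \<le> \<rho> + \<delta>}"
  have near: "real (card (?near x)) \<le> real N * (2 * (2 * \<rho> + \<delta>) * sqrt ((real DIM('a) + 1) / (2 * pi)))"
    if x: "norm x = 1" for x
  proof -
    define B where "B = {z \<in> sphere 0 1. \<bar>x \<bullet> z\<bar> \<le> 2 * \<rho> + \<delta>}"
    have B: "B \<in> sets sphere_prob" unfolding B_def by measurable
    have one: "1 \<le> measure (\<mu> i) B" if i: "i \<in> ?near x" for i
    proof -
      interpret prob_space "\<mu> i" by (rule P)
      have "ball (c i) \<rho> \<inter> sphere 0 1 \<subseteq> B"
      proof
        fix z assume z: "z \<in> ball (c i) \<rho> \<inter> sphere 0 1"
        have "\<bar>z \<bullet> x - c i \<bullet> x\<bar> \<le> \<rho>"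
          using z by (intro abs_inner_diff_le[OF x]) (auto simp: dist_commute)
        then show "z \<in> B" using z i by (auto simp: B_def inner_commute)
      qed
      then show ?thesis using finite_measure_mono[of "ball (c i) \<rho> \<inter> sphere 0 1" B] c(2)[of i] i B by (simp add: S)
    qed
    have "real (card (?near x)) = (\<Sum>i\<in>?near x. 1)" by simp
    also have "\<dots> \<le> (\<Sum>i\<in>?near x. measure (\<mu> i) B)" using one by (intro sum_mono) auto
    also have "\<dots> \<le> (\<Sum>i<N. measure (\<mu> i) B)" by (intro sum_mono2) auto
    also have "\<dots> = real N * measure sphere_prob B" by (rule tot[OF B])
    also have "\<dots> \<le> real N * (2 * (2 * \<rho> + \<delta>) * sqrt ((real DIM('a) + 1) / (2 * pi)))"
      unfolding B_def using x \<delta> \<rho> by (intro mult_left_mono measure_band_le) auto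
    finally show ?thesis .
  qed
  have "{i \<in> {..<N}. measure (\<mu> i) A \<notin> {0, 1}} \<subseteq> ?near x \<union> ?near y"
    using wedge_bracket_cut[OF P S c(2) A x y \<delta>] by auto
  then have "card {i \<in> {..<N}. measure (\<mu> i) A \<notin> {0, 1}} \<le> card (?near x \<union> ?near y)"
    by (intro card_mono) auto
  also have "\<dots> \<le> card (?near x) + card (?near y)" by (rule card_Un_le)
  finally have "real (card {i \<in> {..<N}. measure (\<mu> i) A \<notin> {0, 1}}) \<le> real (card (?near x)) + real (card (?near y))"
    by linarith
  also have "\<dots> \<le> real N * (2 * (2 * \<rho> + \<delta>) * sqrt ((real DIM('a) + 1) / (2 * pi)))
      + real N * (2 * (2 * \<rho> + \<delta>) * sqrt ((real DIM('a) + 1) / (2 * pi)))"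
    using near[OF x] near[OF y] by (rule add_mono)
  finally show ?thesis by (simp add: algebra_simps)
qed

text \<open>A net of size at most b has at most b^2 pairs of poles and thus 2 b^2 brackets; the
  two-sided tail doubles this to the factor 4 in \<open>small\<close>. The second term of the bound
  is the measure gap between the brackets.\<close>

lemma ex_points_wedge_discrepancy:
  fixes \<mu> :: "nat \<Rightarrow> 'a::euclidean_space measure"
  assumes dim: "DIM('a) \<ge> 2" and N: "N \<ge> 1"
    and P: "\<And>i. prob_space (\<mu> i)" and S: "\<And>i. sets (\<mu> i) = sets sphere_prob"
    and tot: "\<And>A. A \<in> sets sphere_prob \<Longrightarrow> (\<Sum>i<N. measure (\<mu> i) A) = real N * measure sphere_prob A"
    and \<delta>: "0 < \<delta>" "\<delta> \<le> 2" and t: "t > 0"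
    and cut: "\<And>A x y. norm x = 1 \<Longrightarrow> norm y = 1 \<Longrightarrow> A = wedge_inner \<delta> x y \<or> A = wedge_outer \<delta> x y \<Longrightarrow>
      real (card {i \<in> {..<N}. measure (\<mu> i) A \<notin> {0, 1}}) \<le> M"
    and small: "4 * (2 * real DIM('a) * (1 + 2 / \<delta>) ^ (DIM('a) - 1))\<^sup>2 * exp (- 2 * t\<^sup>2 / M) < 1"
  obtains Z :: "'a set" where "Z \<subseteq> sphere 0 1" "finite Z" "card Z = N"
    "wedge_discrepancy Z \<le> t / real N + 4 * \<delta> * sqrt ((real DIM('a) + 1) / (2 * pi))"
proof -
  interpret S: prob_space "sphere_prob :: 'a measure" by (rule prob_space_sphere_prob)
  define b where "b = 2 * real DIM('a) * (1 + 2 / \<delta>) ^ (DIM('a) - 1)"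
  define e where "e = 4 * \<delta> * sqrt ((real DIM('a) + 1) / (2 * pi))"
  obtain C :: "'a set" where C: "finite C" "C \<subseteq> sphere 0 1" "sphere 0 1 \<subseteq> (\<Union>c\<in>C. ball c \<delta>)" "real (card C) \<le> b"
    using ex_maximal_separated[OF \<delta>] unfolding b_def by metis
  define F where "F = (\<lambda>(x, y). wedge_inner \<delta> x y) ` (C \<times> C) \<union> (\<lambda>(x, y). wedge_outer \<delta> x y) ` (C \<times> C)"
  have F: "finite F" "F \<subseteq> sets sphere_prob" using C(1) wedge_bracket_in_sets by (auto simp: F_def)
  have "card F \<le> card (C \<times> C) + card (C \<times> C)"
    unfolding F_def using C(1) by (intro order_trans[OF card_Un_le] add_mono card_image_le) auto
  then have "real (card F) \<le> real (card (C \<times> C) + card (C \<times> C))" by (simp only: of_nat_le_iff)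
  also have "\<dots> = 2 * (real (card C))\<^sup>2" by (simp add: card_cartesian_product power2_eq_square)
  also have "\<dots> \<le> 2 * b\<^sup>2" using C(4) by (intro mult_left_mono power_mono) auto
  finally have "real (card F) * (2 * exp (- 2 * t\<^sup>2 / M)) \<le> 2 * b\<^sup>2 * (2 * exp (- 2 * t\<^sup>2 / M))"
    by (rule mult_right_mono) simp
  also have "\<dots> < 1" using small by (simp add: b_def)
  finally have smallF: "real (card F) * (2 * exp (- 2 * t\<^sup>2 / M)) < 1" .
  have cutF: "real (card {i \<in> {..<N}. measure (\<mu> i) A \<notin> {0, 1}}) \<le> M" if A: "A \<in> F" for A
  proof -
    obtain x y where xy: "x \<in> C" "y \<in> C" "A = wedge_inner \<delta> x y \<or> A = wedge_outer \<delta> x y"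
      using A by (auto simp: F_def)
    then have "norm x = 1" "norm y = 1" using C(2) by auto
    then show ?thesis using xy(3) by (rule cut)
  qed
  obtain Z where Z: "Z \<subseteq> sphere 0 1" "finite Z" "card Z = N"
    "\<And>A. A \<in> F \<Longrightarrow> \<bar>real (card (Z \<inter> A)) - real N * S.prob A\<bar> \<le> t"
    using ex_points_of_measures[OF dim N P S tot F cutF t smallF] by metis
  have N0: "real N > 0" using N by simp
  have "wedge_discrepancy Z \<le> t / real N + e"
  proof (rule wedge_discrepancy_le)
    fix x y :: 'a assume xy: "norm x = 1" "norm y = 1"
    obtain x0 where x0: "x0 \<in> C" "dist x0 x < \<delta>" using C(3) xy by force
    obtain y0 where y0: "y0 \<in> C" "dist y0 y < \<delta>" using C(3) xy by force
    let ?L = "wedge_inner \<delta> x0 y0" and ?U = "wedge_outer \<delta> x0 y0"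
    have br: "?L \<subseteq> wedge x y" "wedge x y \<subseteq> ?U"
      using wedge_bracket[OF x0(2) y0(2)] by auto
    have LU: "?L \<in> F" "?U \<in> F" using x0 y0 by (auto simp: F_def)
    have n0: "norm x0 = 1" "norm y0 = 1" using x0 y0 C(2) by auto
    have U: "S.prob ?U \<le> S.prob ?L + e"
      unfolding e_def using n0 \<delta> by (intro measure_wedge_outer_le) auto
    have m: "S.prob ?L \<le> S.prob (wedge x y)" "S.prob (wedge x y) \<le> S.prob ?U"
      using br by (auto intro!: S.finite_measure_mono)
    have cd: "real (card (Z \<inter> ?L)) \<le> real (card (Z \<inter> wedge x y))" "real (card (Z \<inter> wedge x y)) \<le> real (card (Z \<inter> ?U))"
      using br Z(2) by (auto intro!: card_mono)
    have "(real N * S.prob ?L - t) / real N \<le> real (card (Z \<inter> ?L)) / real N"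
      using Z(4)[OF LU(1)] by (intro divide_right_mono) auto
    then have dL: "S.prob ?L - t / real N \<le> real (card (Z \<inter> ?L)) / real N"
      using N0 by (simp add: diff_divide_distrib)
    have "real (card (Z \<inter> ?U)) / real N \<le> (real N * S.prob ?U + t) / real N"
      using Z(4)[OF LU(2)] by (intro divide_right_mono) auto
    then have dU: "real (card (Z \<inter> ?U)) / real N \<le> S.prob ?U + t / real N"
      using N0 by (simp add: add_divide_distrib)
    have "real (card (Z \<inter> ?L)) / real N \<le> real (card (Z \<inter> wedge x y)) / real N"
      "real (card (Z \<inter> wedge x y)) / real N \<le> real (card (Z \<inter> ?U)) / real N"
      using cd by (auto intro!: divide_right_mono)
    then show "\<bar>real (card (Z \<inter> wedge x y)) / real (card Z) - S.prob (wedge x y)\<bar> \<le> t / real N + e"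
      using dL dU m U by (simp add: Z(3) abs_le_iff)
  qed
  then show ?thesis using that[OF Z(1-3)] by (simp add: e_def)
qed

subsection \<open>The upper bound\<close>

text \<open>The base case d = 2 gives 24/25, so 2/5 is nearly the largest possible ratio.\<close>

lemma power_two_fifths_bound:
  assumes "d \<ge> 2"
  shows "2 * (real d + 1) * (2 / 5) ^ d \<le> 1"
  using assms
proof (induction d rule: nat_induct_at_least)
  case base
  show ?case by (simp add: power2_eq_square)
next
  case (Suc d)
  have "2 * (real (Suc d) + 1) * (2 / 5) ^ Suc d = (real d + 2) * (2 / 5) * (2 * (2 / 5) ^ d)"
    by simp
  also have "\<dots> \<le> (real d + 1) * (2 * (2 / 5) ^ d)"
    using Suc.hyps by (intro mult_right_mono) auto
  also have "\<dots> \<le> 1" using Suc.IH by (simp add: algebra_simps)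
  finally show ?case .
qed

lemma ex_points_wedge_discrepancy_explicit:
  assumes dim: "DIM('a::euclidean_space) = d + 1" and d: "d \<ge> 2" and N: "N \<ge> 100 * d"
  obtains Z :: "'a::euclidean_space set" where "Z \<subseteq> sphere 0 1" "finite Z" "card Z = N"
    "wedge_discrepancy Z \<le> 20 * real d powr (3 / 4 + 1 / (4 * real d))
            * real N powr (- 1 / 2 - 1 / (2 * real d)) * sqrt (ln (real N))"
proof -
  define n where "n = real N"
  define D where "D = real d"
  have D: "D \<ge> 2" using d by (simp add: D_def)
  have n: "n \<ge> 100 * D" "n \<ge> 200" "n > 0" "n \<ge> 1"
  proof -
    have "real N \<ge> real (100 * d)" using N by (simp only: of_nat_le_iff)
    then show "n \<ge> 100 * D" by (simp add: n_def D_def)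
    then show "n \<ge> 200" "n > 0" "n \<ge> 1" using D by auto
  qed
  have dim2: "DIM('a) \<ge> 2" and dimr: "real DIM('a) = D + 1" using dim d by (simp_all add: D_def)
  define q where "q = n powr (- 1 / 2 - 1 / (2 * D))"
  define R where "R = n powr (1 / D)"
  define E where "E = n powr (1 - 1 / D)"
  define l where "l = ln n"
  define s where "s = sqrt ((real DIM('a) + 1) / (2 * pi))"
  have l: "l \<ge> 4"
  proof -
    have "exp (4 * 1) = exp (1::real) ^ 4" using exp_of_nat_mult[of 4 "1::real"] by simp
    also have "\<dots> \<le> 3 ^ 4" using exp_le by (intro power_mono) auto
    also have "\<dots> \<le> n" using n by simp
    finally show ?thesis using n by (simp add: l_def ln_ge_iff)
  qed
  have R: "R \<ge> 1" unfolding R_def using n D by (intro ge_one_powr_ge_zero) auto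
  have E: "E > 0" unfolding E_def using n by simp
  have nRE: "n = R * E"
    unfolding R_def E_def powr_add[symmetric] using n by simp
  have q: "q > 0" unfolding q_def using n by simp
  have "1 / (2 * D) \<ge> 0" using D by simp
  then have "q \<le> n powr 0" unfolding q_def using n by (intro powr_mono) linarith+
  then have q1: "q \<le> 1" using n by simp
  have qR: "q \<le> 1 / R"
  proof -
    have "q \<le> n powr (- (1 / D))"
      unfolding q_def using n D by (intro powr_mono) (auto simp: field_simps)
    then show ?thesis by (simp add: R_def powr_minus_divide)
  qed
  have nq: "(n * q)\<^sup>2 = E"
  proof -
    have "n * q = n powr 1 * q" using n by simp
    also have "\<dots> = n powr (1 / 2 - 1 / (2 * D))" unfolding q_def powr_add[symmetric] by simp
    finally have "(n * q)\<^sup>2 = n powr ((1 / 2 - 1 / (2 * D)) + (1 / 2 - 1 / (2 * D)))"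
      by (simp only: power2_eq_square powr_add)
    also have "(1 / 2 - 1 / (2 * D)) + (1 / 2 - 1 / (2 * D)) = 1 - 1 / D" by (simp add: field_simps)
    finally show ?thesis by (simp add: E_def)
  qed
  have s: "s \<le> 3 / 5 * sqrt D" "s \<ge> 0"
  proof -
    have "(real DIM('a) + 1) / (2 * pi) \<le> (3 / 5)\<^sup>2 * D"
    proof -
      have "D + 2 \<le> 2 * D" using D by simp
      also have "\<dots> \<le> 2 * 3 * (9 / 25 * D)" using D by simp
      also have "\<dots> \<le> 2 * pi * (9 / 25 * D)" using D pi_gt3 by (intro mult_right_mono) auto
      finally show ?thesis using pi_gt_zero by (simp add: dimr divide_le_eq power2_eq_square mult_ac)
    qed
    then have "s \<le> sqrt ((3 / 5)\<^sup>2 * D)" unfolding s_def by (rule real_sqrt_le_mono)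
    then show "s \<le> 3 / 5 * sqrt D" by (simp add: real_sqrt_mult)
    show "s \<ge> 0" using dimr D by (simp add: s_def)
  qed
  \<comment> \<open>Chosen so that \<open>w\<^sup>2 = D * sqrt D\<close>: one factor
    \<open>D\<close> for the logarithm of the number of brackets, and \<open>sqrt D\<close> for the
    number \<open>M\<close> of random draws.\<close>
  define w where "w = D powr (3 / 4)"
  have w: "w > 0" using D by (simp add: w_def)
  have w2: "w\<^sup>2 = D * sqrt D"
  proof -
    have "w\<^sup>2 = D powr (1 + 1 / 2)" by (simp add: w_def power2_eq_square flip: powr_add)
    also have "\<dots> = D * sqrt D" unfolding powr_add using D by (simp add: powr_half_sqrt)
    finally show ?thesis .
  qed
  define \<delta> where "\<delta> = 2 * q"
  \<comment> \<open>17 is the least integer with 2 * 17^2 = 578 at least 3 * 192 = 576, so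
    Hoeffding's exponent \<open>2 * t\<^sup>2 / M\<close> reaches \<open>3 * D * l\<close> and beats
    a count below \<open>n ^ (3 * d)\<close>.\<close>
  define t where "t = 17 * w * n * q * sqrt l"
  define M where "M = 192 * sqrt D * E"
  have \<delta>: "0 < \<delta>" "\<delta> \<le> 2" using q q1 by (simp_all add: \<delta>_def)
  have t: "t > 0" using w n q l by (simp add: t_def)
  have M: "M > 0" using D E by (simp add: M_def)
  have N1: "N \<ge> 1" using N d by simp
  have small: "4 * (2 * real DIM('a) * (1 + 2 / \<delta>) ^ (DIM('a) - 1))\<^sup>2 * exp (- 2 * t\<^sup>2 / M) < 1"
  proof -
    have "t\<^sup>2 = 289 * w\<^sup>2 * (n * q)\<^sup>2 * l"
      using l by (simp add: t_def power_mult_distrib)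
    also have "\<dots> = 289 * (D * sqrt D) * E * l" by (simp only: w2 nq)
    finally have t2: "t\<^sup>2 = 289 * (D * sqrt D) * E * l" .
    have "3 * D * l * M \<le> 2 * t\<^sup>2" using D E l by (simp add: t2 M_def)
    then have "3 * D * l \<le> 2 * t\<^sup>2 / M" using M by (simp add: field_simps)
    then have "exp (- 2 * t\<^sup>2 / M) \<le> exp (- (3 * D * l))" by simp
    also have "\<dots> = 1 / n ^ (3 * d)"
    proof -
      have "exp (3 * D * l) = exp (real (3 * d) * l)" by (simp add: D_def)
      also have "\<dots> = n ^ (3 * d)" unfolding exp_of_nat_mult using n by (simp add: l_def)
      finally show ?thesis by (simp add: exp_minus divide_inverse)
    qed
    finally have ex: "exp (- 2 * t\<^sup>2 / M) \<le> 1 / n ^ (3 * d)" .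
    define Q where "Q = n powr (1 / 2 + 1 / (2 * D))"
    have Q1: "Q \<ge> 1" unfolding Q_def using n D by (intro ge_one_powr_ge_zero) auto
    have "2 / \<delta> = 1 / q" by (simp add: \<delta>_def)
    also have "\<dots> = Q"
    proof -
      have "q = n powr (- (1 / 2 + 1 / (2 * D)))" unfolding q_def by (rule arg_cong[where f = "(powr) n"]) simp
      then have "q = 1 / Q" by (simp only: Q_def powr_minus_divide)
      then show ?thesis by simp
    qed
    finally have dQ: "2 / \<delta> = Q" .
    have Q2: "Q ^ (2 * d) = n ^ (d + 1)"
    proof -
      have "Q ^ (2 * d) = Q powr (real (2 * d))" using Q1 by (simp only: powr_realpow)
      also have "\<dots> = n powr (real (d + 1))"
        unfolding Q_def powr_powr using D by (intro arg_cong[where f = "(powr) n"]) (simp add: D_def field_simps)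
      also have "\<dots> = n ^ (d + 1)" using n by (simp only: powr_realpow)
      finally show ?thesis .
    qed
    have "(1 + 2 / \<delta>) ^ (2 * d) \<le> (2 * Q) ^ (2 * d)"
      unfolding dQ using Q1 by (intro power_mono) auto
    also have "\<dots> = 4 ^ d * n ^ (d + 1)"
      by (simp only: power_mult_distrib Q2) (simp add: power_mult)
    finally have p1: "(1 + 2 / \<delta>) ^ (2 * d) \<le> 4 ^ d * n ^ (d + 1)" .
    have "4 * (2 * real DIM('a) * (1 + 2 / \<delta>) ^ (DIM('a) - 1))\<^sup>2 = 16 * (D + 1)\<^sup>2 * (1 + 2 / \<delta>) ^ (2 * d)"
    proof -
      have "DIM('a) - 1 = d" using dim by simp
      moreover have "(2 * (D + 1) * (1 + 2 / \<delta>) ^ d)\<^sup>2 = 4 * ((D + 1)\<^sup>2 * ((1 + 2 / \<delta>) ^ d)\<^sup>2)"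
        unfolding power_mult_distrib by simp
      moreover have "((1 + 2 / \<delta>) ^ d)\<^sup>2 = (1 + 2 / \<delta>) ^ (2 * d)"
        by (simp only: power_mult[symmetric] mult.commute)
      ultimately show ?thesis unfolding dimr by simp
    qed
    also have "\<dots> \<le> 16 * (D + 1)\<^sup>2 * (4 ^ d * n ^ (d + 1))"
      using p1 by (intro mult_left_mono) auto
    also have "\<dots> < n ^ (3 * d)"
    proof -
      \<comment> \<open>Splits the exponent: \<open>3 * d = 2 + (2 * k + 1) + (d + 1)\<close>. The
        square absorbs \<open>(D + 1)\<^sup>2\<close> through \<open>n \<ge> 100 * D\<close>, the
        middle power absorbs what is left of \<open>4 ^ d\<close>, and the last comes from the
        net.\<close>
      obtain k where k: "d = k + 2" using d by (metis le_add_diff_inverse2)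
      have "(D + 1)\<^sup>2 \<le> (2 * D)\<^sup>2" using D by (intro power_mono) auto
      then have "16 * (D + 1)\<^sup>2 * 4 ^ d \<le> 16 * (2 * D)\<^sup>2 * 4 ^ d" by (intro mult_right_mono mult_left_mono) auto
      also have "\<dots> = (1024 * D\<^sup>2) * 4 ^ k" by (simp add: k power_add power_mult_distrib)
      also have "\<dots> < (10000 * D\<^sup>2) * 4 ^ k" using D by (intro mult_strict_right_mono) auto
      also have "\<dots> = (100 * D)\<^sup>2 * 4 ^ k" by (simp add: power_mult_distrib)
      also have "\<dots> \<le> n\<^sup>2 * n ^ (2 * k + 1)"
      proof (intro mult_mono power_mono)
        have "(4::real) ^ k \<le> n ^ k" using n by (intro power_mono) auto
        also have "\<dots> \<le> n ^ (2 * k + 1)" using n by (intro power_increasing) auto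
        finally show "(4::real) ^ k \<le> n ^ (2 * k + 1)" .
      qed (use n D in auto)
      finally have "16 * (D + 1)\<^sup>2 * 4 ^ d * n ^ (d + 1) < n\<^sup>2 * n ^ (2 * k + 1) * n ^ (d + 1)"
        using n by (intro mult_strict_right_mono) auto
      also have "\<dots> = n ^ (3 * d)" unfolding power_add[symmetric] by (rule arg_cong[where f = "(^) n"]) (simp add: k)
      finally show ?thesis by (simp add: mult.assoc)
    qed
    finally have b: "4 * (2 * real DIM('a) * (1 + 2 / \<delta>) ^ (DIM('a) - 1))\<^sup>2 < n ^ (3 * d)" .
    have np: "n ^ (3 * d) > 0" using n by simp
    have "4 * (2 * real DIM('a) * (1 + 2 / \<delta>) ^ (DIM('a) - 1))\<^sup>2 * exp (- 2 * t\<^sup>2 / M)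
        \<le> 4 * (2 * real DIM('a) * (1 + 2 / \<delta>) ^ (DIM('a) - 1))\<^sup>2 * (1 / n ^ (3 * d))"
      using ex by (rule mult_left_mono) simp
    also have "\<dots> < n ^ (3 * d) * (1 / n ^ (3 * d))"
      using b np by (intro mult_strict_right_mono) auto
    also have "\<dots> = 1" using n by simp
    finally show ?thesis .
  qed
  have final: "t / real N + 4 * \<delta> * sqrt ((real DIM('a) + 1) / (2 * pi)) \<le>
      20 * real d powr (3 / 4 + 1 / (4 * real d)) * real N powr (- 1 / 2 - 1 / (2 * real d)) * sqrt (ln (real N))"
  proof -
    \<comment> \<open>The gap between the brackets is at most
      \<open>3 * q * (8 / 5 * sqrt D)\<close>, so this turns it into 3 units of the main term; with
      the 17 of \<open>t\<close> they make the constant 20. It uses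
      \<open>l \<ge> 4\<close>.\<close>
    have "(8 / 5 * sqrt D)\<^sup>2 \<le> (w * sqrt l)\<^sup>2"
    proof -
      have "64 / 25 * D \<le> 4 * D" using D by simp
      also have "\<dots> \<le> D * sqrt D * l"
        using D l mult_mono[of 1 "sqrt D" 4 l] by (simp add: mult.assoc mult_left_mono)
      finally have "64 / 25 * D \<le> D * sqrt D * l" .
      moreover have "(8 / 5 * sqrt D)\<^sup>2 = 64 / 25 * D"
        unfolding power_mult_distrib using D by (simp add: power_divide)
      moreover have "(w * sqrt l)\<^sup>2 = D * sqrt D * l"
        unfolding power_mult_distrib w2 using l by simp
      ultimately show ?thesis by (simp only:)
    qed
    moreover have "0 \<le> w * sqrt l" using w l by simp
    ultimately have wl: "8 / 5 * sqrt D \<le> w * sqrt l" by (rule power2_le_imp_le)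
    have "4 * \<delta> * s = 8 * q * s" by (simp add: \<delta>_def)
    also have "\<dots> \<le> 8 * q * (3 / 5 * sqrt D)" using s(1) q by (intro mult_left_mono) auto
    also have "\<dots> = 3 * q * (8 / 5 * sqrt D)" by simp
    also have "\<dots> \<le> 3 * q * (w * sqrt l)" using wl q by (intro mult_left_mono) auto
    finally have "t / n + 4 * \<delta> * s \<le> 20 * w * q * sqrt l"
      using n by (simp add: t_def)
    also have "\<dots> \<le> 20 * D powr (3 / 4 + 1 / (4 * D)) * q * sqrt l"
    proof -
      have "w \<le> D powr (3 / 4 + 1 / (4 * D))" unfolding w_def using D by (intro powr_mono) auto
      then show ?thesis using q l by (intro mult_right_mono) auto
    qed
    finally show ?thesis by (simp add: n_def D_def s_def q_def l_def)
  qed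
  show ?thesis
  proof (cases "R \<le> 192 * sqrt D")
    \<comment> \<open>The number \<open>n = R * E\<close> of all draws is already at most
      \<open>M\<close>, so independent uniform points need no localization.\<close>
    case True
    interpret S: prob_space "sphere_prob :: 'a measure" by (rule prob_space_sphere_prob)
    have cut: "real (card {i \<in> {..<N}. measure ((\<lambda>_::nat. sphere_prob :: 'a measure) i) A \<notin> {0, 1}}) \<le> M" for A
    proof -
      have "card {i \<in> {..<N}. S.prob A \<notin> {0, 1}} \<le> card {..<N}" by (intro card_mono) auto
      then have "real (card {i \<in> {..<N}. S.prob A \<notin> {0, 1}}) \<le> n" by (simp add: n_def)
      also have "n \<le> 192 * sqrt D * E" unfolding nRE using True E by (intro mult_right_mono) auto
      finally show ?thesis by (simp add: M_def)
    qed
    obtain Z :: "'a set" where Z: "Z \<subseteq> sphere 0 1" "finite Z" "card Z = N"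
      "wedge_discrepancy Z \<le> t / real N + 4 * \<delta> * sqrt ((real DIM('a) + 1) / (2 * pi))"
      by (rule ex_points_wedge_discrepancy[OF dim2 N1, of "\<lambda>_. sphere_prob :: 'a measure", OF prob_space_sphere_prob refl _ \<delta> t cut small])
        (auto intro: that)
    show ?thesis using Z final by (intro that[OF Z(1-3)]) linarith
  next
    case False
    have sD: "sqrt D \<ge> 1" using D by simp
    have R192: "R \<ge> 192" using False sD by linarith
    \<comment> \<open>4/11 is slightly below 2/5, so \<open>1 + 4 / r \<le> 2 / 5 * R\<close> for
      \<open>R \<ge> 192\<close>, and the cells have mass at least 1/N by
      \<open>power_two_fifths_bound\<close>.\<close>
    define r where "r = 11 / R"
    have r: "0 < r" "r \<le> 2" using R192 by (simp_all add: r_def field_simps)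
    have NR: "2 * real DIM('a) * (1 + 4 / r) ^ (DIM('a) - 1) \<le> real N"
    proof -
      have "1 + 4 / r \<le> 2 / 5 * R" using R192 by (simp add: r_def)
      then have "(1 + 4 / r) ^ d \<le> (2 / 5 * R) ^ d" using r by (intro power_mono) auto
      also have "\<dots> = (2 / 5) ^ d * n"
      proof -
        have "R ^ d = R powr D" using R by (simp add: D_def powr_realpow)
        also have "\<dots> = n" using D n by (simp add: R_def powr_powr)
        finally show ?thesis unfolding power_mult_distrib by simp
      qed
      finally have "2 * (D + 1) * (1 + 4 / r) ^ d \<le> 2 * (D + 1) * ((2 / 5) ^ d * n)"
        using D by (intro mult_left_mono) auto
      also have "\<dots> = 2 * (D + 1) * (2 / 5) ^ d * n" by simp
      also have "\<dots> \<le> 1 * n"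
        using power_two_fifths_bound[OF d] n by (intro mult_right_mono) (auto simp: D_def)
      finally show ?thesis unfolding dimr unfolding dim by (simp add: n_def)
    qed
    obtain \<mu> :: "nat \<Rightarrow> 'a measure" and c :: "nat \<Rightarrow> 'a" where \<mu>:
      "\<And>i. prob_space (\<mu> i)" "\<And>i. sets (\<mu> i) = sets sphere_prob"
      "\<And>i. i < N \<Longrightarrow> norm (c i) = 1"
      "\<And>i. i < N \<Longrightarrow> measure (\<mu> i) (ball (c i) (3 * r) \<inter> sphere 0 1) = 1"
      "\<And>A. A \<in> sets sphere_prob \<Longrightarrow> (\<Sum>i<N. measure (\<mu> i) A) = real N * measure sphere_prob A"
      by (rule ex_jittered_measures[OF dim2 r NR]) (rule that)
    have cut: "real (card {i \<in> {..<N}. measure (\<mu> i) A \<notin> {0, 1}}) \<le> M"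
      if "norm x = 1" "norm y = 1" "A = wedge_inner \<delta> x y \<or> A = wedge_outer \<delta> x y" for A x y
    proof -
      have "real (card {i \<in> {..<N}. measure (\<mu> i) A \<notin> {0, 1}}) \<le> n * (4 * (2 * (3 * r) + \<delta>) * s)"
        unfolding n_def s_def
        by (rule wedge_bracket_cut_count[OF \<mu>(1-5) that(3,1,2) \<delta>(1)]) (use r in auto)
      \<comment> \<open>68 = 2 * 3 * 11 + 2: twice the cap radius \<open>3 * r\<close>, plus
        \<open>\<delta> = 2 * q\<close> with \<open>q \<le> 1 / R\<close>. The product 816/5 stays
        below the 192 of \<open>M\<close>.\<close>
      also have "\<dots> \<le> n * (4 * (68 / R) * (3 / 5 * sqrt D))"
        using s qR n q by (intro mult_left_mono mult_mono) (auto simp: \<delta>_def r_def R_def)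
      also have "\<dots> = n / R * (816 / 5 * sqrt D)" by simp
      also have "n / R = E" using nRE R by simp
      also have "E * (816 / 5 * sqrt D) \<le> M" using E D by (simp add: M_def)
      finally show ?thesis .
    qed
    obtain Z :: "'a set" where Z: "Z \<subseteq> sphere 0 1" "finite Z" "card Z = N"
      "wedge_discrepancy Z \<le> t / real N + 4 * \<delta> * sqrt ((real DIM('a) + 1) / (2 * pi))"
      by (rule ex_points_wedge_discrepancy[OF dim2 N1 \<mu>(1,2,5) \<delta> t cut small]) (auto intro: that)
    show ?thesis using Z final by (intro that[OF Z(1-3)]) linarith
  qed
qed

text \<open>A connected set with two distinct points is infinite.\<close>

lemma ex_points_on_sphere:
  assumes dim: "DIM('a::euclidean_space) \<ge> 2"
  obtains Z :: "'a::euclidean_space set" where "Z \<subseteq> sphere 0 1" "finite Z" "card Z = N"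
proof -
  obtain z :: 'a where z: "norm z = 1" using vector_choose_size[of 1] by auto
  have "z \<noteq> - z"
  proof
    assume "z = - z"
    then have "2 *\<^sub>R z = 0" by (simp add: scaleR_2 eq_neg_iff_add_eq_0)
    then show False using z by simp
  qed
  moreover have "z \<in> sphere 0 1" "- z \<in> sphere 0 1" using z by auto
  ultimately have "infinite (sphere (0::'a) 1)"
    using connected_finite_iff_sing[OF connected_sphere[OF dim, of 0 1]] by fastforce
  then show ?thesis
    using infinite_arbitrarily_large[of "sphere (0::'a) 1" N] that by blast
qed

lemma wedge_discrepancy_le_1: "wedge_discrepancy (Z :: 'a::euclidean_space set) \<le> 1"
proof (rule wedge_discrepancy_le)
  fix x y :: 'a
  interpret prob_space "sphere_prob :: 'a measure" by (rule prob_space_sphere_prob)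
  have "real (card (Z \<inter> wedge x y)) / real (card Z) \<le> 1"
    by (cases "finite Z") (auto simp: divide_le_eq_1 card_gt_0_iff intro!: card_mono)
  moreover have "0 \<le> real (card (Z \<inter> wedge x y)) / real (card Z)" by simp
  ultimately show "\<bar>real (card (Z \<inter> wedge x y)) / real (card Z) - prob (wedge x y)\<bar> \<le> 1"
    using prob_le_1[of "wedge x y"] measure_nonneg[of sphere_prob "wedge x y"] by linarith
qed

theorem theorem1p18:
  fixes d :: nat
  assumes "d \<ge> 2" and "CARD('n::finite) = d + 1"
  shows "\<exists>B C :: real. B > 0 \<and> C > 0 \<and>
    (\<forall>N::nat. N \<ge> 2 \<longrightarrow>
      (\<exists>Z :: (real^'n) set. Z \<subseteq> sphere 0 1 \<and> finite Z \<and> card Z = N \<and>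
        wedge_discrepancy Z \<le>
          C * real N powr (- 1 / 2 - 1 / (2 * real d)) * sqrt (ln (real N)))) \<and>
    (\<forall>N::nat. N \<ge> 100 * d \<longrightarrow>
      (\<exists>Z :: (real^'n) set. Z \<subseteq> sphere 0 1 \<and> finite Z \<and> card Z = N \<and>
        wedge_discrepancy Z \<le>
          20 * real d powr (3 / 4 + 1 / (4 * real d))
            * real N powr (- 1 / 2 - 1 / (2 * real d)) * sqrt (ln (real N)))) \<and>
    (\<forall>N::nat. N \<ge> 1 \<longrightarrow>
      (\<forall>Z :: (real^'n) set. Z \<subseteq> sphere 0 1 \<and> finite Z \<and> card Z = N \<longrightarrow>
        wedge_discrepancy Z \<ge> B * real N powr (- 1 / 2 - 1 / (2 * real d))))"
proof -
  have dim: "DIM(real^'n) = d + 1" using assms(2) by simp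
  have dim2: "DIM(real^'n) \<ge> 2" using dim assms(1) by simp
  define q where "q N = real N powr (- 1 / 2 - 1 / (2 * real d))" for N
  define K where "K = 20 * real d powr (3 / 4 + 1 / (4 * real d))"
  define B where "B = 1 / (8 * pi * sqrt (sqrt (real d + 1)))"
  \<comment> \<open>The second entry serves \<open>2 \<le> N < 100 * d\<close>, where any point set
    will do: the discrepancy is at most 1, while \<open>q N \<ge> 1 / N\<close> and
    \<open>ln N \<ge> ln 2\<close>.\<close>
  define C where "C = max K (100 * real d / sqrt (ln 2))"
  have B: "B > 0" by (simp add: B_def)
  have K: "K > 0" using assms(1) by (simp add: K_def)
  then have C: "C > 0" "K \<le> C" "100 * real d / sqrt (ln 2) \<le> C" by (auto simp: C_def)
  have big: "\<exists>Z :: (real^'n) set. Z \<subseteq> sphere 0 1 \<and> finite Z \<and> card Z = N \<and> wedge_discrepancy Z \<le> K * q N * sqrt (ln (real N))"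
    if "N \<ge> 100 * d" for N
    using ex_points_wedge_discrepancy_explicit[OF dim assms(1) that] unfolding K_def q_def by metis
  have all: "\<exists>Z :: (real^'n) set. Z \<subseteq> sphere 0 1 \<and> finite Z \<and> card Z = N \<and> wedge_discrepancy Z \<le> C * q N * sqrt (ln (real N))"
    if N: "N \<ge> 2" for N
  proof (cases "N \<ge> 100 * d")
    case True
    have "K * q N * sqrt (ln (real N)) \<le> C * q N * sqrt (ln (real N))"
      using C(2) N by (intro mult_right_mono) (auto simp: q_def)
    moreover obtain Z :: "(real^'n) set" where "Z \<subseteq> sphere 0 1" "finite Z" "card Z = N"
      "wedge_discrepancy Z \<le> K * q N * sqrt (ln (real N))"
      using big[OF True] by blast
    ultimately show ?thesis by (intro exI[of _ Z] conjI) auto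
  next
    case False
    obtain Z :: "(real^'n) set" where Z: "Z \<subseteq> sphere 0 1" "finite Z" "card Z = N"
      by (rule ex_points_on_sphere[OF dim2]) (rule that)
    have NN: "real N \<ge> 2" "real N \<le> 100 * real d"
    proof -
      show "real N \<ge> 2" using N by simp
      have "real N \<le> real (100 * d)" using False by (simp only: of_nat_le_iff)
      then show "real N \<le> 100 * real d" by simp
    qed
    have "1 / (100 * real d) \<le> 1 / real N" using NN by (intro divide_left_mono) auto
    also have "\<dots> = real N powr (- 1)" using NN powr_minus_divide[of "real N" 1] by simp
    also have "\<dots> \<le> q N" unfolding q_def using NN assms(1) by (intro powr_mono) (auto simp: field_simps)
    finally have q_ge: "1 / (100 * real d) \<le> q N" .
    have l2: "sqrt (ln 2) > 0" by simp
    have "1 = 100 * real d / sqrt (ln 2) * (1 / (100 * real d)) * sqrt (ln 2)"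
      using assms(1) l2 by simp
    also have "\<dots> \<le> C * q N * sqrt (ln (real N))"
      using C q_ge NN by (intro mult_mono) (auto simp: q_def)
    finally show ?thesis using Z wedge_discrepancy_le_1[of Z] by (intro exI[of _ Z]) auto
  qed
  have low: "B * q N \<le> wedge_discrepancy Z"
    if "N \<ge> 1" "Z \<subseteq> sphere 0 1 \<and> finite Z \<and> card Z = N" for N and Z :: "(real^'n) set"
    using wedge_discrepancy_lower_bound[OF dim, of Z N] that assms(1) by (simp add: B_def q_def)
  show ?thesis
  proof (rule exI[of _ B], rule exI[of _ C], intro conjI allI impI, goal_cases)
    case (3 N)
    then show ?case by (rule all[unfolded q_def])
  next
    case (4 N)
    then show ?case by (rule big[unfolded q_def K_def])
  next
    case (5 N Z)
    then show ?case by (rule low[unfolded q_def])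
  qed (use B C(1) in simp_all)
qed

end
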